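(* Let $n=1$. If $\alpha_1>0$ and $r(\lambda)$ has no zeros in $\mathbb{R}\setminus\{0\}$, then the function $W_1(\lambda)=\widetilde v_1(\lambda)-\widetilde v_1(-\lambda)$ is expressed via $S_1(\lambda)=e^{-2i\zeta(\lambda)}$ by the formula $$|W_1(\lambda)|^2=\frac{4\lambda}{\alpha_1}\sin\zeta(\lambda)\cdot\exp\left\{\frac1\pi\,\mathrm{p.v.}\!\int_{\mathbb{R}}\frac{\zeta(t)}{t-\lambda}\,dt\right\}\qquad(\lambda\in\mathbb{R}).$$
   Context: $\alpha_1$ is a non-zero real number and $v_1$ is a non-zero complex-valued function on $\mathbb{R}_+=(0,\infty)$ with $\int_{\mathbb{R}_+}(1+x^2)|v_1(x)|^2dx<\infty$. $\widetilde v_1(\lambda)=\int_{\mathbb{R}_+}e^{-i\lambda x}v_1(x)\,dx$, $\widetilde v_1^*(\lambda)=\overline{\widetilde v_1(\overline\lambda)}$. Let $g_{1,1}(y)=\int_{\mathbb{R}_+}\overline{v_1(x+y)}v_1(x)\,dx$, $\Phi_{1,1}(\lambda)=\int_{\mathbb{R}_+}e^{-i\lambda y}g_{1,1}(y)\,dy$, $\Phi_{1,1}^*(\lambda)=\overline{\Phi_{1,1}(\overline\lambda)}$, and $$r(\lambda)=\Phi_{1,1}^*(\lambda)+\Phi_{1,1}(-\lambda)-\widetilde v_1^*(\lambda)\widetilde v_1(-\lambda)-\frac{2i\lambda}{\alpha_1}\qquad(\lambda\in\mathbb{R}).$$ Let $L_0y=-y''$ in $L^2(\mathbb{R}_+)$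 with domain $\{y\in W_2^2(\mathbb{R}_+):y(0)=0\}$, $R_0(z)=(L_0-zI)^{-1}$, $b_1(z)=1+\alpha_1\langle R_0(z)v_1,v_1\rangle$, and let $B_1^\pm(\lambda)$ ($\lambda\in\mathbb{R}$) be the boundary values of the function $\lambda\mapsto b_1(\lambda^2)$ on $\mathbb{R}$ from the half-planes $\mathbb{C}_\pm$, i.e. $B_1^\pm(\lambda)=\lim_{\varepsilon\to+0}b_1((\lambda\pm i\varepsilon)^2)$; one has $B_1^-(\lambda)=\overline{B_1^+(\lambda)}$ and $B_1^\pm(\infty)=1$. The scattering coefficient of the pair $\{L_1,L_0\}$, $L_1=L_0+\alpha_1\langle\cdot,v_1\rangle v_1$, is $$S_1(\lambda)=-\frac{r(-\lambda)}{r(\lambda)}=\frac{B_1^-(\lambda)}{B_1^+(\lambda)}=e^{-2i\zeta(\lambda)},$$ where $\zeta(\lambda)=\arg B_1^+(\lambda)=-\arg B_1^-(\lambda)$, with the continuous branch of the argument for which $\zeta(\infty)=0$ (so $\zeta$ is real, odd, and $\zeta(\lambda)\ge0$ for $\lambda>0$). "p.v." denotes the principal value integral. *)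

theory Defs
  imports "HOL-Analysis.Analysis"
begin

text \<open>
  Functions on the half-line \<open>(0,\<infinity>)\<close> are represented by functions on \<open>real\<close>; every
  definition below depends only on the values at positive arguments. The spectral parameter is
  called \<open>k\<close>.
\<close>

section \<open>The space \<open>L\<^sup>2(0,\<infinity>)\<close> and the operator \<open>L\<^sub>0\<close>\<close>

definition L2_half :: "(real \<Rightarrow> complex) set" where
  "L2_half = {f. set_borel_measurable lebesgue {0<..} f \<and>
                 set_integrable lebesgue {0<..} (\<lambda>x. (cmod (f x))\<^sup>2)}"

definition inner_half :: "(real \<Rightarrow> complex) \<Rightarrow> (real \<Rightarrow> complex) \<Rightarrow> complex" where
  "inner_half f g = (LINT x:{0<..}|lebesgue. f x * cnj (g x))"

text \<open>
  \<open>ac_deriv y g\<close>: on \<open>(0,\<infinity>)\<close> the function \<open>y\<close> is locally absolutely continuous and \<open>g\<close> is its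
  derivative almost everywhere, i.e. \<open>y\<close> is an indefinite Lebesgue integral of \<open>g\<close>.
\<close>

definition ac_deriv :: "(real \<Rightarrow> complex) \<Rightarrow> (real \<Rightarrow> complex) \<Rightarrow> bool" where
  "ac_deriv y g \<longleftrightarrow>
     (\<forall>a b. 0 < a \<and> a \<le> b \<longrightarrow>
        set_integrable lebesgue {a..b} g \<and> y b - y a = (LINT x:{a..b}|lebesgue. g x))"

text \<open>
  \<open>W22_deriv2 y h\<close>: \<open>y\<close> is the continuous representative of an element of the Sobolev space
  \<open>W\<^sub>2\<^sup>2(0,\<infinity>)\<close>, and \<open>h\<close> is a representative of its second derivative.
\<close>

definition W22_deriv2 :: "(real \<Rightarrow> complex) \<Rightarrow> (real \<Rightarrow> complex) \<Rightarrow> bool" where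
  "W22_deriv2 y h \<longleftrightarrow>
     y \<in> L2_half \<and> h \<in> L2_half \<and> (\<exists>y'\<in>L2_half. ac_deriv y y' \<and> ac_deriv y' h)"

definition W22_half :: "(real \<Rightarrow> complex) set" where
  "W22_half = {y. \<exists>h. W22_deriv2 y h}"

text \<open>The boundary value \<open>y(0)\<close> is the one-sided limit at \<open>0\<close>, which exists on \<open>W22_half\<close>.\<close>

definition dom_L0 :: "(real \<Rightarrow> complex) set" where
  "dom_L0 = {y \<in> W22_half. (y \<longlongrightarrow> 0) (at_right 0)}"

text \<open>
  The second derivative is determined only almost everywhere on \<open>(0,\<infinity>)\<close>; the choice operator
  picks a representative.
\<close>

definition L0 :: "(real \<Rightarrow> complex) \<Rightarrow> real \<Rightarrow> complex" where
  "L0 y = (\<lambda>x. - (SOME h. W22_deriv2 y h) x)"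

text \<open>
  \<open>R0 z f\<close> is a representative of \<open>(L\<^sub>0 - z)\<^sup>-\<^sup>1 f\<close>, meaningful for \<open>z\<close> in the resolvent set of
  \<open>L\<^sub>0\<close>; there the choice is unique on \<open>(0,\<infinity>)\<close>.
\<close>

definition R0 :: "complex \<Rightarrow> (real \<Rightarrow> complex) \<Rightarrow> real \<Rightarrow> complex" where
  "R0 z f = (SOME y. y \<in> dom_L0 \<and> (AE x in lebesgue. 0 < x \<longrightarrow> L0 y x - z * y x = f x))"


section \<open>Boundary values, argument and scattering coefficient\<close>

definition b1 :: "real \<Rightarrow> (real \<Rightarrow> complex) \<Rightarrow> complex \<Rightarrow> complex" where
  "b1 \<alpha> v z = 1 + of_real \<alpha> * inner_half (R0 z v) v"

definition B_plus :: "real \<Rightarrow> (real \<Rightarrow> complex) \<Rightarrow> real \<Rightarrow> complex" where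
  "B_plus \<alpha> v k = Lim (at_right 0) (\<lambda>\<epsilon>::real. b1 \<alpha> v ((of_real k + \<i> * of_real \<epsilon>)\<^sup>2))"

definition B_minus :: "real \<Rightarrow> (real \<Rightarrow> complex) \<Rightarrow> real \<Rightarrow> complex" where
  "B_minus \<alpha> v k = Lim (at_right 0) (\<lambda>\<epsilon>::real. b1 \<alpha> v ((of_real k - \<i> * of_real \<epsilon>)\<^sup>2))"

definition arg_branch :: "(real \<Rightarrow> complex) \<Rightarrow> (real \<Rightarrow> real) \<Rightarrow> bool" where
  "arg_branch F \<zeta> \<longleftrightarrow>
     continuous_on UNIV \<zeta> \<and>
     (\<forall>k. F k = of_real (cmod (F k)) * cis (\<zeta> k)) \<and>
     (\<zeta> \<longlongrightarrow> 0) at_infinity"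

definition zeta :: "real \<Rightarrow> (real \<Rightarrow> complex) \<Rightarrow> real \<Rightarrow> real" where
  "zeta \<alpha> v = (THE \<zeta>. arg_branch (B_plus \<alpha> v) \<zeta>)"

definition v_tilde :: "(real \<Rightarrow> complex) \<Rightarrow> complex \<Rightarrow> complex" where
  "v_tilde v k = (LINT x:{0<..}|lebesgue. exp (- \<i> * k * of_real x) * v x)"

definition g11 :: "(real \<Rightarrow> complex) \<Rightarrow> real \<Rightarrow> complex" where
  "g11 v y = (LINT x:{0<..}|lebesgue. cnj (v (x + y)) * v x)"

definition Phi11 :: "(real \<Rightarrow> complex) \<Rightarrow> complex \<Rightarrow> complex" where
  "Phi11 v k = (LINT y:{0<..}|lebesgue. exp (- \<i> * k * of_real y) * g11 v y)"

definition star :: "(complex \<Rightarrow> complex) \<Rightarrow> complex \<Rightarrow> complex" where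
  "star F k = cnj (F (cnj k))"

definition r_fun :: "real \<Rightarrow> (real \<Rightarrow> complex) \<Rightarrow> real \<Rightarrow> complex" where
  "r_fun \<alpha> v k =
     star (Phi11 v) (of_real k) + Phi11 v (- of_real k)
     - star (v_tilde v) (of_real k) * v_tilde v (- of_real k)
     - 2 * \<i> * of_real k / of_real \<alpha>"

text \<open>
  Always \<open>r(0) = 0\<close>, so this quotient is the scattering coefficient only for \<open>k \<noteq> 0\<close>.
\<close>

definition S1 :: "real \<Rightarrow> (real \<Rightarrow> complex) \<Rightarrow> real \<Rightarrow> complex" where
  "S1 \<alpha> v k = - r_fun \<alpha> v (- k) / r_fun \<alpha> v k"

definition W1 :: "(real \<Rightarrow> complex) \<Rightarrow> real \<Rightarrow> complex" where
  "W1 v k = v_tilde v (of_real k) - v_tilde v (- of_real k)"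


section \<open>Principal value integrals over the real line\<close>

text \<open>
  The singularity is at the point \<open>a\<close>; away from it (in particular at infinity) the integrand
  is required to be absolutely integrable.
\<close>

definition has_pv_integral :: "(real \<Rightarrow> real) \<Rightarrow> real \<Rightarrow> real \<Rightarrow> bool" where
  "has_pv_integral f a I \<longleftrightarrow>
     (\<forall>\<epsilon>>0. set_integrable lebesgue {t. \<epsilon> < \<bar>t - a\<bar>} f) \<and>
     ((\<lambda>\<epsilon>. LINT t:{t. \<epsilon> < \<bar>t - a\<bar>}|lebesgue. f t) \<longlongrightarrow> I) (at_right 0)"

end

theory Submission
  imports Defs "HOL-Complex_Analysis.Complex_Analysis"
begin

text \<open>
  For \<open>Im l > 0\<close> the resolvent \<open>R0 (l\<^sup>2)\<close> has the kernel
  \<open>\<i> / (2 l) (exp (\<i> l \<bar>x - s\<bar>) - exp (\<i> l (x + s)))\<close>, so \<open>F l = b1 (l\<^sup>2)\<close> equals \<open>1 + \<alpha> Q l\<close> for a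
  quadratic form \<open>Q\<close> in \<open>v\<close>. The kernel is bounded by \<open>min x s\<close> and by \<open>1 / \<bar>l\<bar>\<close>; with Hardy's inequality
  this makes \<open>F\<close> continuous on the closed half plane, holomorphic inside, and \<open>1 + O(1 / \<bar>l\<bar>)\<close> at infinity.
  On the real axis \<open>F\<close> is \<open>r\<close> up to the factor \<open>- 2 \<i> k / \<alpha>\<close>, and \<open>Im F\<close> is \<open>\<alpha> \<bar>W1\<bar>\<^sup>2 / (4 k)\<close>.
  In the open half plane the energy identity \<open>Q l = \<bar>y'\<bar>\<^sup>2 - cnj (l\<^sup>2) \<bar>y\<bar>\<^sup>2\<close>, \<open>y = R0 (l\<^sup>2) v\<close>, excludes
  zeros of \<open>F\<close> because \<open>\<alpha> > 0\<close>. Hence \<open>F = exp L\<close> with \<open>L\<close> continuous on the closed half plane and \<open>O(1 / \<bar>l\<bar>)\<close>,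
  \<open>zeta\<close> is \<open>Im L\<close> on the real axis, and Cauchy's theorem on half-annuli around \<open>k\<close> gives
  \<open>p.v. \<integral> zeta t / (t - k) dt = \<pi> Re L k\<close>, that is, \<open>\<bar>F k\<bar>\<close> is the exponential factor in
  \<open>\<bar>W1\<bar>\<^sup>2 = 4 k / \<alpha> \<bar>F\<bar> sin zeta\<close>.
\<close>

section \<open>Logarithms and the Hilbert transform in the half plane\<close>

text \<open>The delicate point is \<open>l = 0\<close>. There the bound \<open>1 / |l|\<close> says
  nothing, and \<open>r_fun\<close> vanishes whatever \<open>v\<close> is, so its assumed lack of
  zeros off \<open>0\<close> does not reach this point. Continuity at \<open>0\<close> comes from
  the weight \<open>x\<^sup>2\<close> in the hypothesis on \<open>v\<close>, through a majorant
  independent of \<open>l\<close>; non-vanishing comes from the sign of \<open>Q\<close> on the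
  imaginary axis. At infinity the rate \<open>1 / |l|\<close> serves twice: it selects the branch of
  the logarithm that tends to \<open>0\<close>, and it makes \<open>zeta t / (t - k)\<close>
  absolutely integrable away from \<open>k\<close>. On the real axis \<open>L\<close> is known only
  to be continuous, so the contour argument has to work up to the boundary without any smoothness
  there. A second obstacle is the form of the definitions: \<open>L0\<close> and \<open>R0\<close>
  are chosen by \<open>SOME\<close> and refer to the completed measure. Uniqueness of second
  derivatives and of resolvent solutions must therefore precede any use of the kernel, and
  \<open>v\<close> is exchanged for a Borel function vanishing off the half-line before Fubini is
  applied.\<close>

lemma exp_eq_one_constant:
  fixes g :: "'a::topological_space \<Rightarrow> complex"
  assumes "connected S" "continuous_on S g" "\<And>x. x \<in> S \<Longrightarrow> exp (g x) = 1"
  shows "g constant_on S"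
proof (rule continuous_discrete_range_constant[OF assms(1,2)])
  fix x assume x: "x \<in> S"
  show "\<exists>e>0. \<forall>y. y \<in> S \<and> g y \<noteq> g x \<longrightarrow> e \<le> norm (g y - g x)"
  \<comment> \<open>Distinct logarithms of \<open>1\<close> are at least \<open>2 * pi\<close>
    apart, so the range of \<open>g\<close> is discrete.\<close>
  proof (intro exI[of _ "2*pi"] conjI allI impI)
    fix y assume y: "y \<in> S \<and> g y \<noteq> g x"
    have "exp (g y) = exp (g x)" using x y assms(3) by simp
    then obtain n :: int where n: "g y = g x + (of_int (2 * n) * pi) * \<i>"
      unfolding exp_eq by auto
    with y have "n \<noteq> 0" by auto
    then have "1 \<le> \<bar>real_of_int n\<bar>" by linarith
    then show "2 * pi \<le> norm (g y - g x)" by (simp add: n norm_mult abs_mult)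
  qed auto
qed

text \<open>Contractibility yields some continuous logarithm \<open>g\<close>, fixed only up to a
  multiple of \<open>2 * pi * \<i>\<close>. Far out \<open>F\<close> is close to \<open>1\<close>,
  so \<open>g\<close> can be compared with the principal branch \<open>Ln\<close>; the difference is
  one constant \<open>c\<close>, and \<open>g - c\<close> inherits the decay of
  \<open>F - 1\<close>.\<close>

lemma half_plane_logarithm:
  fixes F :: "complex \<Rightarrow> complex"
  assumes cont: "continuous_on {z. 0 \<le> Im z} F" and hol: "F holomorphic_on {z. 0 < Im z}"
    and nz: "\<And>z. 0 \<le> Im z \<Longrightarrow> F z \<noteq> 0"
    and decay: "\<And>z. 0 \<le> Im z \<Longrightarrow> z \<noteq> 0 \<Longrightarrow> norm (F z - 1) \<le> C / norm z"
  obtains L D R where "continuous_on {z. 0 \<le> Im z} L" "L holomorphic_on {z. 0 < Im z}"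
    "\<And>z. 0 \<le> Im z \<Longrightarrow> exp (L z) = F z" "0 < R"
    "\<And>z. 0 \<le> Im z \<Longrightarrow> R \<le> norm z \<Longrightarrow> norm (L z) \<le> D / norm z"
proof -
  have "contractible {z. 0 \<le> Im z}"
    by (intro convex_imp_contractible convex_halfspace_Im_ge)
  then obtain g where g: "continuous_on {z. 0 \<le> Im z} g"
    and Fg: "\<And>z. z \<in> {z. 0 \<le> Im z} \<Longrightarrow> F z = exp (g z)"
    using continuous_logarithm_on_contractible[OF cont, of thesis] nz by auto
  \<comment> \<open>The factor \<open>4\<close> keeps \<open>F z\<close> within \<open>1/4\<close>
    of \<open>1\<close>, hence off the cut of \<open>Ln\<close> and within range of the estimate
    \<open>|Ln (1 + w)| \<le> 2 |w|\<close>; the maximum with \<open>1\<close> makes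
    \<open>R\<close> positive whatever the sign of \<open>C\<close>.\<close>
  define R where "R = max 1 (4 * C)"
  have R: "1 \<le> R" "4 * C \<le> R" by (auto simp: R_def)
  have small: "norm (F z - 1) \<le> 1/4" if "0 \<le> Im z" "R \<le> norm z" for z
  proof -
    have "0 < norm z" using that(2) R by linarith
    have "norm (F z - 1) \<le> C / norm z" using decay[of z] that R by fastforce
    also have "\<dots> \<le> 1/4" using \<open>0 < norm z\<close> that R by (simp add: field_simps)
    finally show ?thesis .
  qed
  \<comment> \<open>\<open>exp\<close> maps this half-strip onto the part \<open>|z| \<ge> R\<close>
    of the closed half plane, with \<open>Ln\<close> as inverse. The strip is convex, which gives
    the connectedness needed for comparing two logarithms.\<close>
  define S where "S = {w. ln R \<le> Re w} \<inter> {w. 0 \<le> Im w} \<inter> {w. Im w \<le> pi}"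
  have "convex S" unfolding S_def
    by (intro convex_Int convex_halfspace_Re_ge convex_halfspace_Im_ge convex_halfspace_Im_le)
  then have "connected S" by (rule convex_connected)
  have expS: "0 \<le> Im (exp w)" "R \<le> norm (exp w)" if "w \<in> S" for w
  proof -
    show "0 \<le> Im (exp w)" using that by (auto simp: S_def Im_exp sin_ge_zero)
    have "ln R \<le> Re w" using that by (simp add: S_def)
    then have "exp (ln R) \<le> exp (Re w)" by simp
    then show "R \<le> norm (exp w)" using R by simp
  qed
  have npos: "F z \<notin> \<real>\<^sub>\<le>\<^sub>0" if "0 \<le> Im z" "R \<le> norm z" for z
  proof
    assume "F z \<in> \<real>\<^sub>\<le>\<^sub>0"
    then have "Re (F z) \<le> 0" by (auto simp: complex_nonpos_Reals_iff)
    moreover have "\<bar>Re (F z - 1)\<bar> \<le> 1/4" using small[OF that] abs_Re_le_cmod order_trans by blast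
    ultimately show False by auto
  qed
  have cg: "continuous_on S (\<lambda>w. g (exp w))"
    by (rule continuous_on_compose2[OF g]) (auto intro!: continuous_intros expS)
  have cF: "continuous_on S (\<lambda>w. F (exp w))"
    by (rule continuous_on_compose2[OF cont]) (auto intro!: continuous_intros expS)
  have "(\<lambda>w. g (exp w) - Ln (F (exp w))) constant_on S"
  proof (rule exp_eq_one_constant[OF \<open>connected S\<close>])
    show "continuous_on S (\<lambda>w. g (exp w) - Ln (F (exp w)))"
      by (intro continuous_intros cg cF) (use npos expS in auto)
    show "exp (g (exp w) - Ln (F (exp w))) = 1" if "w \<in> S" for w
      using expS[OF that] nz by (simp add: exp_diff Fg)
  qed
  then obtain c where c: "\<And>w. w \<in> S \<Longrightarrow> g (exp w) - Ln (F (exp w)) = c"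
    unfolding constant_on_def by auto
  have cz: "g z - Ln (F z) = c" if "0 \<le> Im z" "R \<le> norm z" for z
  proof -
    have z: "z \<noteq> 0" using that R by auto
    have "Ln z \<in> S" using z that R by (auto simp: S_def Im_Ln_pos_le ln_mono)
    from c[OF this] z show ?thesis by simp
  qed
  \<comment> \<open>One evaluation, at the point \<open>R\<close>, shows that subtracting
    \<open>c\<close> keeps \<open>g\<close> a logarithm of \<open>F\<close>.\<close>
  have "exp c = 1"
  proof -
    have "exp (g (of_real R) - Ln (F (of_real R))) = exp c" using cz[of "of_real R"] R by simp
    then show ?thesis using nz[of "of_real R"] by (simp add: exp_diff Fg)
  qed
  show ?thesis
  proof (rule that[of "\<lambda>z. g z - c" R "2 * C"])
    show "continuous_on {z. 0 \<le> Im z} (\<lambda>z. g z - c)" by (intro continuous_intros g)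
    show "exp (g z - c) = F z" if "0 \<le> Im z" for z
      using that \<open>exp c = 1\<close> by (simp add: exp_diff Fg)
    show "0 < R" using R by simp
    show "norm (g z - c) \<le> 2 * C / norm z" if "0 \<le> Im z" "R \<le> norm z" for z
    proof -
      have "g z - c = Ln (1 + (F z - 1))" using cz[OF that] by (simp add: algebra_simps)
      also have "norm \<dots> \<le> 2 * norm (F z - 1)" using small[OF that] by (intro norm_Ln_le) auto
      also have "\<dots> \<le> 2 * (C / norm z)" using decay[of z] that R by force
      finally show ?thesis by simp
    qed
    show "(\<lambda>z. g z - c) holomorphic_on {z. 0 < Im z}"
    proof (intro holomorphic_intros)
      have op: "open {z. 0 < Im z}" by (rule open_halfspace_Im_gt)
      have cont': "continuous_on {z. 0 < Im z} g" by (rule continuous_on_subset[OF g]) auto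
      show "g holomorphic_on {z. 0 < Im z}"
        unfolding holomorphic_on_open[OF op]
      proof safe
        fix z0 :: complex assume z0: "0 < Im z0"
        have "isCont g z0" using cont' z0 op continuous_on_eq_continuous_at by blast
        then have "(g \<longlongrightarrow> g z0) (nhds z0)" by (simp add: isCont_def tendsto_at_iff_tendsto_nhds)
        \<comment> \<open>A difference of modulus less than \<open>pi\<close> lies in the strip
          where \<open>Ln\<close> inverts \<open>exp\<close>. So near \<open>z0\<close> the merely
          continuous \<open>g\<close> equals \<open>g z0 + Ln (F z / F z0)\<close>, which is
          differentiable at \<open>z0\<close>.\<close>
        then have "\<forall>\<^sub>F z in nhds z0. dist (g z) (g z0) < pi" using pi_gt_zero tendstoD by blast
        moreover have "\<forall>\<^sub>F z in nhds z0. z \<in> {z. 0 < Im z}" using op z0 by (intro eventually_nhds_in_open) auto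
        ultimately have ev: "\<forall>\<^sub>F z in nhds z0. g z0 + Ln (F z / F z0) = g z"
        proof eventually_elim
          case (elim z)
          have "\<bar>Im (g z - g z0)\<bar> < pi"
            using elim abs_Im_le_cmod[of "g z - g z0"] by (simp add: dist_norm)
          then have "Ln (exp (g z - g z0)) = g z - g z0" by (intro Ln_exp) (auto)
          then show ?case using elim z0 by (simp add: Fg exp_diff)
        qed
        obtain d where d: "(F has_field_derivative d) (at z0)"
          using hol z0 op holomorphic_on_open by blast
        have "\<exists>f'. ((\<lambda>z. g z0 + Ln (F z / F z0)) has_field_derivative f') (at z0)"
          by (rule exI) (rule derivative_eq_intros refl d | use nz[of z0] z0 in simp)+
        then show "\<exists>f'. (g has_field_derivative f') (at z0)"
          using DERIV_cong_ev[OF refl ev refl] by blast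
      qed
    qed
  qed
qed

section \<open>Cauchy's theorem on half-annuli and the principal value\<close>

lemma contour_integral_linepath_same_Im:
  assumes "Im z = c" "Im z' = c" "Re z = a" "Re z' = b" "a < b"
  shows "contour_integral (linepath z z') f = integral {a..b} (\<lambda>x. f (Complex x c))"
proof -
  have z: "z = of_real a + \<i> * of_real c" "z' = of_real b + \<i> * of_real c"
    using assms by (auto simp: complex_eq_iff)
  have zz: "z' - z = of_real b - of_real a" by (simp add: z)
  have lp: "linepath (of_real a) (of_real b) x + \<i> * of_real c = linepath z z' x" for x
    unfolding z linepath_def by (simp add: algebra_simps scaleR_conv_of_real)
  have "contour_integral (linepath z z') f =
    contour_integral (linepath (of_real a) (of_real b)) (\<lambda>w. f (w + \<i> * of_real c))"
    unfolding contour_integral_integral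
    by (intro integral_cong) (simp add: vector_derivative_linepath_within lp zz)
  also have "\<dots> = integral {a..b} (\<lambda>x. f (Complex x c))"
    using \<open>a < b\<close> by (subst contour_integral_linepath_Reals_eq) (auto simp: Complex_eq)
  finally show ?thesis .
qed

text \<open>In the coordinate \<open>w = log (z - k)\<close> the half-annulus around \<open>k\<close> becomes a rectangle, so
  Cauchy's theorem applies to a function that is merely continuous up to the boundary.\<close>

lemma half_annulus_Cauchy:
  fixes L :: "complex \<Rightarrow> complex" and k p q :: real
  assumes cont: "continuous_on {z. 0 \<le> Im z} L" and hol: "L holomorphic_on {z. 0 < Im z}"
    and pq: "p < q"
  shows "integral {p..q} (\<lambda>u. L (of_real (k + exp u))) - integral {p..q} (\<lambda>u. L (of_real (k - exp u))) =
     \<i> * (integral {0..pi} (\<lambda>\<theta>. L (of_real k + exp (Complex p \<theta>)))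
        - integral {0..pi} (\<lambda>\<theta>. L (of_real k + exp (Complex q \<theta>))))"
proof -
  define S where "S = {w. 0 \<le> Im w} \<inter> {w. Im w \<le> pi}"
  define M where "M = (\<lambda>w. L (of_real k + exp w))"
  have Sm: "0 \<le> Im (of_real k + exp w)" if "w \<in> S" for w
    using that by (auto simp: S_def Im_exp sin_ge_zero)
  have cM: "continuous_on S M" unfolding M_def
    by (rule continuous_on_compose2[OF cont]) (auto intro!: continuous_intros Sm[simplified])
  have cvx: "convex S" unfolding S_def
    by (intro convex_Int convex_halfspace_Im_ge convex_halfspace_Im_le)
  have intS: "interior S \<subseteq> {w. 0 < Im w \<and> Im w < pi}"
    unfolding S_def using interior_halfspace_ge[of \<i> 0] interior_halfspace_le[of \<i> pi] by auto
  have dM: "M field_differentiable at w" if "w \<in> interior S - {}" for w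
  proof -
    have "0 < Im (of_real k + exp w)" using that intS by (auto simp: Im_exp sin_gt_zero)
    then have "L field_differentiable at (of_real k + exp w)"
      using hol holomorphic_on_imp_differentiable_at open_halfspace_Im_gt by blast
    then have "(L \<circ> (\<lambda>w. of_real k + exp w)) field_differentiable at w"
      by (intro field_differentiable_compose derivative_intros)
        (auto simp: field_differentiable_def intro: DERIV_exp)
    then show ?thesis by (simp add: M_def o_def)
  qed
  define a b c d where "a = Complex p 0" and "b = Complex q 0" and "c = Complex q pi" and "d = Complex p pi"
  define g where "g = linepath a b +++ linepath b c +++ linepath c d +++ linepath d a"
  have inS: "a \<in> S" "b \<in> S" "c \<in> S" "d \<in> S" by (auto simp: S_def a_def b_def c_def d_def)
  have seg: "closed_segment x y \<subseteq> S" if "x \<in> S" "y \<in> S" for x y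
    using cvx that by (simp add: closed_segment_subset)
  have Mint: "(M has_contour_integral 0) g"
    by (rule Cauchy_theorem_convex[OF cM cvx, of "{}"])
       (use dM seg inS in \<open>auto simp: g_def path_image_join\<close>)
  have ci: "M contour_integrable_on linepath x y" if "x \<in> S" "y \<in> S" for x y
    by (rule contour_integrable_continuous_linepath) (use cM seg[OF that] continuous_on_subset in blast)
  have "contour_integral g M = contour_integral (linepath a b) M + contour_integral (linepath b c) M
     + contour_integral (linepath c d) M + contour_integral (linepath d a) M"
    unfolding g_def using ci inS by (simp add: contour_integrable_joinI algebra_simps)
  also have "contour_integral (linepath c d) M = - contour_integral (linepath d c) M"
    by (metis contour_integral_reverse_linepath cM continuous_on_subset seg inS(3,4))
  also have "contour_integral (linepath d a) M = - contour_integral (linepath a d) M"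
    by (metis contour_integral_reverse_linepath cM continuous_on_subset seg inS(1,4))
  also have "contour_integral (linepath a b) M = integral {p..q} (\<lambda>u. M (Complex u 0))"
    using pq by (subst contour_integral_linepath_same_Im[of _ 0 _ p q]) (auto simp: a_def b_def)
  also have "contour_integral (linepath d c) M = integral {p..q} (\<lambda>u. M (Complex u pi))"
    using pq by (subst contour_integral_linepath_same_Im[of _ pi _ p q]) (auto simp: c_def d_def)
  also have "contour_integral (linepath b c) M = \<i> * integral {0..pi} (\<lambda>u. M (Complex q u))"
    by (subst contour_integral_linepath_same_Re[of _ q _ 0 pi]) (auto simp: b_def c_def)
  also have "contour_integral (linepath a d) M = \<i> * integral {0..pi} (\<lambda>u. M (Complex p u))"
    by (subst contour_integral_linepath_same_Re[of _ p _ 0 pi]) (auto simp: a_def d_def)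
  finally have *: "0 = integral {p..q} (\<lambda>u. M (Complex u 0)) + \<i> * integral {0..pi} (\<lambda>u. M (Complex q u))
     + - integral {p..q} (\<lambda>u. M (Complex u pi)) + - (\<i> * integral {0..pi} (\<lambda>u. M (Complex p u)))"
    using contour_integral_unique[OF Mint] by simp
  \<comment> \<open>The edge \<open>Im w = 0\<close> runs along the real axis to the right of
    \<open>k\<close>, the edge \<open>Im w = pi\<close> to the left of it, because
    \<open>exp (\<i> * pi) = - 1\<close>.\<close>
  have e1: "M (Complex u 0) = L (of_real (k + exp u))" for u
    by (simp add: M_def complex_eq_iff Complex_eq exp_of_real)
  have e2: "M (Complex u pi) = L (of_real (k - exp u))" for u
    by (simp add: M_def Complex_eq exp_add exp_of_real)
  show ?thesis using * unfolding e1 e2 by (simp add: M_def algebra_simps)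
qed

text \<open>The common majorant for several estimates below. The antiderivative
  \<open>arctan\<close> settles the half-line; the half-line function plus its reflection dominates
  the whole (both count at \<open>0\<close>, so this is a bound and not an equality).\<close>

lemma integrable_Poisson_weight: "integrable lborel (\<lambda>t::real. 1 / (1 + t\<^sup>2))"
proof -
  have "(\<integral>\<^sup>+ x. ennreal (1 / (1 + x\<^sup>2)) * indicator {0..} x \<partial>lborel) = ennreal (pi/2 - arctan 0)"
    by (rule nn_integral_FTC_atLeast)
       (auto intro!: derivative_eq_intros tendsto_arctan_at_top simp: inverse_eq_divide)
  also have "(\<integral>\<^sup>+ x. ennreal (1 / (1 + x\<^sup>2)) * indicator {0..} x \<partial>lborel)
     = (\<integral>\<^sup>+ x. ennreal (indicator {0..} x / (1 + x\<^sup>2)) \<partial>lborel)"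
    by (intro nn_integral_cong) (auto simp: indicator_def)
  finally have 1: "integrable lborel (\<lambda>t::real. indicator {0..} t / (1 + t\<^sup>2))"
    by (intro integrableI_nonneg) (auto intro!: AE_I2 divide_nonneg_nonneg add_nonneg_nonneg)
  from lborel_integrable_real_affine[OF this, of "-1" 0]
  have 2: "integrable lborel (\<lambda>t::real. indicator {0..} (- t) / (1 + t\<^sup>2))" by simp
  show ?thesis
    by (rule Bochner_Integration.integrable_bound[OF Bochner_Integration.integrable_add[OF 1 2]])
       (auto simp: indicator_def add_nonneg_eq_0_iff intro!: AE_I2 divide_right_mono)
qed

text \<open>\<open>exp (Complex (ln r) \<theta>)\<close> is the point
  \<open>r * cis \<theta>\<close> of the arc. The lemma is applied with \<open>c = L k\<close> on
  shrinking arcs and with \<open>c = 0\<close> on growing ones.\<close>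

lemma semicircle_average_bound:
  fixes L :: "complex \<Rightarrow> complex" and k r :: real
  assumes cont: "continuous_on {z. 0 \<le> Im z} L" and "0 < r"
    and bd: "\<And>z. 0 \<le> Im z \<Longrightarrow> norm (z - of_real k) = r \<Longrightarrow> norm (L z - c) \<le> e"
  shows "norm (integral {0..pi} (\<lambda>\<theta>. L (of_real k + exp (Complex (ln r) \<theta>))) - of_real pi * c) \<le> e * pi"
proof -
  have im: "0 \<le> Im (of_real k + exp (Complex (ln r) \<theta>))" if "\<theta> \<in> {0..pi}" for \<theta>
    using that by (auto simp: Im_exp sin_ge_zero)
  have c1: "continuous_on {0..pi} (\<lambda>\<theta>. L (of_real k + exp (Complex (ln r) \<theta>)))"
    by (rule continuous_on_compose2[OF cont]) (use im in \<open>auto intro!: continuous_intros simp: Complex_eq\<close>)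
  have "integral {0..pi} (\<lambda>\<theta>. L (of_real k + exp (Complex (ln r) \<theta>))) - of_real pi * c =
    integral {0..pi} (\<lambda>\<theta>. L (of_real k + exp (Complex (ln r) \<theta>)) - c)"
    by (subst Henstock_Kurzweil_Integration.integral_diff)
       (auto intro!: integrable_continuous_real c1 simp: scaleR_conv_of_real)
  also have "norm \<dots> \<le> e * (pi - 0)"
    by (rule integral_bound) (use im assms(2) in \<open>auto intro!: continuous_intros c1 bd\<close>)
  finally show ?thesis by simp
qed

text \<open>With \<open>A r\<close> the integral of \<open>L\<close> over the arc of radius
  \<open>r\<close>, the truncated integral over \<open>\<epsilon> < |t - k| \<le> r\<close> is
  \<open>Re (A \<epsilon>) - Re (A r)\<close>. Letting \<open>r\<close> tend to infinity removes the
  second term; letting \<open>\<epsilon>\<close> tend to \<open>0\<close> turns the first into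
  \<open>pi * Re (L k)\<close>.\<close>

lemma pv_integral_half_plane:
  fixes L :: "complex \<Rightarrow> complex" and k :: real
  assumes cont: "continuous_on {z. 0 \<le> Im z} L" and hol: "L holomorphic_on {z. 0 < Im z}"
    and "0 < R" and decay: "\<And>z. 0 \<le> Im z \<Longrightarrow> R \<le> norm z \<Longrightarrow> norm (L z) \<le> D / norm z"
  shows "has_pv_integral (\<lambda>t. Im (L (of_real t)) / (t - k)) k (pi * Re (L (of_real k)))"
proof -
  define h where "h = (\<lambda>t::real. Im (L (of_real t)))"
  define \<phi> where "\<phi> = (\<lambda>t. h t / (t - k))"
  define A where "A = (\<lambda>r. integral {0..pi} (\<lambda>\<theta>. L (of_real k + exp (Complex (ln r) \<theta>))))"
  have cL: "continuous_on S (\<lambda>t::real. L (of_real (g t)))" if "continuous_on S g" for S and g :: "real \<Rightarrow> real"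
    by (rule continuous_on_compose2[OF cont]) (auto intro!: continuous_intros that)
  have ch: "continuous_on S h" for S
    unfolding h_def by (intro continuous_intros cL)
  have A_small: "(A \<longlongrightarrow> of_real pi * L (of_real k)) (at_right 0)"
  proof (rule tendstoI)
    fix e :: real assume "0 < e"
    then have e: "0 < e / (2*pi)" by simp
    from cont have "continuous (at (of_real k) within {z. 0 \<le> Im z}) L"
      by (simp add: continuous_on_eq_continuous_within)
    then obtain d where d: "d > 0" "\<And>z. 0 \<le> Im z \<Longrightarrow> norm (z - of_real k) < d \<Longrightarrow> norm (L z - L (of_real k)) < e / (2*pi)"
      using e unfolding continuous_within_eps_delta dist_norm by (metis mem_Collect_eq)
    have "\<forall>\<^sub>F r in at_right (0::real). 0 < r \<and> r < d"
      using d(1) by (auto simp: eventually_at_right_field intro!: exI[of _ d])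
    then show "\<forall>\<^sub>F r in at_right 0. dist (A r) (of_real pi * L (of_real k)) < e"
    proof eventually_elim
      case (elim r)
      have "norm (A r - of_real pi * L (of_real k)) \<le> e / (2*pi) * pi"
        unfolding A_def using elim d(2) by (intro semicircle_average_bound[OF cont]) (auto intro: less_imp_le)
      also have "\<dots> < e" using \<open>0 < e\<close> by simp
      finally show ?case by (simp add: dist_norm)
    qed
  qed
  have A_large: "(A \<longlongrightarrow> 0) at_top"
  proof (rule Lim_null_comparison)
    show "((\<lambda>r. \<bar>D\<bar> / (r - \<bar>k\<bar>) * pi) \<longlongrightarrow> 0) at_top" by real_asymp
    show "\<forall>\<^sub>F r in at_top. norm (A r) \<le> \<bar>D\<bar> / (r - \<bar>k\<bar>) * pi"
      using eventually_gt_at_top[of "R + \<bar>k\<bar>"]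
    proof eventually_elim
      case (elim r)
      have "norm (A r - of_real pi * 0) \<le> \<bar>D\<bar> / (r - \<bar>k\<bar>) * pi"
        unfolding A_def
      proof (rule semicircle_average_bound[OF cont])
        show "0 < r" using elim \<open>0 < R\<close> by simp
        fix z assume z: "0 \<le> Im z" "norm (z - of_real k) = r"
        have "r - \<bar>k\<bar> \<le> norm z" using z(2) norm_triangle_ineq4[of z "of_real k"] by simp
        then have "R \<le> norm z" "0 < r - \<bar>k\<bar>" using elim \<open>0 < R\<close> by auto
        have "norm (L z) \<le> D / norm z" using decay z(1) \<open>R \<le> norm z\<close> by blast
        also have "\<dots> \<le> \<bar>D\<bar> / (r - \<bar>k\<bar>)"
          using \<open>r - \<bar>k\<bar> \<le> norm z\<close> \<open>0 < r - \<bar>k\<bar>\<close> by (intro frac_le) auto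
        finally show "norm (L z - 0) \<le> \<bar>D\<bar> / (r - \<bar>k\<bar>)" by simp
      qed
      then show ?case by simp
    qed
  qed
  \<comment> \<open>The decay is known only for \<open>|t| \<ge> R\<close>. Compactness covers the
    rest, and the factors \<open>1 + R\<close> and \<open>(1 + R) / R\<close> convert both bounds to
    the single weight \<open>1 / (1 + |t|)\<close>.\<close>
  obtain B where B: "\<And>t. norm (h t) \<le> B / (1 + \<bar>t\<bar>)" "B \<ge> 0"
  proof -
    have "compact (h ` {-R..R})" by (intro compact_continuous_image ch) auto
    then obtain B0 where B0: "\<And>t. t \<in> {-R..R} \<Longrightarrow> norm (h t) \<le> B0"
      using compact_imp_bounded bounded_iff by (metis imageI)
    define B where "B = max (\<bar>B0\<bar> * (1 + R)) (\<bar>D\<bar> * (1 + R) / R)"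
    have "norm (h t) \<le> B / (1 + \<bar>t\<bar>)" for t
    proof (cases "\<bar>t\<bar> \<le> R")
      case True
      then have "norm (h t) \<le> \<bar>B0\<bar>" using B0[of t] by force
      then have "norm (h t) * (1 + \<bar>t\<bar>) \<le> \<bar>B0\<bar> * (1 + R)" using True by (intro mult_mono) auto
      also have "\<dots> \<le> B" by (simp add: B_def)
      finally show ?thesis by (simp add: field_simps)
    next
      case False
      have "norm (h t) \<le> norm (L (of_real t))" unfolding h_def by (simp add: abs_Im_le_cmod)
      also have "\<dots> \<le> D / \<bar>t\<bar>" using decay[of "of_real t"] False by simp
      also have "\<dots> \<le> \<bar>D\<bar> / \<bar>t\<bar>" by (intro divide_right_mono) auto
      finally have "norm (h t) * (1 + \<bar>t\<bar>) \<le> \<bar>D\<bar> / \<bar>t\<bar> * (1 + \<bar>t\<bar>)" by (intro mult_right_mono) auto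
      also have "\<dots> = \<bar>D\<bar> * ((1 + \<bar>t\<bar>) / \<bar>t\<bar>)" by simp
      also have "\<dots> \<le> \<bar>D\<bar> * ((1 + R) / R)"
        using False \<open>0 < R\<close> by (intro mult_left_mono) (auto simp: field_simps)
      also have "\<dots> \<le> B" by (simp add: B_def)
      finally show ?thesis by (simp add: field_simps)
    qed
    moreover have "B \<ge> 0" using \<open>0 < R\<close> by (simp add: B_def le_max_iff_disj)
    ultimately show ?thesis using that by blast
  qed
  have phi_meas: "\<phi> \<in> borel_measurable borel"
    unfolding \<phi>_def using borel_measurable_continuous_onI[OF ch] by measurable
  define S where "S = (\<lambda>\<epsilon>. {t. \<epsilon> < \<bar>t - k\<bar>})"
  have phi_bd: "norm (indicator (S \<epsilon>) t *\<^sub>R \<phi> t) \<le> B * (1/\<epsilon> + \<bar>k\<bar> + 1) * (1 / (1 + (t - k)\<^sup>2))"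
    if "0 < \<epsilon>" for \<epsilon> t
  proof (cases "\<epsilon> < \<bar>t - k\<bar>")
    case True
    define s where "s = \<bar>t - k\<bar>"
    have s: "\<epsilon> < s" "0 < s" "(t - k)\<^sup>2 = s\<^sup>2" "s \<le> \<bar>t\<bar> + \<bar>k\<bar>" using True that by (auto simp: s_def)
    \<comment> \<open>From \<open>s > \<epsilon>\<close> one has \<open>1 < s / \<epsilon>\<close>,
      and \<open>s \<le> |t| + |k|\<close>; so \<open>1 + s\<^sup>2 \<le> s * (1/\<epsilon> + s)
      \<le> s * c * (1 + |t|)\<close> with this \<open>c\<close>.\<close>
    define c where "c = 1/\<epsilon> + \<bar>k\<bar> + 1"
    have "c > 0" using that by (simp add: c_def add_pos_nonneg)
    have "1 + s\<^sup>2 \<le> s * (1/\<epsilon>) + s * s" using s that by (simp add: power2_eq_square field_simps)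
    also have "\<dots> = s * (1/\<epsilon> + s)" by (simp add: algebra_simps)
    also have "\<dots> \<le> s * (c * (1 + \<bar>t\<bar>))"
    proof (rule mult_left_mono)
      have "\<bar>t\<bar> \<le> c * \<bar>t\<bar>" using that by (intro mult_le_cancel_right1[THEN iffD2]) (auto simp: c_def add_nonneg_nonneg)
      then show "1/\<epsilon> + s \<le> c * (1 + \<bar>t\<bar>)" using s(4) by (simp add: algebra_simps c_def)
    qed (use s in simp)
    finally have c: "1 + s\<^sup>2 \<le> s * (c * (1 + \<bar>t\<bar>))" .
    have "norm (\<phi> t) = norm (h t) / s" by (simp add: \<phi>_def s_def)
    also have "\<dots> \<le> B / (1 + \<bar>t\<bar>) / s" using s by (intro divide_right_mono B(1)) auto
    also have "\<dots> \<le> B * (c / (1 + s\<^sup>2))"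
    proof -
      have "1 / ((1 + \<bar>t\<bar>) * s) \<le> c / (1 + s\<^sup>2)"
        using c s \<open>c > 0\<close> by (simp add: divide_simps add_pos_nonneg) (simp add: algebra_simps)
      from mult_left_mono[OF this B(2)] show ?thesis by simp
    qed
    finally show ?thesis using True s by (simp add: c_def S_def)
  next
    case False
    then show ?thesis using that B(2) by (simp add: S_def add_nonneg_nonneg)
  qed
  have wt: "integrable lebesgue (\<lambda>t. B * (1/\<epsilon> + \<bar>k\<bar> + 1) * (1 / (1 + (t - k)\<^sup>2)))" for \<epsilon>
  proof (subst integrable_completion)
    show "integrable lborel (\<lambda>t. B * (1/\<epsilon> + \<bar>k\<bar> + 1) * (1 / (1 + (t - k)\<^sup>2)))"
      using lborel_integrable_real_affine[OF integrable_Poisson_weight, of 1 "-k"]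
      by (intro integrable_mult_right) simp
  qed measurable
  have S_meas: "S \<epsilon> \<in> sets borel" for \<epsilon> unfolding S_def by measurable
  have phi_meas': "(\<lambda>t. indicator T t *\<^sub>R \<phi> t) \<in> borel_measurable lebesgue" if "T \<in> sets borel" for T
  proof (intro measurable_completion borel_measurable_scaleR borel_measurable_indicator)
    show "\<phi> \<in> borel_measurable lborel" using phi_meas by simp
    show "T \<in> sets lborel" using that by simp
  qed
  have phi_int: "set_integrable lebesgue (S \<epsilon>) \<phi>" if "0 < \<epsilon>" for \<epsilon>
    unfolding set_integrable_def
    by (rule Bochner_Integration.integrable_bound[OF wt[of \<epsilon>] phi_meas'[OF S_meas]])
       (rule AE_I2, rule order_trans[OF phi_bd[OF that]], simp only: real_norm_def abs_ge_self)
  have annulus: "(LINT t:S \<epsilon> \<inter> {t. \<bar>t - k\<bar> \<le> r}|lebesgue. \<phi> t) = Re (A \<epsilon>) - Re (A r)"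
    if "0 < \<epsilon>" "\<epsilon> < r" for \<epsilon> r
  proof -
    have ln: "ln \<epsilon> < ln r" using that by simp
    have ex: "\<epsilon> \<le> exp u \<and> exp u \<le> r" if "u \<in> {ln \<epsilon>..ln r}" for u
    proof -
      have "exp (ln \<epsilon>) \<le> exp u \<and> exp u \<le> exp (ln r)" using that by simp
      then show ?thesis using \<open>0 < \<epsilon>\<close> \<open>\<epsilon> < r\<close> by simp
    qed
    have cphi: "continuous_on T \<phi>" if "k \<notin> T" for T
      unfolding \<phi>_def using that by (intro continuous_intros ch) auto
    \<comment> \<open>Under \<open>t = k + exp u\<close> the measure \<open>dt / (t - k)\<close>
      becomes \<open>du\<close>.\<close>
    have 1: "((\<lambda>u. h (k + exp u)) has_integral integral {k + \<epsilon>..k + r} \<phi>) {ln \<epsilon>..ln r}"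
    proof -
      have "((\<lambda>u. exp u *\<^sub>R \<phi> (k + exp u)) has_integral integral {k + exp (ln \<epsilon>)..k + exp (ln r)} \<phi>) {ln \<epsilon>..ln r}"
      proof (rule has_integral_substitution[where c = "k + \<epsilon>" and d = "k + r"])
        show "(\<lambda>u. k + exp u) ` {ln \<epsilon>..ln r} \<subseteq> {k + \<epsilon>..k + r}"
          using ex by auto
      qed (use that in \<open>auto intro!: derivative_eq_intros cphi\<close>)
      then show ?thesis using that by (simp add: \<phi>_def)
    qed
    \<comment> \<open>To the left of \<open>k\<close> the substitution \<open>t = k - exp u\<close>
      reverses orientation: the general substitution rule yields a difference of two integrals, the
      first over an empty interval, and a minus sign remains.\<close>
    have 2: "((\<lambda>u. - h (k - exp u)) has_integral integral {k - r..k - \<epsilon>} \<phi>) {ln \<epsilon>..ln r}"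
    proof -
      have "((\<lambda>u. (- exp u) *\<^sub>R \<phi> (k - exp u)) has_integral (integral {k - exp (ln \<epsilon>)..k - exp (ln r)} \<phi>
         - integral {k - exp (ln r)..k - exp (ln \<epsilon>)} \<phi>)) {ln \<epsilon>..ln r}"
      proof (rule has_integral_substitution_general[where s = "{}" and c = "k - r" and d = "k - \<epsilon>"])
        show "(\<lambda>u. k - exp u) ` {ln \<epsilon>..ln r} \<subseteq> {k - r..k - \<epsilon>}"
          using ex by auto
      qed (use that in \<open>auto intro!: derivative_eq_intros cphi continuous_intros\<close>)
      from has_integral_neg[OF this] show ?thesis using that by (simp add: \<phi>_def)
    qed
    have L1: "integral {ln \<epsilon>..ln r} (\<lambda>u. h (g u)) = Im (integral {ln \<epsilon>..ln r} (\<lambda>u. L (of_real (g u))))"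
      if "continuous_on {ln \<epsilon>..ln r} g" for g
      using integral_linear[OF integrable_continuous_real[OF cL[OF that]] bounded_linear_Im]
      by (simp add: o_def h_def)
    have L2: "integral {ln \<epsilon>..ln r} (\<lambda>u. h (k + exp u)) = Im (integral {ln \<epsilon>..ln r} (\<lambda>u. L (of_real (k + exp u))))"
      "integral {ln \<epsilon>..ln r} (\<lambda>u. h (k - exp u)) = Im (integral {ln \<epsilon>..ln r} (\<lambda>u. L (of_real (k - exp u))))"
      by (intro L1 continuous_intros)+
    \<comment> \<open>In the imaginary part of the half-annulus identity, the factor
      \<open>\<i>\<close> in front of the arc integrals leaves their real parts.\<close>
    have "integral {k - r..k - \<epsilon>} \<phi> + integral {k + \<epsilon>..k + r} \<phi> = Re (A \<epsilon>) - Re (A r)"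
      using arg_cong[OF half_annulus_Cauchy[OF cont hol ln, of k], of Im]
        integral_unique[OF 1] integral_unique[OF 2]
      by (simp add: L2[symmetric] A_def del: of_real_add of_real_diff)
    moreover have "(\<phi> has_integral (integral {k - r..k - \<epsilon>} \<phi> + integral {k + \<epsilon>..k + r} \<phi>)) ({k - r..k - \<epsilon>} \<union> {k + \<epsilon>..k + r})"
    proof (rule has_integral_Un)
      have "{k - r..k - \<epsilon>} \<inter> {k + \<epsilon>..k + r} = {}" using that by auto
      then show "negligible ({k - r..k - \<epsilon>} \<inter> {k + \<epsilon>..k + r})" by simp
    qed (use that in \<open>auto intro!: integrable_integral integrable_continuous_real cphi\<close>)
    \<comment> \<open>The inequality defining \<open>S \<epsilon>\<close> is strict, so the two sets
      differ only in the points \<open>k - \<epsilon>\<close> and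
      \<open>k + \<epsilon>\<close>.\<close>
    moreover have "(\<phi> has_integral J) (S \<epsilon> \<inter> {t. \<bar>t - k\<bar> \<le> r}) \<longleftrightarrow> (\<phi> has_integral J) ({k - r..k - \<epsilon>} \<union> {k + \<epsilon>..k + r})" for J
      by (rule has_integral_spike_set_eq)
         (rule negligible_subset[of "{k - \<epsilon>, k + \<epsilon>}"], use that in \<open>auto simp: S_def\<close>)+
    ultimately have "(\<phi> has_integral (Re (A \<epsilon>) - Re (A r))) (S \<epsilon> \<inter> {t. \<bar>t - k\<bar> \<le> r})" by simp
    moreover have "set_integrable lebesgue (S \<epsilon> \<inter> {t. \<bar>t - k\<bar> \<le> r}) \<phi>"
      by (rule set_integrable_subset[OF phi_int[OF that(1)]]) (auto simp: S_def)
    ultimately show ?thesis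
      by (simp add: set_lebesgue_integral_eq_integral(2) integral_unique)
  qed
  have tail: "(LINT t:S \<epsilon>|lebesgue. \<phi> t) = Re (A \<epsilon>)" if "0 < \<epsilon>" for \<epsilon>
  proof (rule tendsto_unique[OF trivial_limit_at_top_linorder])
    show "((\<lambda>r. LINT t:S \<epsilon> \<inter> {t. \<bar>t - k\<bar> \<le> r}|lebesgue. \<phi> t) \<longlongrightarrow> (LINT t:S \<epsilon>|lebesgue. \<phi> t)) at_top"
      unfolding set_lebesgue_integral_def
    proof (rule integral_dominated_convergence_at_top[OF _ _ wt[of \<epsilon>]])
      show "AE t in lebesgue. ((\<lambda>r. indicator (S \<epsilon> \<inter> {t. \<bar>t - k\<bar> \<le> r}) t *\<^sub>R \<phi> t) \<longlongrightarrow> indicator (S \<epsilon>) t *\<^sub>R \<phi> t) at_top"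
      proof (intro AE_I2 tendsto_eventually)
        fix t
        show "\<forall>\<^sub>F r in at_top. indicator (S \<epsilon> \<inter> {t. \<bar>t - k\<bar> \<le> r}) t *\<^sub>R \<phi> t = indicator (S \<epsilon>) t *\<^sub>R \<phi> t"
          using eventually_ge_at_top[of "\<bar>t - k\<bar>"] by eventually_elim (simp add: indicator_def)
      qed
      show "\<forall>\<^sub>F r in at_top. AE t in lebesgue. norm (indicator (S \<epsilon> \<inter> {t. \<bar>t - k\<bar> \<le> r}) t *\<^sub>R \<phi> t) \<le> B * (1/\<epsilon> + \<bar>k\<bar> + 1) * (1 / (1 + (t - k)\<^sup>2))"
        by (intro always_eventually allI AE_I2 order_trans[OF _ phi_bd[OF that]]) (simp add: indicator_def)
      show "(\<lambda>t. indicator (S \<epsilon>) t *\<^sub>R \<phi> t) \<in> borel_measurable lebesgue"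
        by (rule phi_meas'[OF S_meas])
      have "{t. \<bar>t - k\<bar> \<le> r} \<in> sets borel" for r by measurable
      then show "(\<lambda>t. indicator (S \<epsilon> \<inter> {t. \<bar>t - k\<bar> \<le> r}) t *\<^sub>R \<phi> t) \<in> borel_measurable lebesgue" for r
        by (intro phi_meas' sets.Int S_meas)
    qed
    have "((\<lambda>r. Re (A \<epsilon>) - Re (A r)) \<longlongrightarrow> Re (A \<epsilon>) - Re 0) at_top"
      by (intro tendsto_intros A_large)
    moreover have "\<forall>\<^sub>F r in at_top. Re (A \<epsilon>) - Re (A r) = (LINT t:S \<epsilon> \<inter> {t. \<bar>t - k\<bar> \<le> r}|lebesgue. \<phi> t)"
      using eventually_gt_at_top[of \<epsilon>] by eventually_elim (use annulus that in simp)
    ultimately show "((\<lambda>r. LINT t:S \<epsilon> \<inter> {t. \<bar>t - k\<bar> \<le> r}|lebesgue. \<phi> t) \<longlongrightarrow> Re (A \<epsilon>)) at_top"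
      by (simp add: filterlim_cong)
  qed
  have "((\<lambda>\<epsilon>. Re (A \<epsilon>)) \<longlongrightarrow> Re (of_real pi * L (of_real k))) (at_right 0)"
    by (intro tendsto_intros A_small)
  moreover have "\<forall>\<^sub>F \<epsilon> in at_right 0. Re (A \<epsilon>) = (LINT t:S \<epsilon>|lebesgue. \<phi> t)"
    using eventually_at_right_less[of 0] by eventually_elim (simp add: tail)
  ultimately have "((\<lambda>\<epsilon>. LINT t:S \<epsilon>|lebesgue. \<phi> t) \<longlongrightarrow> pi * Re (L (of_real k))) (at_right 0)"
    by (simp add: filterlim_cong)
  then show ?thesis using phi_int unfolding has_pv_integral_def \<phi>_def h_def S_def by blast
qed

section \<open>The operator \<open>L\<^sub>0\<close>: uniqueness of second derivatives and of resolvents\<close>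

text \<open>The bridge from Lebesgue to Borel measurability, needed because induction over Borel
  sets and the Fubini arguments take place over \<open>lborel\<close>.\<close>

lemma completion_ex_borel_measurable_complex:
  fixes g :: "'a \<Rightarrow> complex"
  assumes "g \<in> borel_measurable (completion M)"
  shows "\<exists>g'\<in>borel_measurable M. AE x in M. g x = g' x"
proof -
  have "(\<lambda>x. Re (g x)) \<in> borel_measurable (completion M)" "(\<lambda>x. Im (g x)) \<in> borel_measurable (completion M)"
    using assms by measurable
  then obtain p q where pq: "p \<in> borel_measurable M" "AE x in M. Re (g x) = p x"
    "q \<in> borel_measurable M" "AE x in M. Im (g x) = q x"
    using completion_ex_borel_measurable_real[of "\<lambda>x. Re (g x)" M] completion_ex_borel_measurable_real[of "\<lambda>x. Im (g x)" M]
    by blast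
  show ?thesis
  proof (intro bexI)
    show "AE x in M. g x = Complex (p x) (q x)"
      using pq(2,4) by eventually_elim (simp add: complex_eq_iff)
    show "(\<lambda>x. Complex (p x) (q x)) \<in> borel_measurable M"
      using pq unfolding Complex_eq by measurable
  qed
qed

text \<open>The sets over which \<open>f\<close> integrates to \<open>0\<close> contain the closed
  intervals and are closed under disjoint countable unions; vanishing of the total integral gives
  complements. Induction over Borel sets then reaches all of them.\<close>

lemma AE_zero_if_interval_integrals_zero:
  fixes f :: "real \<Rightarrow> complex"
  assumes f: "integrable lborel f" and 0: "\<And>a b. a \<le> b \<Longrightarrow> (LINT x:{a..b}|lborel. f x) = 0"
    and UN: "(LINT x|lborel. f x) = 0"
  shows "AE x in lborel. f x = 0"
proof (rule sigma_finite_measure.density_zero[OF sigma_finite_lborel f])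
  fix A :: "real set" assume "A \<in> sets lborel"
  then have "A \<in> sets borel" by simp
  then show "(LINT x:A|lborel. f x) = 0"
  proof (induction A rule: borel_set_induct)
    case empty
    show ?case by (simp add: set_lebesgue_integral_def)
  next
    case (interval a b)
    then show ?case using 0 by simp
  next
    case (compl A)
    have i: "set_integrable lborel B f" if "B \<in> sets borel" for B
      using f that unfolding set_integrable_def by (intro integrable_mult_indicator) auto
    have "(LINT x:A \<union> - A|lborel. f x) = (LINT x:A|lborel. f x) + (LINT x:- A|lborel. f x)"
      using compl.hyps by (intro set_integral_Un i) auto
    moreover have "(LINT x:A \<union> - A|lborel. f x) = 0"
      using UN by (simp add: set_lebesgue_integral_def)
    ultimately show ?case using compl.IH by simp
  next
    case (union F)
    have "(LINT x:(\<Union>i. F i)|lborel. f x) = (\<Sum>i. (LINT x:(F i)|lborel. f x))"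
    proof (rule lebesgue_integral_countable_add)
      show "set_integrable lborel (\<Union>i. F i) f"
        unfolding set_integrable_def by (rule integrable_mult_indicator[OF _ f]) (use union.hyps in auto)
    qed (use union.hyps in \<open>auto simp: disjoint_family_on_def\<close>)
    then show ?case using union.IH by simp
  qed
qed

text \<open>Since \<open>g\<close> is only locally integrable on the open half-line, the argument is
  localised to compact intervals \<open>J n\<close> that exhaust it, and on each of them a Borel
  representative is used.\<close>

lemma AE_half_line_zero:
  fixes g :: "real \<Rightarrow> complex"
  assumes int: "\<And>a b. 0 < a \<Longrightarrow> a \<le> b \<Longrightarrow> set_integrable lebesgue {a..b} g"
    and 0: "\<And>a b. 0 < a \<Longrightarrow> a \<le> b \<Longrightarrow> (LINT x:{a..b}|lebesgue. g x) = 0"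
  shows "AE x in lebesgue. 0 < x \<longrightarrow> g x = 0"
proof -
  \<comment> \<open>The shift by \<open>1\<close> keeps the left end positive and finite and the
    interval non-empty; for \<open>n = 0\<close> it is the point \<open>1\<close>.\<close>
  define J where "J = (\<lambda>n::nat. {1 / (real n + 1)..real n + 1})"
  have J: "J n = {a..b}" "0 < a" "a \<le> b" if "a = 1 / (real n + 1)" "b = real n + 1" for n a b
  proof -
    show "a \<le> b" using that by (simp add: field_simps) (smt (verit) mult_nonneg_nonneg of_nat_0_le_iff)
  qed (use that in \<open>simp_all add: J_def\<close>)
  have "AE x in lebesgue. indicator (J n) x *\<^sub>R g x = 0" for n
  proof -
    let ?f = "\<lambda>x. indicator (J n) x *\<^sub>R g x"
    have ig: "integrable lebesgue ?f"
      using int J[OF refl refl, of n] unfolding set_integrable_def by simp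
    then obtain f' where f': "f' \<in> borel_measurable lborel" "AE x in lborel. ?f x = f' x"
      using completion_ex_borel_measurable_complex[of ?f lborel] borel_measurable_integrable by blast
    have ae: "AE x in lebesgue. ?f x = f' x" using f'(2) by (rule AE_completion)
    have "integrable lebesgue f'"
      using ig ae f'(1) integrable_cong_AE[of ?f lebesgue f'] borel_measurable_integrable[OF ig]
        measurable_completion[OF f'(1)] by blast
    then have "integrable lborel f'" using f'(1) by (simp add: integrable_completion)
    have eq: "(LINT x:A|lborel. f' x) = (LINT x:(A \<inter> J n)|lebesgue. g x)" if "A \<in> sets borel" for A
    proof -
      have m: "(\<lambda>x. indicator A x *\<^sub>R f' x) \<in> borel_measurable lborel"
        using f'(1) that by (intro borel_measurable_scaleR borel_measurable_indicator) auto
      have "(LINT x:A|lborel. f' x) = (LINT x|lebesgue. indicator A x *\<^sub>R f' x)"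
        unfolding set_lebesgue_integral_def using m by (simp add: integral_completion)
      also have "\<dots> = (LINT x|lebesgue. indicator A x *\<^sub>R ?f x)"
      proof (rule integral_cong_AE)
        show "(\<lambda>x. indicator A x *\<^sub>R f' x) \<in> borel_measurable lebesgue" using m by (rule measurable_completion)
        show "(\<lambda>x. indicator A x *\<^sub>R ?f x) \<in> borel_measurable lebesgue"
          using that by (intro borel_measurable_scaleR[OF _ borel_measurable_integrable[OF ig]] borel_measurable_indicator) auto
        show "AE x in lebesgue. indicator A x *\<^sub>R f' x = indicator A x *\<^sub>R ?f x"
          using ae by eventually_elim simp
      qed
      also have "\<dots> = (LINT x:(A \<inter> J n)|lebesgue. g x)"
        unfolding set_lebesgue_integral_def by (simp add: indicator_inter_arith)
      finally show ?thesis .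
    qed
    \<comment> \<open>Intersecting with \<open>J n\<close> leaves a closed interval inside the open
      half-line, or the empty set when its ends are in the wrong order.\<close>
    have z: "(LINT x:(A \<inter> J n)|lebesgue. g x) = 0" if "A = UNIV \<or> (\<exists>a b. A = {a..b})" for A
    proof -
      have "\<exists>p q. 0 < p \<and> A \<inter> J n = {p..q}"
      proof -
        have "A \<inter> J n = J n \<or> (\<exists>a b. A \<inter> J n = {max a (1 / (real n + 1))..min b (real n + 1)})"
          using that
        proof (elim disjE exE)
          fix a b assume "A = {a..b}"
          then have "A \<inter> J n = {max a (1 / (real n + 1))..min b (real n + 1)}" by (simp add: J_def)
          then show ?thesis by blast
        qed simp
        then show ?thesis using J(1,2)[OF refl refl, of n] by (metis less_max_iff_disj)
      qed
      then obtain p q where pq: "0 < p" "A \<inter> J n = {p..q}" by blast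
      show ?thesis
      proof (cases "p \<le> q")
        case True then show ?thesis using 0 pq by simp
      next
        case False then show ?thesis using pq by (simp add: set_lebesgue_integral_def)
      qed
    qed
    have "AE x in lborel. f' x = 0"
    proof (rule AE_zero_if_interval_integrals_zero)
      show "(LINT x:{a..b}|lborel. f' x) = 0" for a b using eq[of "{a..b}"] z by auto
      show "(LINT x|lborel. f' x) = 0" using eq[of UNIV] z[of UNIV] by (simp add: set_lebesgue_integral_def)
    qed fact
    then have "AE x in lebesgue. f' x = 0" by (rule AE_completion)
    with ae show ?thesis by eventually_elim simp
  qed
  then have "AE x in lebesgue. \<forall>n. indicator (J n) x *\<^sub>R g x = 0" unfolding AE_all_countable by blast
  then show ?thesis
  proof eventually_elim
    case (elim x)
    show ?case
    proof
      assume "0 < x"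
      obtain n :: nat where n: "x < real n" "1 / x < real n"
        by (metis reals_Archimedean2 less_trans linorder_less_linear)
      have "x \<in> J n" unfolding J_def using n \<open>0 < x\<close> by (auto simp: field_simps)
      then show "g x = 0" using elim[rule_format, of n] by simp
    qed
  qed
qed

section \<open>Calculus of indefinite integrals and uniqueness for the resolvent equation\<close>

lemma ac_deriv_integral:
  assumes "ac_deriv y g" "0 < a" "a \<le> b"
  shows "g integrable_on {a..b}" "y b - y a = integral {a..b} g"
  using assms set_lebesgue_integral_eq_integral[of "{a..b}" g] unfolding ac_deriv_def by auto

lemma ac_deriv_continuous:
  assumes "ac_deriv y g"
  shows "continuous_on {0<..} y"
proof (rule continuous_at_imp_continuous_on, rule ballI)
  fix x :: real assume "x \<in> {0<..}"
  then have x: "0 < x" by simp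
  have "continuous_on {x/2..2*x} (\<lambda>t. y (x/2) + integral {x/2..t} g)"
    using ac_deriv_integral(1)[OF assms, of "x/2" "2*x"] x
    by (intro continuous_intros indefinite_integral_continuous_1) auto
  also have "?this \<longleftrightarrow> continuous_on {x/2..2*x} y"
    using x by (intro continuous_on_cong refl) (auto simp: ac_deriv_integral(2)[OF assms, symmetric])
  finally show "isCont y x"
    using x by (elim continuous_on_interior) auto
qed

lemma ac_deriv_has_vector_derivative:
  assumes "ac_deriv y g" "continuous_on {0<..} g" "0 < x"
  shows "(y has_vector_derivative g x) (at x)"
proof -
  have c: "continuous_on {x/2..2*x} g" by (rule continuous_on_subset[OF assms(2)]) (use \<open>0 < x\<close> in auto)
  have "((\<lambda>t. y (x/2) + integral {x/2..t} g) has_vector_derivative 0 + g x) (at x within {x/2..2*x})"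
    using \<open>0 < x\<close> by (intro has_vector_derivative_add has_vector_derivative_const integral_has_vector_derivative c) auto
  then have "((\<lambda>t. y (x/2) + integral {x/2..t} g) has_vector_derivative g x) (at x)"
    using \<open>0 < x\<close> by (simp add: at_within_Icc_at)
  then show ?thesis
    by (rule has_vector_derivative_transform_within_open[of _ _ _ "{x/2<..<2*x}"])
       (use \<open>0 < x\<close> in \<open>auto simp: ac_deriv_integral(2)[OF assms(1), symmetric]\<close>)
qed

lemma ac_deriv_AE_cong:
  assumes "ac_deriv y g" "AE x in lebesgue. 0 < x \<longrightarrow> g x = g' x"
  shows "ac_deriv y g'"
proof -
  obtain N where N: "negligible N" "{x. \<not> (0 < x \<longrightarrow> g x = g' x)} \<subseteq> N"
    using assms(2) unfolding eventually_ae_filter_negligible by blast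
  show ?thesis unfolding ac_deriv_def
  proof (intro allI impI, elim conjE)
    fix a b :: real assume ab: "0 < a" "a \<le> b"
    have e: "g' x = g x" if "x \<in> {a..b} - N" for x
    proof -
      have "0 < x" "x \<notin> N" using that ab by auto
      then show ?thesis using N(2) by auto
    qed
    have g: "set_integrable lebesgue {a..b} g" "y b - y a = integral {a..b} g"
      using assms(1) ab ac_deriv_integral by (auto simp: ac_deriv_def)
    have "set_integrable lebesgue {a..b} g'"
      using absolutely_integrable_spike[OF g(1) N(1) e] by simp
    moreover have "integral {a..b} g = integral {a..b} g'"
      by (rule integral_spike[OF N(1)]) (use e in auto)
    ultimately show "set_integrable lebesgue {a..b} g' \<and> y b - y a = (LINT x:{a..b}|lebesgue. g' x)"
      using g by (simp add: set_lebesgue_integral_eq_integral)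
  qed
qed

lemma ac_deriv_lincomb:
  assumes "ac_deriv y1 g1" "ac_deriv y2 g2"
  shows "ac_deriv (\<lambda>x. c * y1 x + d * y2 x) (\<lambda>x. c * g1 x + d * g2 x)"
  unfolding ac_deriv_def
proof (intro allI impI)
  fix a b :: real assume ab: "0 < a \<and> a \<le> b"
  then have 1: "set_integrable lebesgue {a..b} (\<lambda>x. c * g1 x)" "set_integrable lebesgue {a..b} (\<lambda>x. d * g2 x)"
    using assms by (auto simp: ac_deriv_def)
  have "c * y1 b + d * y2 b - (c * y1 a + d * y2 a) = c * (y1 b - y1 a) + d * (y2 b - y2 a)"
    by (simp add: algebra_simps)
  then show "set_integrable lebesgue {a..b} (\<lambda>x. c * g1 x + d * g2 x) \<and>
     c * y1 b + d * y2 b - (c * y1 a + d * y2 a) = (LINT x:{a..b}|lebesgue. c * g1 x + d * g2 x)"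
    using assms ab 1 by (auto simp: ac_deriv_def set_integral_add)
qed

lemma ac_deriv_unique:
  assumes "ac_deriv y g" "ac_deriv y g'"
  shows "AE x in lebesgue. 0 < x \<longrightarrow> g x = g' x"
proof -
  have "ac_deriv (\<lambda>x. 1 * y x + (-1) * y x) (\<lambda>x. 1 * g x + (-1) * g' x)"
    by (rule ac_deriv_lincomb[OF assms])
  then have "AE x in lebesgue. 0 < x \<longrightarrow> 1 * g x + (-1) * g' x = 0"
    by (intro AE_half_line_zero) (auto simp: ac_deriv_def)
  then show ?thesis by eventually_elim auto
qed

lemma ac_deriv_cong:
  assumes "ac_deriv y g" "\<And>x. 0 < x \<Longrightarrow> y x = y' x"
  shows "ac_deriv y' g"
  using assms unfolding ac_deriv_def by (metis less_le_trans)

text \<open>A first derivative that is itself an indefinite integral is continuous, hence the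
  classical derivative and unique at every point; only the second one is ambiguous on a null set.
  This controls the choice made in \<open>L0\<close>.\<close>

lemma second_ac_deriv_unique:
  assumes "ac_deriv y g" "ac_deriv g h" "ac_deriv y g'" "ac_deriv g' h'"
  shows "AE x in lebesgue. 0 < x \<longrightarrow> h x = h' x"
proof -
  have "g x = g' x" if "0 < x" for x
    using ac_deriv_has_vector_derivative[OF assms(1) ac_deriv_continuous[OF assms(2)] that]
      ac_deriv_has_vector_derivative[OF assms(3) ac_deriv_continuous[OF assms(4)] that]
    by (rule vector_derivative_unique_at)
  then have "ac_deriv g' h" using ac_deriv_cong[OF assms(2)] by blast
  then show ?thesis using assms(4) by (rule ac_deriv_unique)
qed

text \<open>As an indefinite integral \<open>u\<close> is continuous, so the equation holds
  classically and \<open>u x * exp (- c * x)\<close> has derivative \<open>0\<close>.\<close>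

lemma ac_deriv_exponential:
  assumes "ac_deriv u (\<lambda>x. c * u x)"
  obtains C where "\<And>x. 0 < x \<Longrightarrow> u x = C * exp (c * of_real x)"
proof -
  have d: "(u has_vector_derivative c * u x) (at x)" if "0 < x" for x
    using that by (intro ac_deriv_has_vector_derivative[OF assms]) (auto intro!: continuous_intros ac_deriv_continuous[OF assms])
  have "\<exists>C. \<forall>x\<in>{0<..}. u x * exp (- c * of_real x) = C"
  proof (rule has_derivative_zero_constant)
    fix x :: real assume "x \<in> {0<..}"
    then have "0 < x" by simp
    have "((\<lambda>x. exp (- c * of_real x)) has_vector_derivative (- c * exp (- c * of_real x))) (at x)"
      by (rule has_vector_derivative_real_field) (auto intro!: derivative_eq_intros)
    from has_vector_derivative_mult[OF d[OF \<open>0 < x\<close>] this]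
    have "((\<lambda>x. u x * exp (- c * of_real x)) has_vector_derivative 0) (at x)"
      by (simp add: algebra_simps)
    then show "((\<lambda>x. u x * exp (- c * of_real x)) has_derivative (\<lambda>h. 0)) (at x within {0<..})"
      by (simp add: has_vector_derivative_def has_derivative_at_withinI)
  qed simp
  then obtain C where "\<And>x. 0 < x \<Longrightarrow> u x * exp (- c * of_real x) = C" by auto
  then have "u x = C * exp (c * of_real x)" if "0 < x" for x
    using that by (auto simp: exp_minus field_simps)
  with that show ?thesis by blast
qed

lemma L2_half_lincomb:
  assumes "f \<in> L2_half" "g \<in> L2_half"
  shows "(\<lambda>x. c * f x + d * g x) \<in> L2_half"
proof -
  have m: "set_borel_measurable lebesgue {0<..} (\<lambda>x. c * f x + d * g x)"
  proof -
    have "(\<lambda>x. c * (indicator {0<..} x *\<^sub>R f x) + d * (indicator {0<..} x *\<^sub>R g x)) \<in> borel_measurable lebesgue"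
      using assms unfolding L2_half_def set_borel_measurable_def
      by (intro borel_measurable_add borel_measurable_times) auto
    then show ?thesis unfolding set_borel_measurable_def by (simp add: scaleR_conv_of_real algebra_simps)
  qed
  have "set_integrable lebesgue {0<..} (\<lambda>x. (cmod (c * f x + d * g x))\<^sup>2)"
  proof (rule set_integrable_bound)
    show "set_integrable lebesgue {0<..} (\<lambda>x. 2 * (cmod c)\<^sup>2 * (cmod (f x))\<^sup>2 + 2 * (cmod d)\<^sup>2 * (cmod (g x))\<^sup>2)"
      using assms by (intro set_integral_add(1)) (auto simp: L2_half_def)
    have "(\<lambda>x. (cmod (indicator {0<..} x *\<^sub>R (c * f x + d * g x)))\<^sup>2) \<in> borel_measurable lebesgue"
      using m unfolding set_borel_measurable_def by (rule borel_measurable_power[OF measurable_compose[OF _ borel_measurable_norm]])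
    also have "(\<lambda>x. (cmod (indicator {0<..} x *\<^sub>R (c * f x + d * g x)))\<^sup>2) =
       (\<lambda>x. indicator {0<..} x *\<^sub>R (cmod (c * f x + d * g x))\<^sup>2)"
      by (auto simp: indicator_def fun_eq_iff)
    finally show "set_borel_measurable lebesgue {0<..} (\<lambda>x. (cmod (c * f x + d * g x))\<^sup>2)"
      unfolding set_borel_measurable_def .
    show "AE x in lebesgue. x \<in> {0<..} \<longrightarrow> norm ((cmod (c * f x + d * g x))\<^sup>2) \<le>
       norm (2 * (cmod c)\<^sup>2 * (cmod (f x))\<^sup>2 + 2 * (cmod d)\<^sup>2 * (cmod (g x))\<^sup>2)"
    proof (intro AE_I2 impI)
      fix x
      have "(cmod (c * f x + d * g x))\<^sup>2 \<le> (cmod (c * f x) + cmod (d * g x))\<^sup>2"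
        by (intro power_mono norm_triangle_ineq) auto
      also have "\<dots> \<le> 2 * (cmod (c * f x))\<^sup>2 + 2 * (cmod (d * g x))\<^sup>2"
        using sum_squares_bound[of "cmod (c * f x)" "cmod (d * g x)"] by (simp add: power2_sum)
      finally show "norm ((cmod (c * f x + d * g x))\<^sup>2) \<le>
       norm (2 * (cmod c)\<^sup>2 * (cmod (f x))\<^sup>2 + 2 * (cmod d)\<^sup>2 * (cmod (g x))\<^sup>2)"
        by (simp add: norm_mult power_mult_distrib)
    qed
  qed
  with m show ?thesis by (simp add: L2_half_def)
qed

text \<open>Factorisation of the operator: \<open>u = w' - \<i> l w\<close> solves
  \<open>u' = - \<i> l u\<close>, so it is a multiple of \<open>exp (- \<i> l x)\<close>, whose
  modulus is at least \<open>1\<close>; square integrability forces \<open>u = 0\<close>. What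
  remains is \<open>w' = \<i> l w\<close>, and the boundary value kills its solution.\<close>

lemma homogeneous_solution_zero:
  assumes l: "0 < Im l" and w: "ac_deriv w w1" "ac_deriv w1 (\<lambda>x. - l\<^sup>2 * w x)"
    and L2: "w \<in> L2_half" "w1 \<in> L2_half" and bc: "(w \<longlongrightarrow> 0) (at_right 0)" and x: "0 < x"
  shows "w x = 0"
proof -
  define u where "u = (\<lambda>x. 1 * w1 x + (- \<i> * l) * w x)"
  have "ac_deriv u (\<lambda>x. 1 * (- l\<^sup>2 * w x) + (- \<i> * l) * w1 x)"
    unfolding u_def by (rule ac_deriv_lincomb[OF w(2,1)])
  also have "(\<lambda>x. 1 * (- l\<^sup>2 * w x) + (- \<i> * l) * w1 x) = (\<lambda>x. (- \<i> * l) * u x)"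
    by (auto simp: u_def algebra_simps power2_eq_square)
  finally obtain C where C: "\<And>x. 0 < x \<Longrightarrow> u x = C * exp ((- \<i> * l) * of_real x)"
    using ac_deriv_exponential by blast
  have uL2: "u \<in> L2_half" unfolding u_def by (intro L2_half_lincomb L2)
  have "C = 0"
  proof (rule ccontr)
    assume "C \<noteq> 0"
    have "set_integrable lebesgue {0<..} (\<lambda>x::real. (cmod C)\<^sup>2)"
    proof (rule set_integrable_bound)
      show "set_integrable lebesgue {0<..} (\<lambda>x. (cmod (u x))\<^sup>2)" using uL2 by (simp add: L2_half_def)
      show "set_borel_measurable lebesgue {0<..} (\<lambda>x::real. (cmod C)\<^sup>2)"
        unfolding set_borel_measurable_def by (intro borel_measurable_scaleR borel_measurable_indicator) auto
      show "AE x in lebesgue. x \<in> {0<..} \<longrightarrow> norm ((cmod C)\<^sup>2) \<le> norm ((cmod (u x))\<^sup>2)"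
      proof (intro AE_I2 impI)
        fix x :: real assume "x \<in> {0<..}"
        then have "0 < x" by simp
        have "cmod C * 1 \<le> cmod C * exp (Im l * x)"
          using l \<open>0 < x\<close> by (intro mult_left_mono) auto
        then show "norm ((cmod C)\<^sup>2) \<le> norm ((cmod (u x))\<^sup>2)"
          using C[OF \<open>0 < x\<close>] by (simp add: norm_mult power_mono)
      qed
    qed
    then have "set_integrable lebesgue {0<..} (\<lambda>x::real. (1/(cmod C)\<^sup>2) * (cmod C)\<^sup>2)"
      by (rule set_integrable_mult_right)
    then have "integrable lebesgue (indicator {0::real<..} :: real \<Rightarrow> real)"
      using \<open>C \<noteq> 0\<close> by (simp add: set_integrable_def)
    then have "emeasure lebesgue {0::real<..} < \<infinity>" by (simp add: integrable_indicator_iff)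
    moreover have "emeasure lborel {0::real<..} = \<infinity>"
    proof (rule ccontr)
      assume a: "emeasure lborel {0::real<..} \<noteq> \<infinity>"
      then obtain m where m: "emeasure lborel {0::real<..} = ennreal m" "0 \<le> m"
        by (metis ennreal_cases infinity_ennreal_def)
      have "emeasure lborel {0<..m + 1} \<le> emeasure lborel {0::real<..}" by (intro emeasure_mono) auto
      then show False using m by simp
    qed
    ultimately show False by simp
  qed
  then have "w1 x = (\<i> * l) * w x" if "0 < x" for x
    using C[OF that] by (simp add: u_def)
  then have "ac_deriv w (\<lambda>x. (\<i> * l) * w x)"
    using ac_deriv_AE_cong[OF w(1)] by simp
  then obtain D where D: "\<And>x. 0 < x \<Longrightarrow> w x = D * exp ((\<i> * l) * of_real x)"
    using ac_deriv_exponential by blast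
  have "((\<lambda>x. D * exp ((\<i> * l) * of_real x)) \<longlongrightarrow> D * exp ((\<i> * l) * of_real 0)) (at_right 0)"
    by (intro tendsto_intros)
  moreover have "((\<lambda>x. D * exp ((\<i> * l) * of_real x)) \<longlongrightarrow> 0) (at_right 0)"
    using bc by (rule Lim_transform_eventually) (use D eventually_at_right_less[of 0] in \<open>auto elim: eventually_mono\<close>)
  ultimately have "D * exp ((\<i> * l) * of_real 0) = 0" by (rule tendsto_unique[OF trivial_limit_at_right_real])
  then show ?thesis using D x by simp
qed

text \<open>Any explicit solution equals the value of the choice operator at every point of the
  half-line, because the difference of two solutions satisfies the homogeneous problem.\<close>

lemma R0_eqI:
  assumes l: "0 < Im l" and y: "y \<in> L2_half" "g \<in> L2_half" "h \<in> L2_half" "ac_deriv y g" "ac_deriv g h"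
    and bc: "(y \<longlongrightarrow> 0) (at_right 0)" and eq: "AE x in lebesgue. 0 < x \<longrightarrow> - h x - l\<^sup>2 * y x = f x"
    and x: "0 < x"
  shows "R0 (l\<^sup>2) f x = y x"
proof -
  have W: "W22_deriv2 y' (SOME h. W22_deriv2 y' h)" if "y' \<in> W22_half" for y'
    using that unfolding W22_half_def mem_Collect_eq by (rule someI_ex)
  \<comment> \<open>\<open>y\<close> itself satisfies \<open>P\<close>, which is what guarantees
    that the function picked by \<open>SOME\<close> in \<open>R0\<close> solves the
    equation.\<close>
  define P where "P = (\<lambda>y. y \<in> dom_L0 \<and> (AE x in lebesgue. 0 < x \<longrightarrow> L0 y x - l\<^sup>2 * y x = f x))"
  have Wy: "W22_deriv2 y h" using y by (auto simp: W22_deriv2_def)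
  then have yW: "y \<in> W22_half" by (auto simp: W22_half_def)
  have "AE x in lebesgue. 0 < x \<longrightarrow> (SOME h. W22_deriv2 y h) x = h x"
    using W[OF yW] y second_ac_deriv_unique unfolding W22_deriv2_def by blast
  with eq have "AE x in lebesgue. 0 < x \<longrightarrow> L0 y x - l\<^sup>2 * y x = f x"
    by eventually_elim (simp add: L0_def)
  then have "P y" using yW bc by (simp add: P_def dom_L0_def)
  then have PR: "P (R0 (l\<^sup>2) f)" unfolding R0_def P_def[symmetric] by (rule someI[of P])
  define r k where "r = R0 (l\<^sup>2) f" and "k = (SOME h. W22_deriv2 r h)"
  have r: "W22_deriv2 r k" "(r \<longlongrightarrow> 0) (at_right 0)" "AE x in lebesgue. 0 < x \<longrightarrow> - k x - l\<^sup>2 * r x = f x"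
    using PR W[of r] unfolding P_def dom_L0_def L0_def k_def r_def by auto
  obtain r1 where r1: "r1 \<in> L2_half" "ac_deriv r r1" "ac_deriv r1 k" "r \<in> L2_half"
    using r(1) by (auto simp: W22_deriv2_def)
  have "1 * r x + (-1) * y x = 0"
  proof (rule homogeneous_solution_zero[OF l])
    show "ac_deriv (\<lambda>x. 1 * r x + (-1) * y x) (\<lambda>x. 1 * r1 x + (-1) * g x)"
      by (rule ac_deriv_lincomb[OF r1(2) y(4)])
    show "ac_deriv (\<lambda>x. 1 * r1 x + (-1) * g x) (\<lambda>x. - l\<^sup>2 * (1 * r x + (-1) * y x))"
    proof (rule ac_deriv_AE_cong[OF ac_deriv_lincomb[OF r1(3) y(5)]])
      show "AE x in lebesgue. 0 < x \<longrightarrow> 1 * k x + (-1) * h x = - l\<^sup>2 * (1 * r x + (-1) * y x)"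
        using eq r(3)
      proof eventually_elim
        case (elim x)
        show ?case
        proof
          assume "0 < x"
          then have "- k x - l\<^sup>2 * r x = - h x - l\<^sup>2 * y x" using elim by simp
          then show "1 * k x + (-1) * h x = - l\<^sup>2 * (1 * r x + (-1) * y x)" by algebra
        qed
      qed
    qed
    show "((\<lambda>x. 1 * r x + (-1) * y x) \<longlongrightarrow> 0) (at_right 0)"
      using tendsto_diff[OF r(2) bc] by simp
  qed (use x in \<open>intro L2_half_lincomb r1 y | simp\<close>)+
  then show ?thesis by (simp add: r_def)
qed

section \<open>The quadratic form of the resolvent kernel\<close>

text \<open>By homogeneity the integral does not depend on \<open>x\<close>. The ranges
  \<open>s \<le> x\<close> and \<open>s \<ge> x\<close> contribute \<open>2\<close> each, with
  antiderivatives \<open>2 sqrt s / sqrt x\<close> and \<open>- 2 sqrt x / sqrt s\<close>.\<close>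

lemma nn_integral_Schur_weight:
  fixes x :: real
  assumes "0 < x"
  shows "(\<integral>\<^sup>+ s. ennreal (indicator {0<..} s * (sqrt x / (sqrt s * max x s))) \<partial>lborel) \<le> 4"
proof -
  have 1: "((\<lambda>s. 1 / (sqrt x * sqrt s)) has_integral (2 * sqrt x / sqrt x - 2 * sqrt 0 / sqrt x)) {0..x}"
  proof (rule fundamental_theorem_of_calculus_interior[where f = "\<lambda>s. 2 * sqrt s / sqrt x"])
    show "((\<lambda>s. 2 * sqrt s / sqrt x) has_vector_derivative 1 / (sqrt x * sqrt s)) (at s)" if "s \<in> {0<..<x}" for s
      using that assms
      by (auto intro!: derivative_eq_intros simp: has_real_derivative_iff_has_vector_derivative[symmetric] field_simps)
  qed (use assms in \<open>auto intro!: continuous_intros\<close>)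
  have n1: "(\<integral>\<^sup>+ s. ennreal (indicator {0..x} s * (1 / (sqrt x * sqrt s))) \<partial>lborel) = ennreal 2"
    using nn_integral_has_integral_lebesgue[OF _ 1] assms by simp
  have n2: "(\<integral>\<^sup>+ s. ennreal (sqrt x / (s * sqrt s)) * indicator {x..} s \<partial>lborel) = ennreal (0 - (- 2 * sqrt x / sqrt x))"
  proof (rule nn_integral_FTC_atLeast[where F = "\<lambda>s. - 2 * sqrt x / sqrt s"])
    show "((\<lambda>s. - 2 * sqrt x / sqrt s) has_real_derivative sqrt x / (s * sqrt s)) (at s)" if "x \<le> s" for s
      using that assms
      by (auto intro!: derivative_eq_intros simp: field_simps power2_eq_square)
    show "((\<lambda>s. - 2 * sqrt x / sqrt s) \<longlongrightarrow> 0) at_top" by real_asymp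
  qed (use assms in auto)
  have "(\<integral>\<^sup>+ s. ennreal (indicator {0<..} s * (sqrt x / (sqrt s * max x s))) \<partial>lborel)
    \<le> (\<integral>\<^sup>+ s. ennreal (indicator {0..x} s * (1 / (sqrt x * sqrt s))) + ennreal (sqrt x / (s * sqrt s)) * indicator {x..} s \<partial>lborel)"
  proof (rule nn_integral_mono)
    fix s :: real
    show "ennreal (indicator {0<..} s * (sqrt x / (sqrt s * max x s)))
      \<le> ennreal (indicator {0..x} s * (1 / (sqrt x * sqrt s))) + ennreal (sqrt x / (s * sqrt s)) * indicator {x..} s"
    proof (cases "0 < s")
      case True
      show ?thesis
      proof (cases "s \<le> x")
        case le: True
        have "sqrt x / (sqrt s * x) = 1 / (sqrt x * sqrt s)"
          using assms True by (simp add: field_simps)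
        then show ?thesis using True le by (simp add: max_absorb1)
      next
        case False
        then show ?thesis using True by (simp add: max_absorb2 mult.commute)
      qed
    qed simp
  qed
  also have "\<dots> = (\<integral>\<^sup>+ s. ennreal (indicator {0..x} s * (1 / (sqrt x * sqrt s))) \<partial>lborel)
     + (\<integral>\<^sup>+ s. ennreal (sqrt x / (s * sqrt s)) * indicator {x..} s \<partial>lborel)"
    by (rule nn_integral_add) auto
  also have "\<dots> = 4" unfolding n1 n2 using assms by (simp flip: ennreal_plus)
  finally show ?thesis .
qed

section \<open>Exponential estimates, differentiation under the integral, and the resolvent
  kernel\<close>

lemma borel_measurable_cnj [measurable]: "cnj \<in> borel_measurable borel"
  by (intro borel_measurable_continuous_onI continuous_intros)

lemma norm_exp_diff_le:
  fixes z w :: complex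
  assumes "Re z \<le> 0" "Re w \<le> 0"
  shows "norm (exp z - exp w) \<le> norm (z - w)"
proof -
  have "norm (exp z - exp w) \<le> 1 * norm (z - w)"
  proof (rule field_differentiable_bound)
    show "convex {z. Re z \<le> 0}" by (rule convex_halfspace_Re_le)
    show "(exp has_field_derivative exp z) (at z within {z. Re z \<le> 0})" for z :: complex
      by (rule DERIV_subset[OF DERIV_exp]) simp
  qed (use assms in auto)
  then show ?thesis by simp
qed

text \<open>\<open>T\<close> may be unbounded, so \<open>T * f\<close> need not be integrable. In
  the open half plane the exponential absorbs the factor \<open>T\<close> through
  \<open>T * exp (- d * T) \<le> 1 / d\<close>, and dominated convergence applies to the difference
  quotients.\<close>

lemma holomorphic_exp_integral:
  fixes f :: "'a \<Rightarrow> complex" and T :: "'a \<Rightarrow> real"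
  assumes f: "integrable M f" and T[measurable]: "T \<in> borel_measurable M" and T0: "\<And>x. 0 \<le> T x"
  shows "(\<lambda>z. LINT x|M. exp (\<i> * z * of_real (T x)) * f x) holomorphic_on {z. 0 < Im z}"
proof -
  have [measurable]: "f \<in> borel_measurable M" using f by simp
  have "((\<lambda>z. LINT x|M. exp (\<i> * z * of_real (T x)) * f x) has_field_derivative
     (LINT x|M. \<i> * of_real (T x) * exp (\<i> * z * of_real (T x)) * f x)) (at z)" if z: "0 < Im z" for z
  proof -
    define d where "d = Im z / 2"
    have d: "0 < d" using z by (simp add: d_def)
    have bd: "norm ((exp (\<i> * w * of_real (T x)) - exp (\<i> * z * of_real (T x))) / (w - z) * f x) \<le> (1 / d) * norm (f x)"
      if w: "norm (w - z) < d" "w \<noteq> z" for w x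
    proof -
      have Im: "d \<le> Im w" using abs_Im_le_cmod[of "w - z"] w by (simp add: d_def abs_if split: if_splits)
      \<comment> \<open>The decay \<open>exp (- d * T x)\<close> is split off; since
        \<open>d \<le> Im w\<close> and \<open>d \<le> Im z\<close>, the remaining exponents still
        have non-positive real part and \<open>exp\<close> is Lipschitz with constant
        \<open>1\<close> there.\<close>
      let ?a = "\<i> * w * of_real (T x) + of_real (d * T x)" and ?b = "\<i> * z * of_real (T x) + of_real (d * T x)"
      have "exp (\<i> * w * of_real (T x)) - exp (\<i> * z * of_real (T x)) = of_real (exp (- (d * T x))) * (exp ?a - exp ?b)"
        by (simp add: exp_add exp_minus exp_of_real[symmetric] field_simps)
      also have "norm \<dots> = exp (- (d * T x)) * norm (exp ?a - exp ?b)" by (simp add: norm_mult)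
      also have "\<dots> \<le> exp (- (d * T x)) * norm (?a - ?b)"
        using mult_right_mono[OF Im T0[of x]] mult_right_mono[of d "Im z", OF _ T0[of x]] d
        by (intro mult_left_mono norm_exp_diff_le) (auto simp: d_def algebra_simps)
      also have "?a - ?b = \<i> * of_real (T x) * (w - z)" by (simp add: algebra_simps)
      also have "exp (- (d * T x)) * norm \<dots> = (T x * exp (- (d * T x))) * norm (w - z)"
        using T0 by (simp add: norm_mult)
      also have "\<dots> \<le> (1 / d) * norm (w - z)"
      proof (rule mult_right_mono)
        have "d * T x \<le> exp (d * T x)" using exp_ge_add_one_self[of "d * T x"] by linarith
        then show "T x * exp (- (d * T x)) \<le> 1 / d" using d by (simp add: exp_minus field_simps)
      qed simp
      finally have "norm ((exp (\<i> * w * of_real (T x)) - exp (\<i> * z * of_real (T x))) / (w - z)) \<le> 1 / d"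
        using w(2) by (simp add: norm_divide field_simps)
      from mult_right_mono[OF this norm_ge_zero[of "f x"]] show ?thesis by (simp only: norm_mult)
    qed
    have int: "integrable M (\<lambda>x. exp (\<i> * w * of_real (T x)) * f x)" if "0 \<le> Im w" for w
    proof (rule Bochner_Integration.integrable_bound[OF f])
      show "AE x in M. norm (exp (\<i> * w * of_real (T x)) * f x) \<le> norm (f x)"
        using that T0 by (intro AE_I2) (simp add: norm_mult mult_left_le_one_le)
    qed measurable
    have "((\<lambda>w. ((LINT x|M. exp (\<i> * w * of_real (T x)) * f x) - (LINT x|M. exp (\<i> * z * of_real (T x)) * f x)) / (w - z))
      \<longlongrightarrow> (LINT x|M. \<i> * of_real (T x) * exp (\<i> * z * of_real (T x)) * f x)) (at z)"
      unfolding tendsto_at_iff_sequentially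
    proof (intro allI impI)
      fix X :: "nat \<Rightarrow> complex" assume X: "\<forall>i. X i \<in> UNIV - {z}" "X \<longlonglongrightarrow> z"
      then obtain N where N: "\<And>n. n \<ge> N \<Longrightarrow> norm (X n - z) < d"
        using d by (metis LIMSEQ_iff)
      have imX: "0 \<le> Im (X n)" if "n \<ge> N" for n
        using abs_Im_le_cmod[of "X n - z"] N[OF that] d by (simp add: d_def abs_if split: if_splits)
      have "(\<lambda>n. LINT x|M. (exp (\<i> * X (n + N) * of_real (T x)) - exp (\<i> * z * of_real (T x))) / (X (n + N) - z) * f x)
        \<longlonglongrightarrow> (LINT x|M. \<i> * of_real (T x) * exp (\<i> * z * of_real (T x)) * f x)"
      proof (rule integral_dominated_convergence)
        show "integrable M (\<lambda>x. (1 / d) * norm (f x))" using f by simp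
        show "AE x in M. (\<lambda>n. (exp (\<i> * X (n + N) * of_real (T x)) - exp (\<i> * z * of_real (T x))) / (X (n + N) - z) * f x)
            \<longlonglongrightarrow> \<i> * of_real (T x) * exp (\<i> * z * of_real (T x)) * f x"
        proof (intro AE_I2 tendsto_mult tendsto_const)
          fix x
          have "((\<lambda>w. exp (\<i> * w * of_real (T x))) has_field_derivative \<i> * of_real (T x) * exp (\<i> * z * of_real (T x))) (at z)"
            by (auto intro!: derivative_eq_intros)
          then have "((\<lambda>w. (exp (\<i> * w * of_real (T x)) - exp (\<i> * z * of_real (T x))) / (w - z)) \<longlongrightarrow> \<i> * of_real (T x) * exp (\<i> * z * of_real (T x))) (at z)"
            by (simp add: has_field_derivative_iff)
          moreover have "filterlim (\<lambda>n. X (n + N)) (at z) sequentially"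
            using X by (auto simp: filterlim_at intro!: LIMSEQ_ignore_initial_segment)
          ultimately show "(\<lambda>n. (exp (\<i> * X (n + N) * of_real (T x)) - exp (\<i> * z * of_real (T x))) / (X (n + N) - z)) \<longlonglongrightarrow> \<i> * of_real (T x) * exp (\<i> * z * of_real (T x))"
            by (rule filterlim_compose)
        qed
        show "AE x in M. norm ((exp (\<i> * X (n + N) * of_real (T x)) - exp (\<i> * z * of_real (T x))) / (X (n + N) - z) * f x) \<le> (1 / d) * norm (f x)" for n
          using X(1) N[of "n + N"] by (intro AE_I2 bd) auto
      qed measurable
      moreover have "(LINT x|M. (exp (\<i> * X (n + N) * of_real (T x)) - exp (\<i> * z * of_real (T x))) / (X (n + N) - z) * f x)
         = ((LINT x|M. exp (\<i> * X (n + N) * of_real (T x)) * f x) - (LINT x|M. exp (\<i> * z * of_real (T x)) * f x)) / (X (n + N) - z)" for n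
      proof -
        have "(LINT x|M. (exp (\<i> * X (n + N) * of_real (T x)) - exp (\<i> * z * of_real (T x))) / (X (n + N) - z) * f x)
          = (LINT x|M. (exp (\<i> * X (n + N) * of_real (T x)) * f x - exp (\<i> * z * of_real (T x)) * f x) / (X (n + N) - z))"
          by (simp add: algebra_simps)
        also have "\<dots> = (LINT x|M. (exp (\<i> * X (n + N) * of_real (T x)) * f x - exp (\<i> * z * of_real (T x)) * f x)) / (X (n + N) - z)"
          by simp
        also have "(LINT x|M. (exp (\<i> * X (n + N) * of_real (T x)) * f x - exp (\<i> * z * of_real (T x)) * f x))
          = (LINT x|M. exp (\<i> * X (n + N) * of_real (T x)) * f x) - (LINT x|M. exp (\<i> * z * of_real (T x)) * f x)"
          using z imX[of "n + N"] by (intro Bochner_Integration.integral_diff int) auto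
        finally show ?thesis .
      qed
      ultimately have "(\<lambda>n. ((LINT x|M. exp (\<i> * X (n + N) * of_real (T x)) * f x) - (LINT x|M. exp (\<i> * z * of_real (T x)) * f x)) / (X (n + N) - z))
          \<longlonglongrightarrow> (LINT x|M. \<i> * of_real (T x) * exp (\<i> * z * of_real (T x)) * f x)"
        by (simp only:)
      then show "((\<lambda>w. ((LINT x|M. exp (\<i> * w * of_real (T x)) * f x) - (LINT x|M. exp (\<i> * z * of_real (T x)) * f x)) / (w - z)) \<circ> X)
          \<longlonglongrightarrow> (LINT x|M. \<i> * of_real (T x) * exp (\<i> * z * of_real (T x)) * f x)"
        unfolding o_def by (rule LIMSEQ_offset[where k = N])
    qed
    then show ?thesis unfolding has_field_derivative_iff .
  qed
  then show ?thesis
    by (auto simp: holomorphic_on_open open_halfspace_Im_gt)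
qed

lemma integrable_pair_times:
  fixes f g :: "real \<Rightarrow> 'a :: {banach, second_countable_topology, real_normed_algebra}"
  assumes f: "integrable lborel f" and g: "integrable lborel g"
  shows "integrable (lborel \<Otimes>\<^sub>M lborel) (\<lambda>(x, s). f x * g s)"
proof (rule lborel_pair.Fubini_integrable)
  have [measurable]: "f \<in> borel_measurable borel" "g \<in> borel_measurable borel"
    using borel_measurable_integrable[OF f] borel_measurable_integrable[OF g] by auto
  show "(\<lambda>(x, s). f x * g s) \<in> borel_measurable (lborel \<Otimes>\<^sub>M lborel)" by measurable
  show "AE x in lborel. integrable lborel (\<lambda>s. case (x, s) of (x, s) \<Rightarrow> f x * g s)"
    using g by simp
  show "integrable lborel (\<lambda>x. LINT s|lborel. norm (case (x, s) of (x, s) \<Rightarrow> f x * g s))"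
  proof (rule Bochner_Integration.integrable_bound)
    show "integrable lborel (\<lambda>x. norm (f x) * (LINT s|lborel. norm (g s)))"
      using f by simp
    show "AE x in lborel. norm (LINT s|lborel. norm (case (x, s) of (x, s) \<Rightarrow> f x * g s)) \<le> norm (norm (f x) * (LINT s|lborel. norm (g s)))"
    proof (rule AE_I2)
      fix x
      have "(LINT s|lborel. norm (f x * g s)) \<le> (LINT s|lborel. norm (f x) * norm (g s))"
        using f g by (intro integral_mono integrable_norm integrable_mult_right) (auto simp: norm_mult_ineq)
      then show "norm (LINT s|lborel. norm (case (x, s) of (x, s) \<Rightarrow> f x * g s)) \<le> norm (norm (f x) * (LINT s|lborel. norm (g s)))"
        by (simp add: abs_mult)
    qed
  qed measurable
qed

text \<open>The variable \<open>s\<close> is reflected through \<open>\<bar>x + s\<bar>\<close>, which keeps both exponentials bounded for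
  arguments of either sign; the value at \<open>l = 0\<close> is the limit.\<close>

definition res_kernel :: "complex \<Rightarrow> real \<Rightarrow> real \<Rightarrow> complex" where
  "res_kernel l x s = (if l = 0 then of_real ((\<bar>x + s\<bar> - \<bar>x - s\<bar>) / 2)
     else \<i> / (2 * l) * (exp (\<i> * l * of_real \<bar>x - s\<bar>) - exp (\<i> * l * of_real \<bar>x + s\<bar>)))"

lemma res_kernel_measurable [measurable]:
  "(\<lambda>(x, s). res_kernel l x s) \<in> borel_measurable (borel \<Otimes>\<^sub>M borel)"
  unfolding res_kernel_def by measurable

lemma res_kernel_measurable' [measurable]: "(\<lambda>s. res_kernel l x s) \<in> borel_measurable borel"
  unfolding res_kernel_def by measurable

lemma res_kernel_commute: "res_kernel l x s = res_kernel l s x"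
  by (simp add: res_kernel_def abs_minus_commute add.commute)

lemma res_kernel_cnj: "cnj (res_kernel (of_real k) x s) = res_kernel (of_real (- k)) x s"
  by (simp add: res_kernel_def exp_cnj)

lemma abs_add_minus_abs_diff: "\<bar>\<bar>x - s\<bar> - \<bar>x + s\<bar>\<bar> = 2 * min \<bar>x\<bar> \<bar>s\<bar>" for x s :: real
  by (auto simp: abs_if min_def)

text \<open>The Lipschitz bound for \<open>exp\<close> on the left half plane produces a factor
  \<open>|l|\<close> that cancels the denominator. The result is uniform in \<open>l\<close>,
  including \<open>0\<close>.\<close>

lemma norm_res_kernel_le:
  assumes "0 \<le> Im l"
  shows "norm (res_kernel l x s) \<le> min \<bar>x\<bar> \<bar>s\<bar>"
proof (cases "l = 0")
  case False
  define E where "E = exp (\<i> * l * of_real \<bar>x - s\<bar>) - exp (\<i> * l * of_real \<bar>x + s\<bar>)"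
  have "norm E \<le> norm (\<i> * l * of_real \<bar>x - s\<bar> - \<i> * l * of_real \<bar>x + s\<bar>)"
    unfolding E_def using assms by (intro norm_exp_diff_le) (auto intro!: mult_nonneg_nonneg)
  also have "\<i> * l * of_real \<bar>x - s\<bar> - \<i> * l * of_real \<bar>x + s\<bar> = \<i> * l * of_real (\<bar>x - s\<bar> - \<bar>x + s\<bar>)"
    by (simp add: algebra_simps)
  also have "norm \<dots> = norm l * (2 * min \<bar>x\<bar> \<bar>s\<bar>)"
    by (simp only: norm_mult norm_of_real abs_add_minus_abs_diff) simp
  finally have "norm E / (2 * norm l) \<le> min \<bar>x\<bar> \<bar>s\<bar>"
    using False by (subst pos_divide_le_eq) (simp_all add: ac_simps)
  moreover have "res_kernel l x s = \<i> / (2 * l) * E" using False by (simp add: res_kernel_def E_def)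
  then have "norm (res_kernel l x s) = norm E / (2 * norm l)" by (simp add: norm_mult norm_divide)
  ultimately show ?thesis by simp
next
  case True
  have "\<bar>(\<bar>x + s\<bar> - \<bar>x - s\<bar>) / 2\<bar> = min \<bar>x\<bar> \<bar>s\<bar>" using abs_add_minus_abs_diff[of x s] by (simp add: abs_minus_commute)
  then show ?thesis using True unfolding res_kernel_def by (simp only: refl if_True norm_of_real order_refl)
qed

lemma norm_res_kernel_le_inverse:
  assumes "0 \<le> Im l" "l \<noteq> 0"
  shows "norm (res_kernel l x s) \<le> 1 / norm l"
proof -
  have e: "norm (exp (\<i> * l * of_real t)) \<le> 1" if "0 \<le> t" for t :: real
    using assms that by simp
  define E where "E = exp (\<i> * l * of_real \<bar>x - s\<bar>) - exp (\<i> * l * of_real \<bar>x + s\<bar>)"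
  have "norm E \<le> 1 + 1"
    unfolding E_def by (intro order_trans[OF norm_triangle_ineq4] add_mono e) auto
  moreover have "res_kernel l x s = \<i> / (2 * l) * E" using assms by (simp add: res_kernel_def E_def)
  then have "norm (res_kernel l x s) = (norm E / 2) / norm l" by (simp add: norm_mult norm_divide)
  moreover have "(norm E / 2) / norm l \<le> 1 / norm l" using \<open>norm E \<le> 1 + 1\<close> by (intro divide_right_mono) auto
  ultimately show ?thesis by simp
qed

lemma res_kernel_continuous: "((\<lambda>l. res_kernel l x s) \<longlongrightarrow> res_kernel l0 x s) (at l0)"
proof (cases "l0 = 0")
  case False
  have "((\<lambda>l. \<i> / (2 * l) * (exp (\<i> * l * of_real \<bar>x - s\<bar>) - exp (\<i> * l * of_real \<bar>x + s\<bar>)))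
    \<longlongrightarrow> \<i> / (2 * l0) * (exp (\<i> * l0 * of_real \<bar>x - s\<bar>) - exp (\<i> * l0 * of_real \<bar>x + s\<bar>))) (at l0)"
    using False by (intro tendsto_intros) auto
  moreover have "\<forall>\<^sub>F l in at l0. l \<noteq> 0" using False by (rule tendsto_imp_eventually_ne[OF tendsto_ident_at])
  then have "\<forall>\<^sub>F l in at l0. \<i> / (2 * l) * (exp (\<i> * l * of_real \<bar>x - s\<bar>) - exp (\<i> * l * of_real \<bar>x + s\<bar>)) = res_kernel l x s"
    by eventually_elim (simp add: res_kernel_def)
  ultimately show ?thesis using False unfolding res_kernel_def[of l0]
    by (auto intro: Lim_transform_eventually)
next
  case True
  have e: "((\<lambda>l. exp (\<i> * l * c)) has_field_derivative \<i> * c) (at 0)" for c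
    by (rule derivative_eq_intros refl)+ simp
  \<comment> \<open>At \<open>l = 0\<close> the kernel is a difference quotient of exponentials, so
    its limit is a derivative at \<open>0\<close>.\<close>
  have "((\<lambda>l. (exp (\<i> * l * of_real \<bar>x - s\<bar>) - exp (\<i> * l * of_real \<bar>x + s\<bar>)) / l) \<longlongrightarrow> 
     \<i> * of_real \<bar>x - s\<bar> - \<i> * of_real \<bar>x + s\<bar>) (at 0)"
    using DERIV_diff[OF e e, of "of_real \<bar>x - s\<bar>" "of_real \<bar>x + s\<bar>"]
    by (simp add: has_field_derivative_iff)
  then have "((\<lambda>l. \<i> / 2 * ((exp (\<i> * l * of_real \<bar>x - s\<bar>) - exp (\<i> * l * of_real \<bar>x + s\<bar>)) / l)) \<longlongrightarrow> 
     \<i> / 2 * (\<i> * of_real \<bar>x - s\<bar> - \<i> * of_real \<bar>x + s\<bar>)) (at 0)"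
    by (intro tendsto_intros)
  moreover have "\<i> / 2 * (\<i> * of_real \<bar>x - s\<bar> - \<i> * of_real \<bar>x + s\<bar>) = of_real ((\<bar>x + s\<bar> - \<bar>x - s\<bar>) / 2)"
    by (simp add: complex_eq_iff)
  moreover have "\<forall>\<^sub>F l in at 0. \<i> / 2 * ((exp (\<i> * l * of_real \<bar>x - s\<bar>) - exp (\<i> * l * of_real \<bar>x + s\<bar>)) / l) = res_kernel l x s"
    unfolding eventually_at_filter by (auto simp: res_kernel_def)
  ultimately show ?thesis using True unfolding res_kernel_def[of l0]
    by (auto intro: Lim_transform_eventually)
qed

text \<open>The normalised setting: \<open>v\<close> is Borel on the whole line and zero off the
  half-line, so that half-line integrals become plain \<open>lborel\<close> integrals. A general
  \<open>v\<close> agrees almost everywhere on the half-line with such a function.\<close>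

locale form_factor =
  fixes v :: "real \<Rightarrow> complex"
  assumes v_borel [measurable]: "v \<in> borel_measurable borel"
    and v_supp: "\<And>x. x \<le> 0 \<Longrightarrow> v x = 0"
    and v_weighted: "integrable lborel (\<lambda>x. (1 + x\<^sup>2) * (cmod (v x))\<^sup>2)"
begin

lemma v_L2: "integrable lborel (\<lambda>x. (cmod (v x))\<^sup>2)"
  by (rule Bochner_Integration.integrable_bound[OF v_weighted]) (auto intro!: AE_I2 simp: mult_le_cancel_right1)

lemma xv_L2: "integrable lborel (\<lambda>x. x\<^sup>2 * (cmod (v x))\<^sup>2)"
  by (rule Bochner_Integration.integrable_bound[OF v_weighted]) (auto intro!: AE_I2 mult_right_mono)

lemma v_L1: "integrable lborel v"
proof (rule Bochner_Integration.integrable_bound)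
  show "integrable lborel (\<lambda>x. 1 / (1 + x\<^sup>2) + (1 + x\<^sup>2) * (cmod (v x))\<^sup>2)"
    by (intro Bochner_Integration.integrable_add integrable_Poisson_weight v_weighted)
  show "AE x in lborel. norm (v x) \<le> norm (1 / (1 + x\<^sup>2) + (1 + x\<^sup>2) * (cmod (v x))\<^sup>2)"
  proof (rule AE_I2)
    fix x :: real
    \<comment> \<open>Pointwise substitute for the Cauchy-Schwarz inequality:
      \<open>t \<le> 1 + t\<^sup>2\<close> for \<open>t = |v x| * c\<close>, divided by
      \<open>c\<close>.\<close>
    define c where "c = 1 + x\<^sup>2"
    have c: "0 < c" by (simp add: c_def add_pos_nonneg)
    have "2 * (cmod (v x) * c) \<le> 1 + (cmod (v x) * c)\<^sup>2"
      using sum_squares_bound[of 1 "cmod (v x) * c"] by simp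
    moreover have "0 \<le> cmod (v x) * c" using c by simp
    ultimately have "cmod (v x) * c \<le> 1 + (cmod (v x) * c)\<^sup>2" by linarith
    then have "norm (v x) \<le> 1 / c + c * (cmod (v x))\<^sup>2"
      using c by (simp add: field_simps power2_eq_square)
    then show "norm (v x) \<le> norm (1 / (1 + x\<^sup>2) + (1 + x\<^sup>2) * (cmod (v x))\<^sup>2)"
      using c by (simp add: c_def[symmetric])
  qed
qed measurable

text \<open>Hardy's inequality, by the Schur test: with \<open>w x = x |v x|\<close> the integrand is
  \<open>w x * w s / max x s\<close>, which is split by the weights \<open>sqrt (x / s)\<close> and \<open>sqrt (s / x)\<close>.\<close>

lemma Hardy_integrable:
  "integrable (lborel \<Otimes>\<^sub>M lborel) (\<lambda>(x, s). min \<bar>x\<bar> \<bar>s\<bar> * (cmod (v x) * cmod (v s)))"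
proof -
  define h where "h = (\<lambda>x s. x\<^sup>2 * (cmod (v x))\<^sup>2 * (indicator {0<..} x * (indicator {0<..} s * (sqrt x / (sqrt s * max x s)))))"
  have [measurable]: "(\<lambda>(x, s). h x s) \<in> borel_measurable (lborel \<Otimes>\<^sub>M lborel)" unfolding h_def by measurable
  have h_nn: "0 \<le> h x s" for x s by (auto simp: h_def indicator_def)
  have "(\<integral>\<^sup>+ p. ennreal (case p of (x, s) \<Rightarrow> h x s) \<partial>(lborel \<Otimes>\<^sub>M lborel)) = (\<integral>\<^sup>+ x. \<integral>\<^sup>+ s. ennreal (h x s) \<partial>lborel \<partial>lborel)"
    by (subst lborel.nn_integral_fst[symmetric]) auto
  also have "\<dots> \<le> (\<integral>\<^sup>+ x. ennreal (x\<^sup>2 * (cmod (v x))\<^sup>2) * 4 \<partial>lborel)"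
  proof (rule nn_integral_mono)
    fix x :: real
    show "(\<integral>\<^sup>+ s. ennreal (h x s) \<partial>lborel) \<le> ennreal (x\<^sup>2 * (cmod (v x))\<^sup>2) * 4"
    proof (cases "0 < x")
      case True
      have "(\<integral>\<^sup>+ s. ennreal (h x s) \<partial>lborel) = (\<integral>\<^sup>+ s. ennreal (x\<^sup>2 * (cmod (v x))\<^sup>2) * ennreal (indicator {0<..} s * (sqrt x / (sqrt s * max x s))) \<partial>lborel)"
        unfolding h_def using True 
        by (intro nn_integral_cong, subst ennreal_mult[symmetric]) (auto simp: indicator_def)
      also have "\<dots> = ennreal (x\<^sup>2 * (cmod (v x))\<^sup>2) * (\<integral>\<^sup>+ s. ennreal (indicator {0<..} s * (sqrt x / (sqrt s * max x s))) \<partial>lborel)"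
        by (rule nn_integral_cmult) measurable
      also have "\<dots> \<le> ennreal (x\<^sup>2 * (cmod (v x))\<^sup>2) * 4"
        by (intro mult_left_mono nn_integral_Schur_weight True) simp
      finally show ?thesis .
    qed (simp add: h_def)
  qed
  also have "\<dots> = (\<integral>\<^sup>+ x. ennreal (x\<^sup>2 * (cmod (v x))\<^sup>2) \<partial>lborel) * 4"
    by (rule nn_integral_multc) measurable
  also have "\<dots> < \<infinity>"
    using xv_L2 by (simp add: integrable_iff_bounded ennreal_mult_less_top)
  finally have 1: "integrable (lborel \<Otimes>\<^sub>M lborel) (\<lambda>(x, s). h x s)"
    by (intro integrableI_bounded) (auto simp: h_nn split_beta')
  from lborel_pair.integrable_product_swap[OF this]
  have 2: "integrable (lborel \<Otimes>\<^sub>M lborel) (\<lambda>(x, s). h s x)" by simp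
  show ?thesis
  proof (rule Bochner_Integration.integrable_bound[OF Bochner_Integration.integrable_add[OF 1 2]])
    show "AE p in lborel \<Otimes>\<^sub>M lborel. norm (case p of (x, s) \<Rightarrow> min \<bar>x\<bar> \<bar>s\<bar> * (cmod (v x) * cmod (v s)))
      \<le> norm ((case p of (x, s) \<Rightarrow> h x s) + (case p of (x, s) \<Rightarrow> h s x))"
    proof (intro AE_I2)
      fix p :: "real \<times> real"
      obtain x s where p: "p = (x, s)" by fastforce
      have "min \<bar>x\<bar> \<bar>s\<bar> * (cmod (v x) * cmod (v s)) \<le> h x s + h s x"
      proof (cases "0 < x \<and> 0 < s")
        case True
        define a b where "a = sqrt x" and "b = sqrt s"
        have ab: "0 < a" "0 < b" "x = a * a" "s = b * b" using True by (auto simp: a_def b_def)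
        define w z m where "w = x * cmod (v x)" and "z = s * cmod (v s)" and "m = max x s"
        have m: "0 < m" using True by (simp add: m_def less_max_iff_disj)
        have "min x s * (cmod (v x) * cmod (v s)) * m = w * z"
          using True by (simp add: m_def w_def z_def min_def max_def)
        then have e: "min x s * (cmod (v x) * cmod (v s)) = w * z / m" using m by (simp add: eq_divide_eq)
        \<comment> \<open>Dividing by \<open>a * b\<close> turns this symmetric inequality into the
          one with the weights \<open>a / b\<close> and \<open>b / a\<close>.\<close>
        have "2 * (w * a) * (z * b) \<le> (w * a)\<^sup>2 + (z * b)\<^sup>2" by (rule sum_squares_bound)
        moreover have "0 \<le> (w * a) * (z * b)" using True ab by (simp add: w_def z_def)
        ultimately have "(w * a) * (z * b) \<le> (w * a)\<^sup>2 + (z * b)\<^sup>2" by linarith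
        then have "(w * a) * (z * b) / (a * b) \<le> ((w * a)\<^sup>2 + (z * b)\<^sup>2) / (a * b)"
          using ab by (intro divide_right_mono) auto
        moreover have "(w * a) * (z * b) / (a * b) = w * z" using ab by simp
        moreover have "((w * a)\<^sup>2 + (z * b)\<^sup>2) / (a * b) = w\<^sup>2 * (a / b) + z\<^sup>2 * (b / a)"
          using ab by (simp add: add_divide_distrib power2_eq_square)
        ultimately have "w * z \<le> w\<^sup>2 * (a / b) + z\<^sup>2 * (b / a)" by simp
        then have "w * z / m \<le> (w\<^sup>2 * (a / b) + z\<^sup>2 * (b / a)) / m"
          using m by (simp add: divide_right_mono)
        also have "\<dots> = h x s + h s x"
          using True m by (simp add: h_def a_def b_def m_def w_def z_def max.commute add_divide_distrib power_mult_distrib)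
        finally show ?thesis using True e by simp
      next
        case False
        then have "v x = 0 \<or> v s = 0" using v_supp[of x] v_supp[of s] by fastforce
        then show ?thesis using h_nn[of x s] h_nn[of s x] by auto
      qed
      then show "norm (case p of (x, s) \<Rightarrow> min \<bar>x\<bar> \<bar>s\<bar> * (cmod (v x) * cmod (v s)))
      \<le> norm ((case p of (x, s) \<Rightarrow> h x s) + (case p of (x, s) \<Rightarrow> h s x))"
        using h_nn by (simp add: p)
    qed
  qed measurable
qed

lemma vv_integrable: "integrable (lborel \<Otimes>\<^sub>M lborel) (\<lambda>(x, s). v s * cnj (v x))"
proof -
  have "integrable lborel (\<lambda>x. cnj (v x))" using v_L1 by simp
  from integrable_pair_times[OF this v_L1] show ?thesis by (simp add: mult.commute)
qed

lemma bounded_vv_integrable: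
  fixes f :: "real \<times> real \<Rightarrow> complex"
  assumes [measurable]: "f \<in> borel_measurable (lborel \<Otimes>\<^sub>M lborel)"
    and "\<And>x s. 0 < x \<Longrightarrow> 0 < s \<Longrightarrow> norm (f (x, s)) \<le> B"
  shows "integrable (lborel \<Otimes>\<^sub>M lborel) (\<lambda>(x, s). f (x, s) * (v s * cnj (v x)))"
proof (rule Bochner_Integration.integrable_bound)
  show "integrable (lborel \<Otimes>\<^sub>M lborel) (\<lambda>p. of_real B * (case p of (x, s) \<Rightarrow> v s * cnj (v x)))"
    by (intro integrable_mult_right vv_integrable)
  show "AE p in lborel \<Otimes>\<^sub>M lborel. norm (case p of (x, s) \<Rightarrow> f (x, s) * (v s * cnj (v x)))
     \<le> norm (of_real B * (case p of (x, s) \<Rightarrow> v s * cnj (v x)))"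
  proof (rule AE_I2, clarify)
    fix x s :: real
    show "norm (f (x, s) * (v s * cnj (v x))) \<le> norm (of_real B * (v s * cnj (v x)))"
    proof (cases "0 < x \<and> 0 < s")
      case True
      then have "norm (f (x, s)) \<le> \<bar>B\<bar>" using assms(2) by fastforce
      then show ?thesis by (simp add: norm_mult mult_right_mono)
    next
      case False
      then have "v x = 0 \<or> v s = 0" using v_supp[of x] v_supp[of s] by fastforce
      then show ?thesis by auto
    qed
  qed
qed measurable

text \<open>For \<open>Im l > 0\<close> this is the inner product of \<open>R0 (l\<^sup>2) v\<close>
  with \<open>v\<close>; unlike the resolvent, the double integral also makes sense for real
  \<open>l\<close>.\<close>

definition Q :: "complex \<Rightarrow> complex" where
  "Q l = (LINT (x, s)|(lborel \<Otimes>\<^sub>M lborel). res_kernel l x s * (v s * cnj (v x)))"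

lemma Q_integrable:
  assumes "0 \<le> Im l"
  shows "integrable (lborel \<Otimes>\<^sub>M lborel) (\<lambda>(x, s). res_kernel l x s * (v s * cnj (v x)))"
proof (rule Bochner_Integration.integrable_bound[OF Hardy_integrable])
  show "AE p in lborel \<Otimes>\<^sub>M lborel. norm (case p of (x, s) \<Rightarrow> res_kernel l x s * (v s * cnj (v x)))
     \<le> norm (case p of (x, s) \<Rightarrow> min \<bar>x\<bar> \<bar>s\<bar> * (cmod (v x) * cmod (v s)))"
    using norm_res_kernel_le[OF assms]
    by (intro AE_I2) (auto simp: norm_mult mult.commute[of "cmod (v _)" "cmod (v _)"] intro!: mult_right_mono)
qed measurable

lemma Q_continuous: "continuous_on {l. 0 \<le> Im l} Q"
  unfolding continuous_on_sequentially
proof (intro allI ballI impI, elim conjE)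
  fix X :: "nat \<Rightarrow> complex" and l
  assume l: "l \<in> {l. 0 \<le> Im l}" and X: "\<forall>n. X n \<in> {l. 0 \<le> Im l}" "X \<longlonglongrightarrow> l"
  show "(Q \<circ> X) \<longlonglongrightarrow> Q l" unfolding o_def Q_def
  proof (rule integral_dominated_convergence[OF _ _ Hardy_integrable])
    show "AE p in lborel \<Otimes>\<^sub>M lborel. norm (case p of (x, s) \<Rightarrow> res_kernel (X n) x s * (v s * cnj (v x)))
     \<le> (case p of (x, s) \<Rightarrow> min \<bar>x\<bar> \<bar>s\<bar> * (cmod (v x) * cmod (v s)))" for n
      using norm_res_kernel_le[of "X n"] X(1)
      by (intro AE_I2) (auto simp: norm_mult mult.commute[of "cmod (v _)" "cmod (v _)"] intro!: mult_right_mono)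
    show "AE p in lborel \<Otimes>\<^sub>M lborel. (\<lambda>n. case p of (x, s) \<Rightarrow> res_kernel (X n) x s * (v s * cnj (v x)))
      \<longlonglongrightarrow> (case p of (x, s) \<Rightarrow> res_kernel l x s * (v s * cnj (v x)))"
    proof (rule AE_I2, clarify, intro tendsto_mult tendsto_const)
      fix x s
      have "isCont (\<lambda>l. res_kernel l x s) l" by (simp add: isCont_def res_kernel_continuous)
      then show "(\<lambda>n. res_kernel (X n) x s) \<longlonglongrightarrow> res_kernel l x s" using X(2) by (rule isCont_tendsto_compose)
    qed
  qed measurable
qed

text \<open>Away from \<open>l = 0\<close> each exponential is bounded and may be integrated
  separately, since \<open>v\<close> is integrable. Holomorphy and the comparison with
  \<open>r_fun\<close> both start from this form.\<close>

lemma Q_eq_exp: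
  assumes "0 \<le> Im l" "l \<noteq> 0"
  shows "Q l = \<i> / (2 * l) * ((LINT (x, s)|(lborel \<Otimes>\<^sub>M lborel). exp (\<i> * l * of_real \<bar>x - s\<bar>) * (v s * cnj (v x)))
    - (LINT (x, s)|(lborel \<Otimes>\<^sub>M lborel). exp (\<i> * l * of_real \<bar>x + s\<bar>) * (v s * cnj (v x))))"
proof -
  have i: "integrable (lborel \<Otimes>\<^sub>M lborel) (\<lambda>(x, s). exp (\<i> * l * of_real \<bar>x - s\<bar>) * (v s * cnj (v x)))"
    "integrable (lborel \<Otimes>\<^sub>M lborel) (\<lambda>(x, s). exp (\<i> * l * of_real \<bar>x + s\<bar>) * (v s * cnj (v x)))"
    using bounded_vv_integrable[of "\<lambda>(x, s). exp (\<i> * l * of_real \<bar>x - s\<bar>)" 1]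
      bounded_vv_integrable[of "\<lambda>(x, s). exp (\<i> * l * of_real \<bar>x + s\<bar>)" 1] assms by auto
  show ?thesis
    unfolding Bochner_Integration.integral_diff[OF i, symmetric] integral_mult_right_zero[symmetric] Q_def
  proof (intro Bochner_Integration.integral_cong refl, clarify)
    fix x s
    have "res_kernel l x s = \<i> / (2 * l) * (exp (\<i> * l * of_real \<bar>x - s\<bar>) - exp (\<i> * l * of_real \<bar>x + s\<bar>))"
      using assms by (simp add: res_kernel_def)
    then show "res_kernel l x s * (v s * cnj (v x)) = \<i> / (2 * l) *
        (exp (\<i> * l * of_real \<bar>x - s\<bar>) * (v s * cnj (v x)) - exp (\<i> * l * of_real \<bar>x + s\<bar>) * (v s * cnj (v x)))"
      by (simp only: left_diff_distrib mult.assoc)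
  qed
qed

lemma Q_holomorphic: "Q holomorphic_on {l. 0 < Im l}"
proof -
  have 1: "(\<lambda>l. LINT p|(lborel \<Otimes>\<^sub>M lborel). exp (\<i> * l * of_real (T p)) * (case p of (x, s) \<Rightarrow> v s * cnj (v x))) holomorphic_on {l. 0 < Im l}"
    if [measurable]: "T \<in> borel_measurable (lborel \<Otimes>\<^sub>M lborel)" and "\<And>p. 0 \<le> T p" for T
    by (rule holomorphic_exp_integral[OF vv_integrable]) (use that in auto)
  have "(\<lambda>l. \<i> / (2 * l) * ((LINT p|(lborel \<Otimes>\<^sub>M lborel). exp (\<i> * l * of_real (case p of (x, s) \<Rightarrow> \<bar>x - s\<bar>)) * (case p of (x, s) \<Rightarrow> v s * cnj (v x)))
    - (LINT p|(lborel \<Otimes>\<^sub>M lborel). exp (\<i> * l * of_real (case p of (x, s) \<Rightarrow> \<bar>x + s\<bar>)) * (case p of (x, s) \<Rightarrow> v s * cnj (v x))))) holomorphic_on {l. 0 < Im l}"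
    by (intro holomorphic_intros 1) auto
  also have "?this \<longleftrightarrow> ?thesis"
    by (intro holomorphic_cong refl) (subst Q_eq_exp, auto simp: split_beta')
  finally show ?thesis .
qed

lemma norm_Q_le:
  assumes "0 \<le> Im l" "l \<noteq> 0"
  shows "norm (Q l) \<le> (LINT (x, s)|(lborel \<Otimes>\<^sub>M lborel). norm (v s * cnj (v x))) / norm l"
proof -
  have "norm (Q l) \<le> (LINT p|(lborel \<Otimes>\<^sub>M lborel). norm (case p of (x, s) \<Rightarrow> res_kernel l x s * (v s * cnj (v x))))"
    unfolding Q_def by (rule integral_norm_bound)
  also have "\<dots> \<le> (LINT p|(lborel \<Otimes>\<^sub>M lborel). norm (case p of (x, s) \<Rightarrow> v s * cnj (v x)) / norm l)"
  proof (rule integral_mono)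
    show "norm (case p of (x, s) \<Rightarrow> res_kernel l x s * (v s * cnj (v x))) \<le> norm (case p of (x, s) \<Rightarrow> v s * cnj (v x)) / norm l" for p
      using mult_right_mono[OF norm_res_kernel_le_inverse[OF assms], of "norm (v (snd p) * cnj (v (fst p)))" "fst p" "snd p"]
      by (simp add: split_beta' norm_mult)
  qed (intro integrable_norm Q_integrable assms integrable_divide vv_integrable)+
  finally show ?thesis by (simp add: split_beta')
qed

end

section \<open>Integration against exponential kernels\<close>

lemma set_lebesgue_lborel:
  fixes f :: "real \<Rightarrow> 'b::{banach, second_countable_topology}"
  assumes [measurable]: "f \<in> borel_measurable borel" and S: "S \<in> sets borel"
  shows "set_integrable lebesgue S f \<longleftrightarrow> set_integrable lborel S f"
    and "(LINT x:S|lebesgue. f x) = (LINT x:S|lborel. f x)"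
    and "set_borel_measurable lebesgue S f"
proof -
  have m: "(\<lambda>x. indicator S x *\<^sub>R f x) \<in> borel_measurable lborel"
    using S by (intro borel_measurable_scaleR borel_measurable_indicator) auto
  show "set_integrable lebesgue S f \<longleftrightarrow> set_integrable lborel S f"
    unfolding set_integrable_def using m by (rule integrable_completion)
  show "(LINT x:S|lebesgue. f x) = (LINT x:S|lborel. f x)"
    unfolding set_lebesgue_integral_def using m by (rule integral_completion)
  show "set_borel_measurable lebesgue S f"
    unfolding set_borel_measurable_def using m by (rule measurable_completion)
qed

text \<open>Tailored to Green's functions, which are smooth on either side of \<open>x = s\<close>
  but only continuous across it.\<close>

lemma piecewise_FTC:
  fixes p q :: "real \<Rightarrow> complex"
  assumes "\<And>x. (p has_vector_derivative p' x) (at x)" "\<And>x. (q has_vector_derivative q' x) (at x)"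
    and "p s = q s" "a \<le> b"
  shows "((\<lambda>x. if x \<le> s then p' x else q' x) has_integral
     ((if b \<le> s then p b else q b) - (if a \<le> s then p a else q a))) {a..b}"
proof (rule fundamental_theorem_of_calculus_interior_strong[where S = "{s}" and f = "\<lambda>x. if x \<le> s then p x else q x"])
  show "((\<lambda>x. if x \<le> s then p x else q x) has_vector_derivative (if x \<le> s then p' x else q' x)) (at x)"
    if "x \<in> {a<..<b} - {s}" for x
  proof (cases "x < s")
    case True
    have "((\<lambda>x. if x \<le> s then p x else q x) has_vector_derivative p' x) (at x)"
      by (rule has_vector_derivative_transform_within_open[of p "p' x" x "{..<s}"]) (use True assms(1) in auto)
    then show ?thesis using True by simp
  next
    case False
    then have "s < x" using that by auto
    have "((\<lambda>x. if x \<le> s then p x else q x) has_vector_derivative q' x) (at x)"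
      by (rule has_vector_derivative_transform_within_open[of q "q' x" x "{s<..}"]) (use \<open>s < x\<close> assms(2) in auto)
    then show ?thesis using \<open>s < x\<close> by simp
  qed
  have c: "continuous_on T p" "continuous_on T q" for T
    using assms(1,2) by (blast intro: continuous_at_imp_continuous_on has_vector_derivative_continuous)+
  show "continuous_on {a..b} (\<lambda>x. if x \<le> s then p x else q x)"
    by (rule continuous_on_cases_le) (use assms c in \<open>auto intro!: continuous_intros\<close>)
qed (use assms in auto)

lemma integrable_exp_minus_abs:
  fixes \<tau> :: real
  assumes "0 < \<tau>"
  shows "integrable lborel (\<lambda>x. exp (- \<tau> * \<bar>x\<bar>))"
proof (rule Bochner_Integration.integrable_bound)
  show "integrable lborel (\<lambda>x. (1 + 2 / \<tau>\<^sup>2) * (1 / (1 + x\<^sup>2)))"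
    by (rule integrable_mult_right[OF integrable_Poisson_weight])
  show "AE x in lborel. norm (exp (- \<tau> * \<bar>x\<bar>)) \<le> norm ((1 + 2 / \<tau>\<^sup>2) * (1 / (1 + x\<^sup>2)))"
  proof (rule AE_I2)
    fix x :: real
    have p: "0 < 1 + x\<^sup>2" by (simp add: add_pos_nonneg)
    have "1 + (\<tau> * \<bar>x\<bar>) + (\<tau> * \<bar>x\<bar>)\<^sup>2 / 2 \<le> exp (\<tau> * \<bar>x\<bar>)"
      using assms by (intro exp_lower_Taylor_quadratic) auto
    moreover have "0 \<le> \<tau> * \<bar>x\<bar>" using assms by simp
    ultimately have e: "1 + \<tau>\<^sup>2 * x\<^sup>2 / 2 \<le> exp (\<tau> * \<bar>x\<bar>)" by (simp add: power_mult_distrib)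
    have "1 + x\<^sup>2 \<le> (1 + 2 / \<tau>\<^sup>2) * (1 + \<tau>\<^sup>2 * x\<^sup>2 / 2)"
    proof -
      \<comment> \<open>The constant \<open>1 + 2 / \<tau>\<^sup>2\<close> is designed for
        \<open>a * b = x\<^sup>2\<close>, so that \<open>(1 + a) * (1 + b)\<close> already contains
        \<open>1 + x\<^sup>2\<close>.\<close>
      define a b where "a = 2 / \<tau>\<^sup>2" and "b = \<tau>\<^sup>2 * x\<^sup>2 / 2"
      have "a * b = x\<^sup>2" "0 \<le> a" "0 \<le> b" using assms by (simp_all add: a_def b_def)
      then have "1 + x\<^sup>2 \<le> (1 + a) * (1 + b)" by (simp add: algebra_simps)
      then show ?thesis by (simp only: a_def b_def)
    qed
    also have "\<dots> \<le> (1 + 2 / \<tau>\<^sup>2) * exp (\<tau> * \<bar>x\<bar>)"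
      by (intro mult_left_mono e) (auto intro!: add_nonneg_nonneg)
    finally have "exp (- \<tau> * \<bar>x\<bar>) \<le> (1 + 2 / \<tau>\<^sup>2) / (1 + x\<^sup>2)"
      using p by (simp add: exp_minus divide_simps mult.commute)
    then show "norm (exp (- \<tau> * \<bar>x\<bar>)) \<le> norm ((1 + 2 / \<tau>\<^sup>2) * (1 / (1 + x\<^sup>2)))"
      using p by (simp add: add_nonneg_nonneg)
  qed
qed measurable

text \<open>By translation invariance the inner integral over \<open>x\<close> does not see the
  shift. The case \<open>c = - 1\<close> serves convolution with an exponential,
  \<open>c = 1\<close> the autocorrelation \<open>g11\<close>.\<close>

lemma integrable_pair_shear:
  fixes f :: "real \<Rightarrow> real" and g :: "real \<Rightarrow> real"
  assumes f: "integrable lborel f" and g: "integrable lborel g"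
  shows "integrable (lborel \<Otimes>\<^sub>M lborel) (\<lambda>(x, s). f (x + c * s) * g s)"
proof -
  have [measurable]: "f \<in> borel_measurable borel" "g \<in> borel_measurable borel"
    using borel_measurable_integrable[OF f] borel_measurable_integrable[OF g] by auto
  have shift: "integrable lborel (\<lambda>x. f (x + t))" "(LINT x|lborel. norm (f (x + t))) = (LINT x|lborel. norm (f x))" for t
    using lborel_integrable_real_affine[OF f, of 1 t] lborel_integral_real_affine[of 1 "\<lambda>x. norm (f x)" t]
    by (auto simp: add.commute)
  have "integrable (lborel \<Otimes>\<^sub>M lborel) (\<lambda>(s, x). f (x + c * s) * g s)"
  proof (rule lborel_pair.Fubini_integrable)
    show "AE s in lborel. integrable lborel (\<lambda>x. case (s, x) of (s, x) \<Rightarrow> f (x + c * s) * g s)"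
      using shift by simp
    have "(\<lambda>s. LINT x|lborel. norm (case (s, x) of (s, x) \<Rightarrow> f (x + c * s) * g s)) = (\<lambda>s. (LINT x|lborel. norm (f x)) * norm (g s))"
      using shift(2) by (simp add: abs_mult)
    then show "integrable lborel (\<lambda>s. LINT x|lborel. norm (case (s, x) of (s, x) \<Rightarrow> f (x + c * s) * g s))"
      using g by simp
  qed measurable
  from lborel_pair.integrable_product_swap[OF this] show ?thesis by simp
qed

text \<open>Integration by parts for indefinite integrals: both sides are evaluations of the double
  integral of \<open>g s * k t\<close> over the triangle \<open>a \<le> s \<le> t \<le> b\<close>.\<close>

lemma indefinite_integral_by_parts:
  fixes y g u k :: "real \<Rightarrow> complex"
  assumes g: "set_integrable lborel {a..b} g" and k: "set_integrable lborel {a..b} k" and "a \<le> b"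
    and [measurable]: "g \<in> borel_measurable borel" "k \<in> borel_measurable borel"
      "y \<in> borel_measurable borel" "u \<in> borel_measurable borel"
    and y: "\<And>t. a \<le> t \<Longrightarrow> t \<le> b \<Longrightarrow> y t - y a = (LINT s:{a..t}|lborel. g s)"
    and u: "\<And>s. a \<le> s \<Longrightarrow> s \<le> b \<Longrightarrow> u b - u s = (LINT t:{s..b}|lborel. k t)"
  shows "set_integrable lborel {a..b} (\<lambda>t. y t * k t)" "set_integrable lborel {a..b} (\<lambda>t. g t * u t)"
    "(LINT t:{a..b}|lborel. y t * k t) + (LINT t:{a..b}|lborel. g t * u t) = y b * u b - y a * u a"
proof -
  define G where "G = (\<lambda>s. indicator {a..b} s *\<^sub>R g s)"
  define H where "H = (\<lambda>t. indicator {a..b} t *\<^sub>R k t)"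
  have GH: "integrable lborel G" "integrable lborel H"
    using g k by (auto simp: G_def H_def set_integrable_def)
  have [measurable]: "G \<in> borel_measurable borel" "H \<in> borel_measurable borel"
    unfolding G_def H_def by measurable
  define F where "F = (\<lambda>s t. if s \<le> t then G s * H t else 0)"
  have F: "integrable (lborel \<Otimes>\<^sub>M lborel) (\<lambda>(s, t). F s t)"
  proof (rule Bochner_Integration.integrable_bound[OF integrable_pair_times[OF GH]])
    show "(\<lambda>(s, t). F s t) \<in> borel_measurable (lborel \<Otimes>\<^sub>M lborel)" unfolding F_def by measurable
  qed (auto simp: F_def)
  have inner1: "(LINT s|lborel. F s t) = indicator {a..b} t *\<^sub>R ((y t - y a) * k t)" for t
  proof (cases "t \<in> {a..b}")
    case True
    have "(LINT s|lborel. F s t) = (LINT s|lborel. (indicator {a..t} s *\<^sub>R g s) * k t)"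
      using True by (intro Bochner_Integration.integral_cong) (auto simp: F_def G_def H_def indicator_def)
    also have "\<dots> = (LINT s|lborel. indicator {a..t} s *\<^sub>R g s) * k t" by (rule integral_mult_left_zero)
    also have "\<dots> = (y t - y a) * k t" using y[of t] True by (simp add: set_lebesgue_integral_def)
    finally show ?thesis using True by simp
  next
    case False
    have "F s t = 0" for s using False by (auto simp: F_def H_def)
    then show ?thesis using False by simp
  qed
  have inner2: "(LINT t|lborel. F s t) = indicator {a..b} s *\<^sub>R (g s * (u b - u s))" for s
  proof (cases "s \<in> {a..b}")
    case True
    have "(LINT t|lborel. F s t) = (LINT t|lborel. g s * (indicator {s..b} t *\<^sub>R k t))"
      using True by (intro Bochner_Integration.integral_cong) (auto simp: F_def G_def H_def indicator_def)
    also have "\<dots> = g s * (LINT t|lborel. indicator {s..b} t *\<^sub>R k t)" by (rule integral_mult_right_zero)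
    also have "\<dots> = g s * (u b - u s)" using u[of s] True by (simp add: set_lebesgue_integral_def)
    finally show ?thesis using True by simp
  next
    case False
    have "F s t = 0" for t using False by (auto simp: F_def G_def)
    then show ?thesis using False by simp
  qed
  have i1: "set_integrable lborel {a..b} (\<lambda>t. (y t - y a) * k t)"
    using lborel_pair.integrable_snd[OF F] by (simp add: inner1 set_integrable_def)
  have i2: "set_integrable lborel {a..b} (\<lambda>t. g t * (u b - u t))"
    using lborel_pair.integrable_fst[OF F] by (simp add: inner2 set_integrable_def)
  have eq: "(LINT t:{a..b}|lborel. (y t - y a) * k t) = (LINT t:{a..b}|lborel. g t * (u b - u t))"
    using lborel_pair.Fubini_integral[OF F] by (simp add: inner1 inner2 set_lebesgue_integral_def)
  have "set_integrable lborel {a..b} (\<lambda>t. (y t - y a) * k t + y a * k t)"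
    using i1 k by (intro set_integral_add(1)) auto
  then show 1: "set_integrable lborel {a..b} (\<lambda>t. y t * k t)" by (simp add: algebra_simps)
  have "set_integrable lborel {a..b} (\<lambda>t. g t * u b - g t * (u b - u t))"
    using i2 g by (intro set_integral_diff(1)) auto
  then show 2: "set_integrable lborel {a..b} (\<lambda>t. g t * u t)" by (simp add: algebra_simps)
  have "(LINT t:{a..b}|lborel. (y t - y a) * k t) = (LINT t:{a..b}|lborel. y t * k t - y a * k t)"
    by (simp add: algebra_simps)
  also have "\<dots> = (LINT t:{a..b}|lborel. y t * k t) - y a * (LINT t:{a..b}|lborel. k t)"
    using 1 k by (subst set_integral_diff(2)) auto
  also have "(LINT t:{a..b}|lborel. k t) = u b - u a" using u[of a] \<open>a \<le> b\<close> by simp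
  finally have e1: "(LINT t:{a..b}|lborel. (y t - y a) * k t) = (LINT t:{a..b}|lborel. y t * k t) - y a * (u b - u a)" .
  have "(LINT t:{a..b}|lborel. g t * (u b - u t)) = (LINT t:{a..b}|lborel. g t * u b - g t * u t)"
    by (simp add: algebra_simps)
  also have "\<dots> = (LINT t:{a..b}|lborel. g t) * u b - (LINT t:{a..b}|lborel. g t * u t)"
    using 2 g by (subst set_integral_diff(2)) auto
  also have "(LINT t:{a..b}|lborel. g t) = y b - y a" using y[of b] \<open>a \<le> b\<close> by simp
  finally have e2: "(LINT t:{a..b}|lborel. g t * (u b - u t)) = (y b - y a) * u b - (LINT t:{a..b}|lborel. g t * u t)" .
  show "(LINT t:{a..b}|lborel. y t * k t) + (LINT t:{a..b}|lborel. g t * u t) = y b * u b - y a * u a"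
    using eq unfolding e1 e2 by algebra
qed

text \<open>The derivative in \<open>x\<close>; it jumps by \<open>-1\<close> at \<open>x = s\<close>.\<close>

definition res_kernel_deriv :: "complex \<Rightarrow> real \<Rightarrow> real \<Rightarrow> complex" where
  "res_kernel_deriv l x s = (exp (\<i> * l * of_real \<bar>x + s\<bar>)
     + (if x \<le> s then 1 else - 1) * exp (\<i> * l * of_real \<bar>x - s\<bar>)) / 2"

lemma res_kernel_deriv_measurable [measurable]:
  "(\<lambda>(x, s). res_kernel_deriv l x s) \<in> borel_measurable (borel \<Otimes>\<^sub>M borel)"
  "(\<lambda>s. res_kernel_deriv l x s) \<in> borel_measurable borel"
  unfolding res_kernel_deriv_def by measurable

lemma norm_exp_kernels:
  assumes "0 < Im l" "0 < x" "0 < s"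
  shows "norm (res_kernel l x s) \<le> 1 / norm l * exp (- Im l * \<bar>x - s\<bar>)"
    and "norm (res_kernel_deriv l x s) \<le> 1 * exp (- Im l * \<bar>x - s\<bar>)"
proof -
  let ?E = "exp (\<i> * l * of_real \<bar>x - s\<bar>)" and ?E' = "exp (\<i> * l * of_real \<bar>x + s\<bar>)"
  have n: "norm ?E = exp (- Im l * \<bar>x - s\<bar>)" by simp
  have "Im l * \<bar>x - s\<bar> \<le> Im l * \<bar>x + s\<bar>" using assms by (intro mult_left_mono) auto
  then have n': "norm ?E' \<le> exp (- Im l * \<bar>x - s\<bar>)" by simp
  have "norm (?E - ?E') \<le> 2 * exp (- Im l * \<bar>x - s\<bar>)" using norm_triangle_ineq4[of ?E ?E'] n n' by linarith
  moreover have "res_kernel l x s = \<i> / (2 * l) * (?E - ?E')" using assms(1) by (auto simp: res_kernel_def)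
  then have "norm (res_kernel l x s) = (1 / norm l) * (norm (?E - ?E') / 2)" by (simp add: norm_mult norm_divide)
  moreover have "(1 / norm l) * (norm (?E - ?E') / 2) \<le> 1 / norm l * exp (- Im l * \<bar>x - s\<bar>)"
    using calculation(1) by (intro mult_left_mono) auto
  ultimately show "norm (res_kernel l x s) \<le> 1 / norm l * exp (- Im l * \<bar>x - s\<bar>)" by (simp only:)
  have "norm (?E' + (if x \<le> s then 1 else - 1) * ?E) \<le> 2 * exp (- Im l * \<bar>x - s\<bar>)"
  proof (cases "x \<le> s")
    case True
    show ?thesis using norm_triangle_ineq[of ?E' ?E] n n' True by (simp only: if_True mult_1)
  next
    case False
    have "?E' + (- 1) * ?E = ?E' - ?E" by simp
    then show ?thesis using norm_triangle_ineq4[of ?E' ?E] n n' False by (simp only: if_False)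
  qed
  then show "norm (res_kernel_deriv l x s) \<le> 1 * exp (- Im l * \<bar>x - s\<bar>)"
    by (simp add: res_kernel_deriv_def norm_divide)
qed

lemma has_vector_derivative_exp_affine:
  fixes c :: complex
  shows "((\<lambda>x. exp (c * of_real (a * x + b))) has_vector_derivative c * of_real a * exp (c * of_real (a * x + b))) (at x)"
proof -
  have "((\<lambda>z. exp (c * (of_real a * z + of_real b))) has_field_derivative c * of_real a * exp (c * (of_real a * of_real x + of_real b))) (at (of_real x))"
    by (auto intro!: derivative_eq_intros)
  from has_vector_derivative_real_field[OF this] show ?thesis by simp
qed

text \<open>The second part is the integrated form of \<open>- K'' - l\<^sup>2 K = delta\<close> at
  \<open>s\<close>. The interval in the indicator is half-open because
  \<open>res_kernel_deriv\<close> takes its left-hand value at \<open>x = s\<close>: the jump is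
  seen exactly when \<open>a \<le> s < b\<close>.\<close>

lemma kernel_FTC:
  assumes l: "l \<noteq> 0" and "0 < a" "a \<le> b" "0 < s"
  shows "((\<lambda>x. res_kernel_deriv l x s) has_integral (res_kernel l b s - res_kernel l a s)) {a..b}"
    and "((\<lambda>x. - l\<^sup>2 * res_kernel l x s) has_integral
      (res_kernel_deriv l b s - res_kernel_deriv l a s + indicator {a..<b} s)) {a..b}"
proof -
  define c K where "c = \<i> * l" and "K = \<i> / (2 * l)"
  have c: "c * c = - l\<^sup>2" "K * c = - 1 / 2" "- l\<^sup>2 * K = - c / 2"
  proof -
    have "c * c = (\<i> * \<i>) * (l * l)" unfolding c_def by (simp only: mult_ac)
    then show "c * c = - l\<^sup>2" by (simp add: power2_eq_square)
  qed (use l in \<open>auto simp: c_def K_def power2_eq_square field_simps\<close>)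
  define A B C where "A = (\<lambda>x::real. exp (c * of_real (1 * x + s)))"
    and "B = (\<lambda>x::real. exp (c * of_real (1 * x + (- s))))" and "C = (\<lambda>x::real. exp (c * of_real ((- 1) * x + s)))"
  have dA: "(A has_vector_derivative c * A x) (at x)" and dB: "(B has_vector_derivative c * B x) (at x)"
    and dC: "(C has_vector_derivative - c * C x) (at x)" for x
    using has_vector_derivative_exp_affine[of c 1 s x] has_vector_derivative_exp_affine[of c 1 "- s" x]
      has_vector_derivative_exp_affine[of c "-1" s x] by (simp_all add: A_def B_def C_def)
  define p q where "p = (\<lambda>x. K * (C x - A x))" and "q = (\<lambda>x. K * (B x - A x))"
  \<comment> \<open>The added \<open>1\<close> in \<open>q1\<close> undoes the jump, so that
    \<open>p1\<close> and \<open>q1\<close> agree at \<open>s\<close> and can be glued;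
    \<open>K1\<close> subtracts it again.\<close>
  define p1 q1 where "p1 = (\<lambda>x. (A x + C x) / 2)" and "q1 = (\<lambda>x. (A x - B x) / 2 + 1)"
  have Kpq: "res_kernel l x s = (if x \<le> s then p x else q x)" if "0 < x" for x
    using that assms by (auto simp: res_kernel_def p_def q_def A_def B_def C_def c_def K_def)
  have K1: "res_kernel_deriv l x s = (if x \<le> s then p1 x else q1 x) - (if x \<le> s then 0 else 1)" if "0 < x" for x
    using that assms by (auto simp: res_kernel_deriv_def p1_def q1_def A_def B_def C_def c_def)
  have BC: "B s = 1" "C s = 1" by (simp_all add: B_def C_def)
  have dp: "(p has_vector_derivative p1 x) (at x)" for x
  proof -
    have "(p has_vector_derivative K * (- c * C x - c * A x)) (at x)"
      unfolding p_def by (intro has_vector_derivative_mult_right has_vector_derivative_diff dA dC)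
    also have "K * (- c * C x - c * A x) = - (K * c) * (C x + A x)" by (simp add: algebra_simps)
    finally show ?thesis unfolding c by (simp add: p1_def algebra_simps)
  qed
  have dq: "(q has_vector_derivative q1 x - 1) (at x)" for x
  proof -
    have "(q has_vector_derivative K * (c * B x - c * A x)) (at x)"
      unfolding q_def by (intro has_vector_derivative_mult_right has_vector_derivative_diff dA dB)
    also have "K * (c * B x - c * A x) = (K * c) * (B x - A x)" by (simp add: algebra_simps)
    finally show ?thesis unfolding c by (simp add: q1_def diff_divide_distrib)
  qed
  have dp1: "(p1 has_vector_derivative - l\<^sup>2 * p x) (at x)" for x
  proof -
    have "(p1 has_vector_derivative (c * A x + - c * C x) / 2) (at x)"
      unfolding p1_def by (intro has_vector_derivative_divide has_vector_derivative_add dA dC)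
    also have "(c * A x + - c * C x) / 2 = (- l\<^sup>2 * (K)) * (C x - A x)" unfolding c by (simp add: field_simps)
    finally show ?thesis by (simp only: p_def mult.assoc)
  qed
  have dq1: "(q1 has_vector_derivative - l\<^sup>2 * q x) (at x)" for x
  proof -
    have "(q1 has_vector_derivative (c * A x - c * B x) / 2 + 0) (at x)"
      unfolding q1_def by (intro has_vector_derivative_divide has_vector_derivative_add has_vector_derivative_diff has_vector_derivative_const dA dB)
    also have "(c * A x - c * B x) / 2 + 0 = (- l\<^sup>2 * (K)) * (B x - A x)" unfolding c by (simp add: field_simps)
    finally show ?thesis by (simp only: q_def mult.assoc)
  qed
  have "((\<lambda>x. if x \<le> s then p1 x else q1 x - 1) has_integral
     ((if b \<le> s then p b else q b) - (if a \<le> s then p a else q a))) {a..b}"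
    using BC assms by (intro piecewise_FTC dp dq) (auto simp: p_def q_def)
  then have "((\<lambda>x. if x \<le> s then p1 x else q1 x - 1) has_integral (res_kernel l b s - res_kernel l a s)) {a..b}"
    using assms by (simp add: Kpq)
  then show "((\<lambda>x. res_kernel_deriv l x s) has_integral (res_kernel l b s - res_kernel l a s)) {a..b}"
    by (rule has_integral_eq[rotated]) (use assms K1 in auto)
  have "((\<lambda>x. if x \<le> s then - l\<^sup>2 * p x else - l\<^sup>2 * q x) has_integral
     ((if b \<le> s then p1 b else q1 b) - (if a \<le> s then p1 a else q1 a))) {a..b}"
    using BC assms by (intro piecewise_FTC dp1 dq1) (auto simp: p1_def q1_def field_simps)
  also have "(if b \<le> s then p1 b else q1 b) - (if a \<le> s then p1 a else q1 a)
    = res_kernel_deriv l b s - res_kernel_deriv l a s + indicator {a..<b} s"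
    using assms K1[of a] K1[of b] by (auto simp: indicator_def)
  finally show "((\<lambda>x. - l\<^sup>2 * res_kernel l x s) has_integral
      (res_kernel_deriv l b s - res_kernel_deriv l a s + indicator {a..<b} s)) {a..b}"
    by (rule has_integral_eq[rotated]) (use assms Kpq in auto)
qed

context form_factor
begin

text \<open>Fubini on \<open>{a..b}\<close> times the half-line: an antiderivative of the kernel in
  \<open>x\<close> passes through the integration against \<open>v\<close>.\<close>

lemma kernel_integral_swap:
  fixes k :: "real \<Rightarrow> real \<Rightarrow> complex"
  assumes [measurable]: "(\<lambda>(x, s). k x s) \<in> borel_measurable (borel \<Otimes>\<^sub>M borel)"
    and bd: "\<And>x s. a \<le> x \<Longrightarrow> x \<le> b \<Longrightarrow> 0 < s \<Longrightarrow> norm (k x s) \<le> C"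
    and D: "\<And>s. 0 < s \<Longrightarrow> ((\<lambda>x. k x s) has_integral D s) {a..b}"
  shows "set_integrable lborel {a..b} (\<lambda>x. LINT s|lborel. k x s * v s)"
    and "(LINT x:{a..b}|lborel. (LINT s|lborel. k x s * v s)) = (LINT s|lborel. D s * v s)"
proof -
  have [measurable]: "(\<lambda>x. k x s) \<in> borel_measurable borel" for s by measurable
  define F where "F = (\<lambda>x s. indicator {a..b} x *\<^sub>R (k x s * v s))"
  have ind: "integrable lborel (\<lambda>x. indicator {a..b} x *\<^sub>R complex_of_real C)"
    using borel_integrable_compact[of "{a..b}" "\<lambda>x. complex_of_real C"] by simp
  have F: "integrable (lborel \<Otimes>\<^sub>M lborel) (\<lambda>(x, s). F x s)"
  proof (rule Bochner_Integration.integrable_bound[OF integrable_pair_times[OF ind v_L1]])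
    show "(\<lambda>(x, s). F x s) \<in> borel_measurable (lborel \<Otimes>\<^sub>M lborel)" unfolding F_def by measurable
    show "AE p in lborel \<Otimes>\<^sub>M lborel. norm (case p of (x, s) \<Rightarrow> F x s) \<le> norm (case p of (x, s) \<Rightarrow> indicator {a..b} x *\<^sub>R complex_of_real C * v s)"
    proof (rule AE_I2, clarify)
      fix x s :: real
      show "norm (F x s) \<le> norm (indicator {a..b} x *\<^sub>R complex_of_real C * v s)"
      proof (cases "0 < s \<and> x \<in> {a..b}")
        case True
        then have "norm (k x s) \<le> \<bar>C\<bar>" using bd[of x s] by auto
        then show ?thesis using True by (simp add: F_def norm_mult mult_right_mono)
      next
        case False
        then show ?thesis using v_supp[of s] by (auto simp: F_def)
      qed
    qed
  qed
  have i1: "(LINT s|lborel. F x s) = indicator {a..b} x *\<^sub>R (LINT s|lborel. k x s * v s)" for x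
    by (simp add: F_def)
  have i2: "(LINT x|lborel. F x s) = D s * v s" for s
  proof (cases "0 < s")
    case True
    have "set_integrable lborel {a..b} (\<lambda>x. k x s)"
      unfolding set_integrable_def
    proof (rule Bochner_Integration.integrable_bound[OF ind])
      show "AE x in lborel. norm (indicator {a..b} x *\<^sub>R k x s) \<le> norm (indicator {a..b} x *\<^sub>R complex_of_real C)"
        using bd[OF _ _ True] by (intro AE_I2) (auto simp: indicator_def intro: order_trans[OF _ abs_ge_self])
    qed measurable
    then have "(LINT x:{a..b}|lborel. k x s) = D s"
      using set_borel_integral_eq_integral(2) integral_unique[OF D[OF True]] by metis
    moreover have "(LINT x|lborel. F x s) = (LINT x|lborel. (indicator {a..b} x *\<^sub>R k x s) * v s)"
      by (simp add: F_def)
    moreover have "\<dots> = (LINT x|lborel. indicator {a..b} x *\<^sub>R k x s) * v s" by (rule integral_mult_left_zero)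
    ultimately show ?thesis by (simp only: set_lebesgue_integral_def)
  qed (simp add: F_def v_supp)
  show "set_integrable lborel {a..b} (\<lambda>x. LINT s|lborel. k x s * v s)"
    using lborel_pair.integrable_fst[OF F] by (simp add: i1 set_integrable_def)
  show "(LINT x:{a..b}|lborel. (LINT s|lborel. k x s * v s)) = (LINT s|lborel. D s * v s)"
    using lborel_pair.Fubini_integral[OF F] by (simp add: i1 i2 set_lebesgue_integral_def)
qed

text \<open>Square integrability is obtained cheaply: \<open>y\<close> is bounded because the kernel
  is, and integrable because the exponential is, so its square is dominated by the bound times
  \<open>|y|\<close>.\<close>

lemma exp_kernel_integral:
  fixes k :: "real \<Rightarrow> real \<Rightarrow> complex"
  assumes [measurable]: "(\<lambda>(x, s). k x s) \<in> borel_measurable (borel \<Otimes>\<^sub>M borel)"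
    and bd: "\<And>x s. 0 < x \<Longrightarrow> 0 < s \<Longrightarrow> norm (k x s) \<le> C * exp (- \<tau> * \<bar>x - s\<bar>)" and \<tau>: "0 < \<tau>"
  defines "y \<equiv> \<lambda>x. LINT s|lborel. k x s * v s"
  shows "y \<in> borel_measurable borel"
    and "\<And>x. 0 < x \<Longrightarrow> integrable lborel (\<lambda>s. k x s * v s)"
    and "\<And>x. 0 < x \<Longrightarrow> norm (y x) \<le> \<bar>C\<bar> * (LINT s|lborel. norm (v s))"
    and "set_integrable lborel {0<..} (\<lambda>x. (cmod (y x))\<^sup>2)"
    and "(y \<longlongrightarrow> 0) at_top"
proof -
  have [measurable]: "(\<lambda>s. k x s) \<in> borel_measurable borel" for x by measurable
  show ym[measurable]: "y \<in> borel_measurable borel" unfolding y_def by measurable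
  have kv: "norm (k x s * v s) \<le> \<bar>C\<bar> * exp (- \<tau> * \<bar>x - s\<bar>) * norm (v s)" if "0 < x" for x s
  proof (cases "0 < s")
    case True
    have "norm (k x s) \<le> C * exp (- \<tau> * \<bar>x - s\<bar>)" by (rule bd[OF that True])
    also have "\<dots> \<le> \<bar>C\<bar> * exp (- \<tau> * \<bar>x - s\<bar>)" by (intro mult_right_mono) auto
    finally show ?thesis by (simp add: norm_mult mult_right_mono)
  qed (simp add: v_supp)
  have kv': "norm (k x s * v s) \<le> \<bar>C\<bar> * norm (v s)" if "0 < x" for x s
  proof -
    have "\<bar>C\<bar> * exp (- \<tau> * \<bar>x - s\<bar>) * norm (v s) \<le> \<bar>C\<bar> * 1 * norm (v s)"
      using \<tau> by (intro mult_right_mono mult_left_mono) auto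
    with kv[OF that] show ?thesis by (metis mult.right_neutral order_trans)
  qed
  have vn: "integrable lborel (\<lambda>s. \<bar>C\<bar> * norm (v s))" using v_L1 by simp
  show int: "integrable lborel (\<lambda>s. k x s * v s)" if "0 < x" for x
    by (rule Bochner_Integration.integrable_bound[OF vn])
       (use kv'[OF that] in \<open>auto intro!: AE_I2 order_trans[OF _ abs_ge_self]\<close>)
  show yb: "norm (y x) \<le> \<bar>C\<bar> * (LINT s|lborel. norm (v s))" if "0 < x" for x
  proof -
    have "norm (y x) \<le> (LINT s|lborel. norm (k x s * v s))" unfolding y_def by (rule integral_norm_bound)
    also have "\<dots> \<le> (LINT s|lborel. \<bar>C\<bar> * norm (v s))"
      using kv' that by (intro integral_mono integrable_norm int vn) auto
    finally show ?thesis by simp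
  qed
  define F where "F = (\<lambda>x s. indicator {0<..} x *\<^sub>R (k x s * v s))"
  have "integrable lborel (\<lambda>s. norm (v s))" using v_L1 by simp
  from integrable_mult_right[OF integrable_pair_shear[OF integrable_exp_minus_abs[OF \<tau>] this, of "-1"], of "\<bar>C\<bar>"]
  have E: "integrable (lborel \<Otimes>\<^sub>M lborel) (\<lambda>p. \<bar>C\<bar> * (case p of (x, s) \<Rightarrow> exp (- \<tau> * \<bar>x - s\<bar>) * norm (v s)))" by simp
  have F: "integrable (lborel \<Otimes>\<^sub>M lborel) (\<lambda>(x, s). F x s)"
  proof (rule Bochner_Integration.integrable_bound[OF E])
    show "(\<lambda>(x, s). F x s) \<in> borel_measurable (lborel \<Otimes>\<^sub>M lborel)" unfolding F_def by measurable
    show "AE p in lborel \<Otimes>\<^sub>M lborel. norm (case p of (x, s) \<Rightarrow> F x s) \<le> norm (\<bar>C\<bar> * (case p of (x, s) \<Rightarrow> exp (- \<tau> * \<bar>x - s\<bar>) * norm (v s)))"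
    proof (rule AE_I2, clarify)
      fix x s :: real
      show "norm (F x s) \<le> norm (\<bar>C\<bar> * (exp (- \<tau> * \<bar>x - s\<bar>) * norm (v s)))"
        using kv[of x s] by (auto simp: F_def indicator_def mult.assoc)
    qed
  qed
  have "(\<lambda>x. LINT s|lborel. F x s) = (\<lambda>x. indicator {0<..} x *\<^sub>R y x)" by (simp add: F_def y_def)
  then have i1: "integrable lborel (\<lambda>x. indicator {0<..} x *\<^sub>R y x)"
    using lborel_pair.integrable_fst[OF F] by simp
  define B where "B = \<bar>C\<bar> * (LINT s|lborel. norm (v s))"
  show "set_integrable lborel {0<..} (\<lambda>x. (cmod (y x))\<^sup>2)"
    unfolding set_integrable_def
  proof (rule Bochner_Integration.integrable_bound)
    show "integrable lborel (\<lambda>x. B * norm (indicator {0<..} x *\<^sub>R y x))" using i1 by (intro integrable_mult_right integrable_norm)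
    show "AE x in lborel. norm (indicator {0<..} x *\<^sub>R (cmod (y x))\<^sup>2) \<le> norm (B * norm (indicator {0<..} x *\<^sub>R y x))"
    proof (rule AE_I2)
      fix x
      have "(cmod (y x))\<^sup>2 \<le> \<bar>B\<bar> * cmod (y x)" if "0 < x"
        using mult_right_mono[OF yb[OF that], of "cmod (y x)"] unfolding B_def[symmetric] power2_eq_square
        by (meson abs_ge_self mult_right_mono norm_ge_zero order_trans)
      then show "norm (indicator {0<..} x *\<^sub>R (cmod (y x))\<^sup>2) \<le> norm (B * norm (indicator {0<..} x *\<^sub>R y x))"
        by (auto simp: indicator_def abs_mult)
    qed
  qed measurable
  have "((\<lambda>x. LINT s|lborel. k x s * v s) \<longlongrightarrow> (LINT s|(lborel :: real measure). 0)) at_top"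
  proof (rule integral_dominated_convergence_at_top[OF _ _ vn])
    show "\<forall>\<^sub>F x in at_top. AE s in lborel. norm (k x s * v s) \<le> \<bar>C\<bar> * norm (v s)"
      using eventually_gt_at_top[of 0] by eventually_elim (use kv' in auto)
    show "AE s in lborel. ((\<lambda>x. k x s * v s) \<longlongrightarrow> 0) at_top"
    proof (rule AE_I2, rule Lim_null_comparison)
      fix s
      show "\<forall>\<^sub>F x in at_top. norm (k x s * v s) \<le> \<bar>C\<bar> * exp (- \<tau> * \<bar>x - s\<bar>) * norm (v s)"
        using eventually_gt_at_top[of 0] by eventually_elim (rule kv)
      have "((\<lambda>x. exp (- \<tau> * \<bar>x - s\<bar>)) \<longlongrightarrow> 0) at_top" using \<tau> by real_asymp
      then show "((\<lambda>x. \<bar>C\<bar> * exp (- \<tau> * \<bar>x - s\<bar>) * norm (v s)) \<longlongrightarrow> 0) at_top"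
        by (intro tendsto_mult_left_zero tendsto_mult_right_zero)
    qed
  qed measurable
  then show "(y \<longlongrightarrow> 0) at_top" by (simp add: y_def)
qed

end

section \<open>The resolvent and the energy identity\<close>

text \<open>Integration by parts is available only on compact intervals with positive left end; this
  passes to the whole half-line.\<close>

lemma half_line_exhaustion:
  fixes \<phi> :: "real \<Rightarrow> complex"
  assumes "set_integrable lborel {0<..} \<phi>" and [measurable]: "\<phi> \<in> borel_measurable borel"
  shows "(\<lambda>n. LINT x:{1 / (real n + 1)..real n + 1}|lborel. \<phi> x) \<longlonglongrightarrow> (LINT x:{0<..}|lborel. \<phi> x)"
  unfolding set_lebesgue_integral_def
proof (rule integral_dominated_convergence)
  show "integrable lborel (\<lambda>x. norm (indicator {0<..} x *\<^sub>R \<phi> x))"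
    using assms(1) by (intro integrable_norm) (simp add: set_integrable_def)
  show "AE x in lborel. norm (indicator {1 / (real n + 1)..real n + 1} x *\<^sub>R \<phi> x) \<le> norm (indicator {0<..} x *\<^sub>R \<phi> x)" for n
  proof (intro AE_I2)
    fix x :: real
    have "0 < 1 / (real n + 1)" by simp
    then have "x \<in> {1 / (real n + 1)..real n + 1} \<Longrightarrow> 0 < x" by (meson atLeastAtMost_iff less_le_trans)
    then show "norm (indicator {1 / (real n + 1)..real n + 1} x *\<^sub>R \<phi> x) \<le> norm (indicator {0<..} x *\<^sub>R \<phi> x)"
      by (auto simp: indicator_def)
  qed
  show "AE x in lborel. (\<lambda>n. indicator {1 / (real n + 1)..real n + 1} x *\<^sub>R \<phi> x) \<longlonglongrightarrow> indicator {0<..} x *\<^sub>R \<phi> x"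
  proof (intro AE_I2 tendsto_eventually)
    fix x :: real
    show "\<forall>\<^sub>F n in sequentially. indicator {1 / (real n + 1)..real n + 1} x *\<^sub>R \<phi> x = indicator {0<..} x *\<^sub>R \<phi> x"
    proof (cases "0 < x")
      case True
      obtain N :: nat where N: "x < real N" "1 / x < real N"
        by (metis reals_Archimedean2 less_trans linorder_less_linear)
      show ?thesis
        using eventually_ge_at_top[of N]
      proof eventually_elim
        case (elim n)
        then have n: "x < real n + 1" "1 / x < real n + 1" using N by linarith+
        then have "1 / (real n + 1) \<le> x" using True by (simp add: field_simps)
        then show ?case using n True by simp
      qed
    next
      case False
      have "x \<notin> {1 / (real n + 1)..real n + 1}" for n :: nat
      proof -
        have "0 < 1 / (real n + 1)" by simp
        then have "x < 1 / (real n + 1)" using False by linarith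
        then show ?thesis by simp
      qed
      then show ?thesis using False by simp
    qed
  qed
qed measurable

lemma integral_pair_times:
  fixes f g :: "real \<Rightarrow> complex"
  assumes f: "integrable lborel f" and g: "integrable lborel g"
  shows "(LINT (x, s)|(lborel \<Otimes>\<^sub>M lborel). f x * g s) = (LINT x|lborel. f x) * (LINT s|lborel. g s)"
  using lborel_pair.integral_fst[OF integrable_pair_times[OF f g]] by simp

lemma integral_cnj_eq:
  fixes f :: "'a \<Rightarrow> complex"
  shows "(LINT x|M. cnj (f x)) = cnj (LINT x|M. f x)"
  by (rule integral_bounded_linear'[OF bounded_linear_cnj bounded_linear_cnj]) auto

context form_factor
begin

text \<open>The Green's function candidate for \<open>R0 (l\<^sup>2) v\<close>, identified with it
  in \<open>R0_eq_res\<close>.\<close>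

definition res :: "complex \<Rightarrow> real \<Rightarrow> complex" where
  "res l x = (LINT s|lborel. res_kernel l x s * v s)"

definition res_deriv :: "complex \<Rightarrow> real \<Rightarrow> complex" where
  "res_deriv l x = (LINT s|lborel. res_kernel_deriv l x s * v s)"

lemma res_bounds:
  assumes "0 < Im l"
  shows "res l \<in> borel_measurable borel" "res_deriv l \<in> borel_measurable borel"
    "\<And>x. 0 < x \<Longrightarrow> integrable lborel (\<lambda>s. res_kernel l x s * v s)"
    "\<And>x. 0 < x \<Longrightarrow> integrable lborel (\<lambda>s. res_kernel_deriv l x s * v s)"
    "\<And>x. 0 < x \<Longrightarrow> norm (res_deriv l x) \<le> (LINT s|lborel. norm (v s))"
    "set_integrable lborel {0<..} (\<lambda>x. (cmod (res l x))\<^sup>2)"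
    "set_integrable lborel {0<..} (\<lambda>x. (cmod (res_deriv l x))\<^sup>2)"
    "(res l \<longlongrightarrow> 0) at_top" "(res_deriv l \<longlongrightarrow> 0) at_top"
  using exp_kernel_integral[OF res_kernel_measurable norm_exp_kernels(1)[OF assms] assms, folded res_def]
    exp_kernel_integral[OF res_kernel_deriv_measurable(1) norm_exp_kernels(2)[OF assms] assms, folded res_deriv_def]
  by auto

lemma L2_halfI:
  fixes f :: "real \<Rightarrow> complex"
  assumes [measurable]: "f \<in> borel_measurable borel" and "set_integrable lborel {0<..} (\<lambda>x. (cmod (f x))\<^sup>2)"
  shows "f \<in> L2_half"
  using assms by (simp add: L2_half_def set_lebesgue_lborel)

lemma v_L2_half: "v \<in> L2_half"
proof (rule L2_halfI[OF v_borel])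
  show "set_integrable lborel {0<..} (\<lambda>x. (cmod (v x))\<^sup>2)"
    unfolding set_integrable_def by (rule integrable_mult_indicator[OF _ v_L2]) simp
qed

text \<open>Both parts integrate \<open>kernel_FTC\<close> against \<open>v\<close>; the indicator
  there becomes the integral of \<open>v\<close>, that is, the inhomogeneity of the
  equation.\<close>

lemma ac_deriv_res:
  assumes l: "0 < Im l"
  shows "ac_deriv (res l) (res_deriv l)"
    and "ac_deriv (res_deriv l) (\<lambda>x. - v x - l\<^sup>2 * res l x)"
proof -
  note [measurable] = res_bounds(1,2)[OF l]
  have l0: "l \<noteq> 0" using l by auto
  show "ac_deriv (res l) (res_deriv l)" unfolding ac_deriv_def
  proof (intro allI impI, elim conjE)
    fix a b :: real assume ab: "0 < a" "a \<le> b"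
    have bd: "norm (res_kernel_deriv l x s) \<le> 1" if "a \<le> x" "x \<le> b" "0 < s" for x s
    proof -
      have "exp (- Im l * \<bar>x - s\<bar>) \<le> 1" using l by simp
      then show ?thesis using norm_exp_kernels(2)[OF l, of x s] that ab by linarith
    qed
    note S = kernel_integral_swap[OF res_kernel_deriv_measurable(1) bd kernel_FTC(1)[OF l0 ab], folded res_deriv_def]
    have "(LINT x:{a..b}|lborel. res_deriv l x) = (LINT s|lborel. (res_kernel l b s - res_kernel l a s) * v s)"
      by (rule S)
    also have "\<dots> = (LINT s|lborel. res_kernel l b s * v s - res_kernel l a s * v s)" by (simp add: left_diff_distrib)
    also have "\<dots> = res l b - res l a"
      unfolding res_def using ab by (intro Bochner_Integration.integral_diff res_bounds[OF l]) auto
    finally show "set_integrable lebesgue {a..b} (res_deriv l) \<and> res l b - res l a = (LINT x:{a..b}|lebesgue. res_deriv l x)"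
      using S(1) by (simp add: set_lebesgue_lborel)
  qed
  show "ac_deriv (res_deriv l) (\<lambda>x. - v x - l\<^sup>2 * res l x)" unfolding ac_deriv_def
  proof (intro allI impI, elim conjE)
    fix a b :: real assume ab: "0 < a" "a \<le> b"
    have bd: "norm (- l\<^sup>2 * res_kernel l x s) \<le> norm l" if "a \<le> x" "x \<le> b" "0 < s" for x s
    proof -
      have "norm (res_kernel l x s) \<le> 1 / norm l" using l l0 by (intro norm_res_kernel_le_inverse) auto
      then have "(norm l)\<^sup>2 * norm (res_kernel l x s) \<le> (norm l)\<^sup>2 * (1 / norm l)" by (intro mult_left_mono) auto
      then show ?thesis using l0 by (simp add: norm_mult norm_power power2_eq_square)
    qed
    have m: "(\<lambda>(x, s). - l\<^sup>2 * res_kernel l x s) \<in> borel_measurable (borel \<Otimes>\<^sub>M borel)" by measurable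
    have eq: "(\<lambda>x. LINT s|lborel. - l\<^sup>2 * res_kernel l x s * v s) = (\<lambda>x. - l\<^sup>2 * res l x)"
      unfolding res_def by (simp add: mult.assoc)
    note S = kernel_integral_swap[OF m bd kernel_FTC(2)[OF l0 ab], unfolded eq]
    have vi: "set_integrable lborel S v" if "S \<in> sets borel" for S
      unfolding set_integrable_def using that by (intro integrable_mult_indicator v_L1) auto
    have iv: "integrable lborel (\<lambda>s. indicator {a..<b} s * v s)"
      by (rule Bochner_Integration.integrable_bound[OF v_L1]) (measurable, auto simp: indicator_def)
    have "(LINT x:{a..b}|lborel. - l\<^sup>2 * res l x) = (LINT s|lborel. (res_kernel_deriv l b s - res_kernel_deriv l a s + indicator {a..<b} s) * v s)"
      by (rule S(2))
    also have "\<dots> = (LINT s|lborel. (res_kernel_deriv l b s * v s - res_kernel_deriv l a s * v s) + indicator {a..<b} s * v s)"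
      by (simp add: algebra_simps)
    also have "\<dots> = (res_deriv l b - res_deriv l a) + (LINT s|lborel. indicator {a..<b} s * v s)"
    proof -
      have "(LINT s|lborel. res_kernel_deriv l b s * v s - res_kernel_deriv l a s * v s) = res_deriv l b - res_deriv l a"
        unfolding res_deriv_def using ab by (intro Bochner_Integration.integral_diff res_bounds[OF l]) auto
      then show ?thesis using ab
        by (subst Bochner_Integration.integral_add[OF Bochner_Integration.integrable_diff iv]) (auto intro!: res_bounds[OF l])
    qed
    \<comment> \<open>Half-open and closed interval differ by the null set consisting of
      \<open>b\<close>.\<close>
    also have "(LINT s|lborel. indicator {a..<b} s * v s) = (LINT s:{a..b}|lborel. v s)"
      unfolding set_lebesgue_integral_def
    proof (rule integral_cong_AE)
      show "AE s in lborel. indicator {a..<b} s * v s = indicator {a..b} s *\<^sub>R v s"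
        using AE_lborel_singleton[of b] by eventually_elim (auto simp: indicator_def)
    qed measurable
    finally have e: "(LINT x:{a..b}|lborel. - l\<^sup>2 * res l x) = res_deriv l b - res_deriv l a + (LINT s:{a..b}|lborel. v s)" .
    have "set_integrable lborel {a..b} (\<lambda>x. - l\<^sup>2 * res l x - v x)"
      and "(LINT x:{a..b}|lborel. - l\<^sup>2 * res l x - v x) = (LINT x:{a..b}|lborel. - l\<^sup>2 * res l x) - (LINT x:{a..b}|lborel. v x)"
      using S(1) vi by (auto intro!: set_integral_diff)
    moreover have "(\<lambda>x. - l\<^sup>2 * res l x - v x) = (\<lambda>x. - v x - l\<^sup>2 * res l x)" by auto
    ultimately have "set_integrable lborel {a..b} (\<lambda>x. - v x - l\<^sup>2 * res l x)"
      and "(LINT x:{a..b}|lborel. - v x - l\<^sup>2 * res l x) = (LINT x:{a..b}|lborel. - l\<^sup>2 * res l x) - (LINT x:{a..b}|lborel. v x)"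
      by simp_all
    then show "set_integrable lebesgue {a..b} (\<lambda>x. - v x - l\<^sup>2 * res l x) \<and>
        res_deriv l b - res_deriv l a = (LINT x:{a..b}|lebesgue. - v x - l\<^sup>2 * res l x)"
      unfolding e by (simp add: set_lebesgue_lborel)
  qed
qed

lemma res_L2: 
  assumes l: "0 < Im l"
  shows "res l \<in> L2_half" "res_deriv l \<in> L2_half" "(\<lambda>x. - v x - l\<^sup>2 * res l x) \<in> L2_half"
proof -
  show 1: "res l \<in> L2_half" "res_deriv l \<in> L2_half" using res_bounds[OF l] by (auto intro: L2_halfI)
  show "(\<lambda>x. - v x - l\<^sup>2 * res l x) \<in> L2_half"
    using L2_half_lincomb[OF v_L2_half 1(1), of "-1" "- l\<^sup>2"] by simp
qed

text \<open>The kernel bound \<open>min x s \<le> x\<close> forces the Dirichlet condition.\<close>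

lemma res_at_0:
  assumes l: "0 < Im l"
  shows "(res l \<longlongrightarrow> 0) (at_right 0)"
proof (rule Lim_null_comparison)
  have "((\<lambda>x. x * (LINT s|lborel. norm (v s))) \<longlongrightarrow> 0 * (LINT s|lborel. norm (v s))) (at_right 0)"
    by (intro tendsto_intros)
  then show "((\<lambda>x. x * (LINT s|lborel. norm (v s))) \<longlongrightarrow> 0) (at_right 0)" by simp
  show "\<forall>\<^sub>F x in at_right 0. norm (res l x) \<le> x * (LINT s|lborel. norm (v s))"
    using eventually_at_right_less[of 0]
  proof eventually_elim
    case (elim x)
    have "norm (res l x) \<le> (LINT s|lborel. norm (res_kernel l x s * v s))" unfolding res_def by (rule integral_norm_bound)
    also have "\<dots> \<le> (LINT s|lborel. x * norm (v s))"
    proof (rule integral_mono)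
      show "norm (res_kernel l x s * v s) \<le> x * norm (v s)" for s
        using norm_res_kernel_le[of l x s] l elim by (simp add: norm_mult mult_right_mono)
    qed (use res_bounds[OF l] elim v_L1 in auto)
    finally show ?case by simp
  qed
qed

lemma R0_eq_res:
  assumes "0 < Im l" "0 < x"
  shows "R0 (l\<^sup>2) v x = res l x"
  using assms by (intro R0_eqI[OF assms(1) res_L2 ac_deriv_res res_at_0]) auto

lemma integrable_res_v:
  assumes l: "0 < Im l"
  shows "integrable lborel (\<lambda>x. res l x * cnj (v x))" and "(LINT x|lborel. res l x * cnj (v x)) = Q l"
proof -
  have *: "(LINT s|lborel. res_kernel l x s * (v s * cnj (v x))) = res l x * cnj (v x)" for x
    unfolding res_def integral_mult_left_zero[symmetric] by (simp add: mult.assoc)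
  show "integrable lborel (\<lambda>x. res l x * cnj (v x))"
    using lborel_pair.integrable_fst[OF Q_integrable[of l]] l by (simp add: *)
  show "(LINT x|lborel. res l x * cnj (v x)) = Q l"
    using lborel_pair.integral_fst[OF Q_integrable[of l]] l by (simp add: * Q_def)
qed

lemma b1_eq:
  assumes l: "0 < Im l"
  shows "b1 \<alpha> v (l\<^sup>2) = 1 + of_real \<alpha> * Q l"
proof -
  note [measurable] = res_bounds(1,2)[OF l]
  have "inner_half (R0 (l\<^sup>2) v) v = (LINT x:{0<..}|lebesgue. res l x * cnj (v x))"
    unfolding inner_half_def by (rule set_lebesgue_integral_cong) (use R0_eq_res[OF l] in auto)
  also have "\<dots> = (LINT x:{0<..}|lborel. res l x * cnj (v x))"
    by (rule set_lebesgue_lborel) auto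
  also have "\<dots> = (LINT x|lborel. res l x * cnj (v x))"
    unfolding set_lebesgue_integral_def
    by (intro Bochner_Integration.integral_cong) (auto simp: indicator_def v_supp)
  finally show ?thesis using integrable_res_v[OF l] by (simp add: b1_def)
qed

text \<open>Pairing \<open>- y'' - l\<^sup>2 y = v\<close> with \<open>y\<close> and integrating by
  parts. The boundary terms \<open>y * cnj y'\<close> vanish because \<open>y\<close> tends to
  \<open>0\<close> at both ends while \<open>y'\<close> stays bounded.\<close>

lemma energy_identity:
  assumes l: "0 < Im l"
  shows "Q l = of_real (LINT x:{0<..}|lborel. (cmod (res_deriv l x))\<^sup>2)
     - cnj (l\<^sup>2) * of_real (LINT x:{0<..}|lborel. (cmod (res l x))\<^sup>2)"
proof -
  note [measurable] = res_bounds(1,2)[OF l]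
  define y g h where "y = res l" and "g = res_deriv l" and "h = (\<lambda>x. - v x - l\<^sup>2 * res l x)"
  have [measurable]: "y \<in> borel_measurable borel" "g \<in> borel_measurable borel" "h \<in> borel_measurable borel"
    unfolding y_def g_def h_def by measurable
  have ac: "ac_deriv y g" "ac_deriv g h" unfolding y_def g_def h_def by (rule ac_deriv_res[OF l])+
  \<comment> \<open>This is the almost everywhere derivative of \<open>y * cnj g\<close>; inserting
    the equation for \<open>h\<close> exhibits the three terms of the identity.\<close>
  define \<phi> where "\<phi> = (\<lambda>t. y t * cnj (h t) + g t * cnj (g t))"
  have [measurable]: "\<phi> \<in> borel_measurable borel" unfolding \<phi>_def by measurable
  have phi: "\<phi> = (\<lambda>t. of_real ((cmod (g t))\<^sup>2) - y t * cnj (v t) - cnj (l\<^sup>2) * of_real ((cmod (y t))\<^sup>2))"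
    unfolding \<phi>_def h_def y_def[symmetric] complex_norm_square by (auto simp: algebra_simps)
  have i1: "set_integrable lborel {0<..} (\<lambda>t. complex_of_real ((cmod (g t))\<^sup>2))"
    and i2: "set_integrable lborel {0<..} (\<lambda>t. complex_of_real ((cmod (y t))\<^sup>2))"
    using res_bounds(6,7)[OF l] unfolding g_def y_def set_integrable_def
    by (auto simp: scaleR_conv_of_real simp flip: of_real_mult of_real_power)
  have i3: "set_integrable lborel {0<..} (\<lambda>t. y t * cnj (v t))"
    unfolding set_integrable_def y_def using integrable_res_v[OF l] by (intro integrable_mult_indicator) auto
  have iphi: "set_integrable lborel {0<..} \<phi>"
    unfolding phi by (intro set_integral_diff(1) set_integrable_mult_right i1 i2 i3)
  have parts: "(LINT t:{a..b}|lborel. \<phi> t) = y b * cnj (g b) - y a * cnj (g a)" if ab: "0 < a" "a \<le> b" for a b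
  proof -
    have c: "set_integrable lborel {p..q} g" "y q - y p = (LINT t:{p..q}|lborel. g t)"
      "set_integrable lborel {p..q} h" "g q - g p = (LINT t:{p..q}|lborel. h t)" if "0 < p" "p \<le> q" for p q
      using ac that unfolding ac_deriv_def by (auto simp: set_lebesgue_lborel)
    have ch: "set_integrable lborel {a..b} (\<lambda>t. cnj (h t))"
      using c(3)[OF ab] unfolding set_integrable_def by (simp flip: complex_cnj_scaleR)
    have u: "cnj (g b) - cnj (g s) = (LINT t:{s..b}|lborel. cnj (h t))" if "a \<le> s" "s \<le> b" for s
    proof -
      have "cnj (g b) - cnj (g s) = cnj (LINT t:{s..b}|lborel. h t)"
        using c(4)[of s b] that ab by (simp flip: complex_cnj_diff)
      then show ?thesis unfolding set_lebesgue_integral_def by (simp flip: integral_cnj_eq)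
    qed
    have y: "y t - y a = (LINT s:{a..t}|lborel. g s)" if "a \<le> t" "t \<le> b" for t using c(2)[of a t] that ab by simp
    have m: "g \<in> borel_measurable borel" "(\<lambda>t. cnj (h t)) \<in> borel_measurable borel"
      "y \<in> borel_measurable borel" "(\<lambda>t. cnj (g t)) \<in> borel_measurable borel" by measurable
    note P = indefinite_integral_by_parts[where u = "\<lambda>t. cnj (g t)", OF c(1)[OF ab] ch ab(2) m y u]
    have "(LINT t:{a..b}|lborel. \<phi> t) = (LINT t:{a..b}|lborel. y t * cnj (h t)) + (LINT t:{a..b}|lborel. g t * cnj (g t))"
      unfolding \<phi>_def by (rule set_integral_add(2)[OF P(1,2)])
    also have "\<dots> = y b * cnj (g b) - y a * cnj (g a)" by (rule P(3))
    finally show ?thesis .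
  qed
  have "(\<lambda>n. LINT t:{1 / (real n + 1)..real n + 1}|lborel. \<phi> t) \<longlonglongrightarrow> (LINT t:{0<..}|lborel. \<phi> t)"
    by (rule half_line_exhaustion[OF iphi]) measurable
  moreover have "(\<lambda>n. LINT t:{1 / (real n + 1)..real n + 1}|lborel. \<phi> t) \<longlonglongrightarrow> 0"
  proof -
    define B where "B = (LINT s|lborel. norm (v s))"
    have lims: "filterlim (\<lambda>n. 1 / (real n + 1)) (at_right 0) sequentially" "filterlim (\<lambda>n. real n + 1) at_top sequentially"
      by real_asymp+
    have y1: "(\<lambda>n. y (real n + 1)) \<longlonglongrightarrow> 0" and y0: "(\<lambda>n. y (1 / (real n + 1))) \<longlonglongrightarrow> 0"
      using filterlim_compose[OF res_bounds(8)[OF l] lims(2)] filterlim_compose[OF res_at_0[OF l] lims(1)]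
      by (simp_all add: y_def)
    have gB: "norm (g t) \<le> B" if "0 < t" for t using res_bounds(5)[OF l that] by (simp add: g_def B_def)
    have "(\<lambda>n. y (t n) * cnj (g (t n))) \<longlonglongrightarrow> 0" if "(\<lambda>n. y (t n)) \<longlonglongrightarrow> 0" "\<And>n. 0 < t n" for t :: "nat \<Rightarrow> real"
    proof (rule Lim_null_comparison)
      show "(\<lambda>n. norm (y (t n)) * B) \<longlonglongrightarrow> 0" using tendsto_norm_zero[OF that(1)] by (rule tendsto_mult_left_zero)
      show "\<forall>\<^sub>F n in sequentially. norm (y (t n) * cnj (g (t n))) \<le> norm (y (t n)) * B"
        using gB[OF that(2)] by (intro always_eventually allI) (simp add: norm_mult mult_left_mono)
    qed
    from tendsto_diff[OF this[OF y1] this[OF y0]]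
    have "(\<lambda>n. y (real n + 1) * cnj (g (real n + 1)) - y (1 / (real n + 1)) * cnj (g (1 / (real n + 1)))) \<longlonglongrightarrow> 0"
      by simp
    moreover have "1 / (real n + 1) \<le> real n + 1" for n
    proof -
      have "1 / (real n + 1) \<le> 1" by simp
      then show ?thesis by linarith
    qed
    ultimately show ?thesis by (subst parts) auto
  qed
  ultimately have "0 = (LINT t:{0<..}|lborel. \<phi> t)" using LIMSEQ_unique by blast
  also have "\<dots> = (LINT t:{0<..}|lborel. of_real ((cmod (g t))\<^sup>2)) - (LINT t:{0<..}|lborel. y t * cnj (v t))
      - (LINT t:{0<..}|lborel. cnj (l\<^sup>2) * of_real ((cmod (y t))\<^sup>2))"
    unfolding phi by (subst set_integral_diff(2) | intro set_integral_diff(1) set_integrable_mult_right i1 i2 i3)+ (rule refl)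
  also have "(LINT t:{0<..}|lborel. y t * cnj (v t)) = Q l"
  proof -
    have "(LINT t:{0<..}|lborel. y t * cnj (v t)) = (LINT t|lborel. res l t * cnj (v t))"
      unfolding set_lebesgue_integral_def y_def
      by (intro Bochner_Integration.integral_cong) (auto simp: indicator_def v_supp)
    then show ?thesis using integrable_res_v[OF l] by simp
  qed
  also have "(LINT t:{0<..}|lborel. cnj (l\<^sup>2) * of_real ((cmod (y t))\<^sup>2)) = cnj (l\<^sup>2) * of_real (LINT t:{0<..}|lborel. (cmod (y t))\<^sup>2)"
    by (simp add: set_lebesgue_integral_def scaleR_conv_of_real algebra_simps flip: of_real_mult of_real_power integral_complex_of_real)
  also have "(LINT t:{0<..}|lborel. complex_of_real ((cmod (g t))\<^sup>2)) = of_real (LINT t:{0<..}|lborel. (cmod (g t))\<^sup>2)"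
    by (simp add: set_lebesgue_integral_def scaleR_conv_of_real flip: of_real_mult of_real_power)
  finally show ?thesis by (simp add: y_def g_def algebra_simps)
qed

text \<open>A zero would make \<open>Q l\<close> the negative real number
  \<open>- 1 / \<alpha>\<close>. The imaginary part of the energy identity,
  \<open>2 * Re l * Im l * N0\<close>, then vanishes: either \<open>l\<close> is purely imaginary,
  where the identity gives \<open>Q l \<ge> 0\<close>, or \<open>y\<close> vanishes almost
  everywhere and \<open>Q l = 0\<close>.\<close>

lemma Q_nonresonant:
  assumes l: "0 < Im l" and "0 < \<alpha>"
  shows "1 + of_real \<alpha> * Q l \<noteq> 0"
proof
  assume 0: "1 + of_real \<alpha> * Q l = 0"
  note [measurable] = res_bounds(1,2)[OF l]
  define N1 N0 where "N1 = (LINT x:{0<..}|lborel. (cmod (res_deriv l x))\<^sup>2)" and "N0 = (LINT x:{0<..}|lborel. (cmod (res l x))\<^sup>2)"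
  have nn: "0 \<le> N1" "0 \<le> N0" by (auto simp: N1_def N0_def set_lebesgue_integral_def intro!: integral_nonneg_AE)
  have Q: "Q l = of_real N1 - cnj (l\<^sup>2) * of_real N0" using energy_identity[OF l] by (simp add: N1_def N0_def)
  have neg: "Q l = - 1 / of_real \<alpha>" using 0 \<open>0 < \<alpha>\<close> by (simp add: field_simps eq_neg_iff_add_eq_0)
  then have ReIm: "Im (Q l) = 0" "Re (Q l) < 0" using \<open>0 < \<alpha>\<close> by (auto simp: Re_divide_of_real)
  have "Re l * Im l * N0 = 0" using ReIm(1) by (auto simp: Q power2_eq_square)
  then consider "Re l = 0" | "N0 = 0" using l by auto
  then show False
  proof cases
    case 1
    then have "Re (Q l) = N1 + (Im l)\<^sup>2 * N0" by (simp add: Q power2_eq_square)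
    moreover have "0 \<le> (Im l)\<^sup>2 * N0" using nn by simp
    ultimately show False using ReIm(2) nn by linarith
  next
    case 2
    have "AE x in lborel. indicator {0<..} x *\<^sub>R (cmod (res l x))\<^sup>2 = 0"
      using 2 res_bounds(6)[OF l] unfolding N0_def set_lebesgue_integral_def set_integrable_def
      by (subst (asm) integral_nonneg_eq_0_iff_AE) auto
    then have "AE x in lborel. res l x * cnj (v x) = 0"
      by eventually_elim (auto simp: indicator_def v_supp split: if_splits)
    then have "Q l = 0" using integrable_res_v(2)[OF l] integral_eq_zero_AE by metis
    with ReIm show False by simp
  qed
qed

text \<open>This covers the point that \<open>r_fun\<close> cannot: on the imaginary axis
  \<open>- cnj (l\<^sup>2)\<close> is positive, so both energy terms are non-negative, and the sign
  survives in the limit.\<close>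

lemma Re_Q_0: "0 \<le> Re (Q 0)"
proof (rule tendsto_lowerbound)
  have "((\<lambda>e. Re (Q (\<i> * of_real e))) \<longlongrightarrow> Re (Q 0)) (at 0 within {0<..})"
  proof (intro tendsto_Re)
    have "(Q \<longlongrightarrow> Q 0) (at 0 within {l. 0 \<le> Im l})" using Q_continuous by (simp add: continuous_on_def)
    then show "((\<lambda>e. Q (\<i> * of_real e)) \<longlongrightarrow> Q 0) (at_right 0)"
      by (rule filterlim_compose)
         (auto simp: filterlim_at eventually_at_filter intro!: tendsto_eq_intros always_eventually)
  qed
  then show "((\<lambda>e. Re (Q (\<i> * of_real e))) \<longlongrightarrow> Re (Q 0)) (at_right 0)" .
  show "\<forall>\<^sub>F e in at_right 0. 0 \<le> Re (Q (\<i> * of_real e))"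
    using eventually_at_right_less[of 0]
  proof eventually_elim
    case (elim e)
    then have l: "0 < Im (\<i> * of_real e)" by simp
    show ?case unfolding energy_identity[OF l]
      by (auto simp: power2_eq_square set_lebesgue_integral_def intro!: add_nonneg_nonneg mult_nonneg_nonneg integral_nonneg_AE)
  qed
qed simp

end

section \<open>Boundary values in terms of \<open>v\<close>\<close>

context form_factor
begin

lemma integral_half_line_v:
  fixes f :: "real \<Rightarrow> complex"
  assumes [measurable]: "f \<in> borel_measurable borel"
  shows "(LINT x:{0<..}|lebesgue. f x * v x) = (LINT x|lborel. f x * v x)"
proof -
  have "(LINT x:{0<..}|lebesgue. f x * v x) = (LINT x:{0<..}|lborel. f x * v x)"
    by (rule set_lebesgue_lborel(2)) measurable
  also have "\<dots> = (LINT x|lborel. f x * v x)"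
    unfolding set_lebesgue_integral_def
    by (intro Bochner_Integration.integral_cong refl) (auto simp: indicator_def v_supp)
  finally show ?thesis .
qed

lemma v_tilde_eq: "v_tilde v z = (LINT x|lborel. exp (- \<i> * z * of_real x) * v x)"
  unfolding v_tilde_def by (rule integral_half_line_v) measurable

lemma integrable_bounded_v:
  assumes [measurable]: "f \<in> borel_measurable borel" and "\<And>x. 0 < x \<Longrightarrow> norm (f x) \<le> (1::real)"
  shows "integrable lborel (\<lambda>x. f x * v x)"
proof (rule Bochner_Integration.integrable_bound[OF v_L1])
  show "AE x in lborel. norm (f x * v x) \<le> norm (v x)"
  proof (rule AE_I2)
    show "norm (f x * v x) \<le> norm (v x)" for x
      using assms(2)[of x] v_supp[of x] by (cases "0 < x") (auto simp: norm_mult mult_left_le_one_le)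
  qed
qed measurable

text \<open>On the support of \<open>v\<close> one has \<open>|x + s| = x + s\<close>, so the
  exponential of the second term of \<open>Q_eq_exp\<close> separates.\<close>

lemma v_tilde_product:
  fixes k :: real
  shows "star (v_tilde v) (of_real k) * v_tilde v (- of_real k)
    = (LINT (x, s)|(lborel \<Otimes>\<^sub>M lborel). exp (\<i> * of_real k * of_real \<bar>x + s\<bar>) * (v s * cnj (v x)))"
proof -
  have i: "integrable lborel (\<lambda>x. exp (\<i> * of_real k * of_real x) * v x)" "integrable lborel (\<lambda>x. exp (- \<i> * of_real k * of_real x) * v x)"
    by (rule integrable_bounded_v; simp)+
  have c: "cnj (exp (- \<i> * of_real k * of_real x) * v x) = exp (\<i> * of_real k * of_real x) * cnj (v x)" for x :: real
    by (simp add: exp_cnj)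
  have ic: "integrable lborel (\<lambda>x. exp (\<i> * of_real k * of_real x) * cnj (v x))"
    using i(2) unfolding c[symmetric] complex_integrable_cnj .
  have "star (v_tilde v) (of_real k) = (LINT x|lborel. exp (\<i> * of_real k * of_real x) * cnj (v x))"
    unfolding star_def v_tilde_eq integral_cnj_eq[symmetric] by (simp only: complex_cnj_complex_of_real c)
  moreover have "v_tilde v (- of_real k) = (LINT x|lborel. exp (\<i> * of_real k * of_real x) * v x)"
    unfolding v_tilde_eq by simp
  ultimately have "star (v_tilde v) (of_real k) * v_tilde v (- of_real k)
    = (LINT (x, s)|(lborel \<Otimes>\<^sub>M lborel). (exp (\<i> * of_real k * of_real x) * cnj (v x)) * (exp (\<i> * of_real k * of_real s) * v s))"
    using integral_pair_times[OF ic i(1)] by simp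
  also have "\<dots> = (LINT (x, s)|(lborel \<Otimes>\<^sub>M lborel). exp (\<i> * of_real k * of_real \<bar>x + s\<bar>) * (v s * cnj (v x)))"
  proof (intro Bochner_Integration.integral_cong refl, clarify)
    fix x s :: real
    show "exp (\<i> * of_real k * of_real x) * cnj (v x) * (exp (\<i> * of_real k * of_real s) * v s) = exp (\<i> * of_real k * of_real \<bar>x + s\<bar>) * (v s * cnj (v x))"
    proof (cases "0 < x \<and> 0 < s")
      case True
      then have "\<i> * of_real k * of_real \<bar>x + s\<bar> = \<i> * of_real k * of_real x + \<i> * of_real k * of_real s" by (simp add: algebra_simps)
      then show ?thesis by (simp only: exp_add) (simp add: mult_ac)
    next
      case False
      then show ?thesis using v_supp[of x] v_supp[of s] by fastforce
    qed
  qed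
  finally show ?thesis .
qed

text \<open>The substitution \<open>x = s + y\<close> unfolds the autocorrelation; the condition
  \<open>y > 0\<close> becomes the half \<open>s < x\<close> of the quadrant.\<close>

lemma Phi11_eq:
  fixes k :: real
  shows "Phi11 v (- of_real k) = (LINT (x, s)|(lborel \<Otimes>\<^sub>M lborel).
     (if s < x then exp (\<i> * of_real k * of_real \<bar>x - s\<bar>) else 0) * (v s * cnj (v x)))"
proof -
  define e where "e = (\<lambda>y::real. if 0 < y then exp (\<i> * of_real k * of_real y) else 0)"
  have [measurable]: "e \<in> borel_measurable borel" unfolding e_def by measurable
  have ne: "norm (e y) \<le> 1" for y by (simp add: e_def)
  have g: "g11 v y = (LINT s|lborel. cnj (v (s + y)) * v s)" for y
    unfolding g11_def by (rule integral_half_line_v) measurable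
  have [measurable]: "g11 v \<in> borel_measurable borel"
    unfolding g[abs_def] by measurable
  have "Phi11 v (- of_real k) = (LINT y:{0<..}|lborel. exp (- \<i> * (- of_real k) * of_real y) * g11 v y)"
    unfolding Phi11_def by (rule set_lebesgue_lborel(2)) measurable
  also have "\<dots> = (LINT y|lborel. e y * g11 v y)"
    unfolding set_lebesgue_integral_def by (intro Bochner_Integration.integral_cong) (auto simp: e_def)
  also have "\<dots> = (LINT y|lborel. LINT s|lborel. e y * (cnj (v (s + y)) * v s))"
    unfolding g by (simp only: integral_mult_right_zero)
  also have "\<dots> = (LINT s|lborel. LINT y|lborel. e y * (cnj (v (s + y)) * v s))"
  proof (rule lborel_pair.Fubini_integral[symmetric])
    have "integrable lborel (\<lambda>x. norm (v x))" using v_L1 by simp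
    from integrable_pair_shear[OF this this, of 1]
    have "integrable (lborel \<Otimes>\<^sub>M lborel) (\<lambda>(y, s). norm (v (y + s)) * norm (v s))" by simp
    then show "integrable (lborel \<Otimes>\<^sub>M lborel) (\<lambda>(y, s). e y * (cnj (v (s + y)) * v s))"
    proof (rule Bochner_Integration.integrable_bound)
      show "AE p in lborel \<Otimes>\<^sub>M lborel. norm (case p of (y, s) \<Rightarrow> e y * (cnj (v (s + y)) * v s)) \<le> norm (case p of (y, s) \<Rightarrow> norm (v (y + s)) * norm (v s))"
        using ne by (intro AE_I2) (auto simp: norm_mult add.commute intro!: mult_left_le_one_le)
    qed measurable
  qed
  also have "\<dots> = (LINT s|lborel. LINT x|lborel. e (x - s) * (v s * cnj (v x)))"
  proof (rule Bochner_Integration.integral_cong[OF refl])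
    fix s :: real
    show "(LINT y|lborel. e y * (cnj (v (s + y)) * v s)) = (LINT x|lborel. e (x - s) * (v s * cnj (v x)))"
      using lborel_integral_real_affine[of 1 "\<lambda>x. e (x - s) * (v s * cnj (v x))" s] by (simp add: mult.commute)
  qed
  also have "\<dots> = (LINT (x, s)|(lborel \<Otimes>\<^sub>M lborel). e (x - s) * (v s * cnj (v x)))"
  proof -
    have "integrable (lborel \<Otimes>\<^sub>M lborel) (\<lambda>(x, s). e (x - s) * (v s * cnj (v x)))"
      using bounded_vv_integrable[of "\<lambda>(x, s). e (x - s)" 1] ne by simp
    from lborel_pair.integral_snd[OF this] show ?thesis by simp
  qed
  also have "\<dots> = (LINT (x, s)|(lborel \<Otimes>\<^sub>M lborel).
     (if s < x then exp (\<i> * of_real k * of_real \<bar>x - s\<bar>) else 0) * (v s * cnj (v x)))"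
    by (intro Bochner_Integration.integral_cong) (auto simp: e_def)
  finally show ?thesis .
qed

text \<open>Conjugation followed by exchanging the variables carries the half \<open>s < x\<close>
  to the half \<open>x < s\<close>, so the two terms together give the first term of
  \<open>Q_eq_exp\<close>.\<close>

lemma Phi11_sum:
  fixes k :: real
  shows "star (Phi11 v) (of_real k) + Phi11 v (- of_real k)
    = (LINT (x, s)|(lborel \<Otimes>\<^sub>M lborel). exp (\<i> * of_real k * of_real \<bar>x - s\<bar>) * (v s * cnj (v x)))"
proof -
  define P where "P = (\<lambda>(x::real, s::real). if s < x then exp (\<i> * of_real k * of_real \<bar>x - s\<bar>) else 0)"
  define P' where "P' = (\<lambda>(x::real, s::real). if x < s then exp (\<i> * of_real k * of_real \<bar>x - s\<bar>) else 0)"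
  have [measurable]: "P \<in> borel_measurable (lborel \<Otimes>\<^sub>M lborel)" "P' \<in> borel_measurable (lborel \<Otimes>\<^sub>M lborel)"
    unfolding P_def P'_def by measurable
  have iP: "integrable (lborel \<Otimes>\<^sub>M lborel) (\<lambda>(x, s). P (x, s) * (v s * cnj (v x)))"
    and iP': "integrable (lborel \<Otimes>\<^sub>M lborel) (\<lambda>(x, s). P' (x, s) * (v s * cnj (v x)))"
    by (rule bounded_vv_integrable[where B = 1]; simp add: P_def P'_def)+
  have 1: "Phi11 v (- of_real k) = (LINT (x, s)|(lborel \<Otimes>\<^sub>M lborel). P (x, s) * (v s * cnj (v x)))"
    unfolding Phi11_eq by (simp add: P_def)
  have "star (Phi11 v) (of_real k) = cnj (Phi11 v (- of_real (- k)))" by (simp add: star_def)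
  also have "\<dots> = (LINT p|(lborel \<Otimes>\<^sub>M lborel). cnj (case p of (x, s) \<Rightarrow> (if s < x then exp (\<i> * of_real (- k) * of_real \<bar>x - s\<bar>) else 0) * (v s * cnj (v x))))"
    unfolding Phi11_eq integral_cnj_eq by simp
  also have "\<dots> = (LINT p|(lborel \<Otimes>\<^sub>M lborel). (case p of (x, s) \<Rightarrow> P' (s, x) * (v x * cnj (v s))))"
    by (intro Bochner_Integration.integral_cong refl) (auto simp: P'_def exp_cnj abs_minus_commute split: prod.splits)
  also have "\<dots> = (LINT (x, s)|(lborel \<Otimes>\<^sub>M lborel). P' (x, s) * (v s * cnj (v x)))"
    using lborel_pair.integral_product_swap[of "\<lambda>(x, s). P' (x, s) * (v s * cnj (v x))"] iP' by simp
  finally have 2: "star (Phi11 v) (of_real k) = (LINT (x, s)|(lborel \<Otimes>\<^sub>M lborel). P' (x, s) * (v s * cnj (v x)))" .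
  define E where "E = (\<lambda>(x::real, s::real). exp (\<i> * of_real k * of_real \<bar>x - s\<bar>))"
  have [measurable]: "E \<in> borel_measurable (lborel \<Otimes>\<^sub>M lborel)" unfolding E_def by measurable
  have iE: "integrable (lborel \<Otimes>\<^sub>M lborel) (\<lambda>(x, s). E (x, s) * (v s * cnj (v x)))"
    by (rule bounded_vv_integrable[where B = 1]; simp add: E_def)
  have iPP: "integrable (lborel \<Otimes>\<^sub>M lborel) (\<lambda>(x, s). P' (x, s) * (v s * cnj (v x)) + P (x, s) * (v s * cnj (v x)))"
    using Bochner_Integration.integrable_add[OF iP' iP] by (simp add: split_beta')
  have "star (Phi11 v) (of_real k) + Phi11 v (- of_real k)
     = (LINT (x, s)|(lborel \<Otimes>\<^sub>M lborel). P' (x, s) * (v s * cnj (v x)) + P (x, s) * (v s * cnj (v x)))"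
    unfolding 1 2 using Bochner_Integration.integral_add[OF iP' iP] by (simp add: split_beta')
  \<comment> \<open>Iterated integrals are used to discard the diagonal: for fixed \<open>s\<close>
    only the single point \<open>x = s\<close> is missing.\<close>
  also have "\<dots> = (LINT s|lborel. LINT x|lborel. P' (x, s) * (v s * cnj (v x)) + P (x, s) * (v s * cnj (v x)))"
    by (rule lborel_pair.integral_snd[OF iPP, symmetric])
  also have "\<dots> = (LINT s|lborel. LINT x|lborel. E (x, s) * (v s * cnj (v x)))"
  proof (rule Bochner_Integration.integral_cong[OF refl], rule integral_cong_AE)
    fix s :: real
    show "AE x in lborel. P' (x, s) * (v s * cnj (v x)) + P (x, s) * (v s * cnj (v x)) = E (x, s) * (v s * cnj (v x))"
      using AE_lborel_singleton[of s] by eventually_elim (auto simp: P_def P'_def E_def)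
  qed measurable
  also have "\<dots> = (LINT (x, s)|(lborel \<Otimes>\<^sub>M lborel). E (x, s) * (v s * cnj (v x)))"
    by (rule lborel_pair.integral_snd[OF iE])
  finally show ?thesis by (simp add: E_def)
qed

text \<open>The factor \<open>- 2 * \<i> * k / \<alpha>\<close> cancels the prefactor
  \<open>\<i> / (2 * k)\<close> of \<open>Q\<close>. Off \<open>0\<close> the function
  \<open>r_fun\<close> thus has the same zeros as the boundary value of \<open>b1\<close>.\<close>

lemma r_fun_eq:
  assumes "\<alpha> \<noteq> 0" "k \<noteq> 0"
  shows "r_fun \<alpha> v k = - 2 * \<i> * of_real k / of_real \<alpha> * (1 + of_real \<alpha> * Q (of_real k))"
proof -
  define N where "N = (LINT (x, s)|(lborel \<Otimes>\<^sub>M lborel). exp (\<i> * of_real k * of_real \<bar>x - s\<bar>) * (v s * cnj (v x)))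
    - (LINT (x, s)|(lborel \<Otimes>\<^sub>M lborel). exp (\<i> * of_real k * of_real \<bar>x + s\<bar>) * (v s * cnj (v x)))"
  have "r_fun \<alpha> v k = N - 2 * \<i> * of_real k / of_real \<alpha>"
    unfolding r_fun_def Phi11_sum v_tilde_product N_def by simp
  moreover have "Q (of_real k) = \<i> / (2 * of_real k) * N" unfolding N_def using assms by (intro Q_eq_exp) auto
  moreover have "- 2 * \<i> * of_real k / of_real \<alpha> * (1 + of_real \<alpha> * (\<i> / (2 * of_real k) * N)) = N - 2 * \<i> * of_real k / of_real \<alpha>"
    using assms by (simp add: field_simps)
  ultimately show ?thesis by simp
qed

lemma Q_minus: "Q (of_real (- k)) = cnj (Q (of_real k))"
proof -
  have "cnj (Q (of_real k)) = (LINT p|(lborel \<Otimes>\<^sub>M lborel). cnj (case p of (x, s) \<Rightarrow> res_kernel (of_real k) x s * (v s * cnj (v x))))"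
    unfolding Q_def integral_cnj_eq ..
  also have "\<dots> = (LINT (x, s)|(lborel \<Otimes>\<^sub>M lborel). res_kernel (of_real (- k)) s x * (v x * cnj (v s)))"
  proof (intro Bochner_Integration.integral_cong refl, clarify)
    fix x s
    show "cnj (res_kernel (of_real k) x s * (v s * cnj (v x))) = res_kernel (of_real (- k)) s x * (v x * cnj (v s))"
      by (simp add: res_kernel_cnj res_kernel_commute[of _ x s])
  qed
  also have "\<dots> = Q (of_real (- k))"
    using lborel_pair.integral_product_swap[of "\<lambda>(x, s). res_kernel (of_real (- k)) x s * (v s * cnj (v x))"] Q_integrable[of "of_real (- k)"]
    by (simp add: Q_def)
  finally show ?thesis ..
qed

text \<open>The difference of the kernels at \<open>k\<close> and \<open>- k\<close> separates into
  \<open>2 * \<i> / k * sin (k x) * sin (k s)\<close>. Hence \<open>Im Q\<close> is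
  \<open>|S|\<^sup>2 / k\<close> for the sine transform \<open>S\<close> of \<open>v\<close>, and
  \<open>W1\<close> is \<open>- 2 * \<i> * S\<close>.\<close>

lemma norm_W1:
  assumes "k \<noteq> 0"
  shows "(cmod (W1 v k))\<^sup>2 = 4 * k * Im (Q (of_real k))"
proof -
  define S where "S = (LINT s|lborel. of_real (sin (k * s)) * v s)"
  have iS: "integrable lborel (\<lambda>s. of_real (sin (k * s)) * v s)"
    by (rule integrable_bounded_v) auto
  have cS: "cnj (of_real (sin (k * s)) * v s) = of_real (sin (k * s)) * cnj (v s)" for s by simp
  have iS': "integrable lborel (\<lambda>s. of_real (sin (k * s)) * cnj (v s))"
    using iS unfolding cS[symmetric] complex_integrable_cnj .
  have e: "exp (\<i> * of_real t) = of_real (cos t) + \<i> * of_real (sin t)" for t :: real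
    by (simp add: cis_conv_exp[symmetric] complex_eq_iff)
  have W: "W1 v k = - 2 * \<i> * S"
  proof -
    have i: "integrable lborel (\<lambda>x. exp (- \<i> * of_real k * of_real x) * v x)" "integrable lborel (\<lambda>x. exp (- \<i> * (- of_real k) * of_real x) * v x)"
      by (rule integrable_bounded_v; simp)+
    have "W1 v k = (LINT x|lborel. exp (- \<i> * of_real k * of_real x) * v x - exp (- \<i> * (- of_real k) * of_real x) * v x)"
      unfolding W1_def v_tilde_eq by (rule Bochner_Integration.integral_diff[OF i, symmetric])
    also have "\<dots> = (LINT x|lborel. - 2 * \<i> * (of_real (sin (k * x)) * v x))"
    proof (rule Bochner_Integration.integral_cong[OF refl])
      fix x
      have "exp (- \<i> * of_real k * of_real x) = of_real (cos (k * x)) - \<i> * of_real (sin (k * x))"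
        "exp (- \<i> * (- of_real k) * of_real x) = of_real (cos (k * x)) + \<i> * of_real (sin (k * x))"
        using e[of "- (k * x)"] e[of "k * x"] by (simp_all add: mult.assoc)
      then show "exp (- \<i> * of_real k * of_real x) * v x - exp (- \<i> * (- of_real k) * of_real x) * v x = - 2 * \<i> * (of_real (sin (k * x)) * v x)"
        by (simp only:) (simp add: algebra_simps)
    qed
    also have "\<dots> = - 2 * \<i> * S" unfolding S_def by (rule integral_mult_right_zero)
    finally show ?thesis .
  qed
  have K: "(res_kernel (of_real k) x s - res_kernel (of_real (- k)) x s) * (v s * cnj (v x))
    = 2 * \<i> / of_real k * ((of_real (sin (k * x)) * cnj (v x)) * (of_real (sin (k * s)) * v s))" for x s
  proof (cases "0 < x \<and> 0 < s")
    case True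
    have E: "exp (\<i> * of_real k * of_real t) - exp (\<i> * of_real (- k) * of_real t) = 2 * \<i> * of_real (sin (k * t))"
      "exp (\<i> * of_real k * of_real t) + exp (\<i> * of_real (- k) * of_real t) = 2 * of_real (cos (k * t))" for t :: real
      using e[of "- (k * t)"] e[of "k * t"] by (simp_all add: mult.assoc)
    have "res_kernel (of_real k) x s - res_kernel (of_real (- k)) x s
      = \<i> / (2 * of_real k) * ((exp (\<i> * of_real k * of_real \<bar>x - s\<bar>) + exp (\<i> * of_real (- k) * of_real \<bar>x - s\<bar>))
         - (exp (\<i> * of_real k * of_real \<bar>x + s\<bar>) + exp (\<i> * of_real (- k) * of_real \<bar>x + s\<bar>)))"
      using assms by (simp add: res_kernel_def field_simps)
    also have "\<dots> = \<i> / of_real k * of_real (cos (k * \<bar>x - s\<bar>) - cos (k * \<bar>x + s\<bar>))"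
      unfolding E using assms by (simp add: field_simps)
    also have "cos (k * \<bar>x - s\<bar>) - cos (k * \<bar>x + s\<bar>) = 2 * (sin (k * x) * sin (k * s))"
    proof -
      have "cos (k * \<bar>t\<bar>) = cos (k * t)" for t by (simp add: abs_if)
      then show ?thesis by (simp add: right_diff_distrib distrib_left cos_diff cos_add)
    qed
    finally have "res_kernel (of_real k) x s - res_kernel (of_real (- k)) x s = \<i> / of_real k * of_real (2 * (sin (k * x) * sin (k * s)))" .
    then show ?thesis by (simp add: mult_ac)
  next
    case False
    then show ?thesis using v_supp[of x] v_supp[of s] by fastforce
  qed
  have i: "integrable (lborel \<Otimes>\<^sub>M lborel) (\<lambda>(x, s). res_kernel (of_real k) x s * (v s * cnj (v x)))"
    "integrable (lborel \<Otimes>\<^sub>M lborel) (\<lambda>(x, s). res_kernel (of_real (- k)) x s * (v s * cnj (v x)))"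
    by (intro Q_integrable; simp)+
  have "Q (of_real k) - Q (of_real (- k)) = (LINT p|(lborel \<Otimes>\<^sub>M lborel). (case p of (x, s) \<Rightarrow> res_kernel (of_real k) x s * (v s * cnj (v x)))
     - (case p of (x, s) \<Rightarrow> res_kernel (of_real (- k)) x s * (v s * cnj (v x))))"
    unfolding Q_def by (rule Bochner_Integration.integral_diff[OF i, symmetric])
  also have "\<dots> = (LINT p|(lborel \<Otimes>\<^sub>M lborel). 2 * \<i> / of_real k * (case p of (x, s) \<Rightarrow> (of_real (sin (k * x)) * cnj (v x)) * (of_real (sin (k * s)) * v s)))"
  proof (intro Bochner_Integration.integral_cong refl)
    fix p :: "real \<times> real"
    show "(case p of (x, s) \<Rightarrow> res_kernel (of_real k) x s * (v s * cnj (v x)))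
     - (case p of (x, s) \<Rightarrow> res_kernel (of_real (- k)) x s * (v s * cnj (v x)))
     = 2 * \<i> / of_real k * (case p of (x, s) \<Rightarrow> (of_real (sin (k * x)) * cnj (v x)) * (of_real (sin (k * s)) * v s))"
      using K[of "fst p" "snd p"] by (simp add: split_beta' left_diff_distrib)
  qed
  also have "\<dots> = 2 * \<i> / of_real k * (LINT (x, s)|(lborel \<Otimes>\<^sub>M lborel). (of_real (sin (k * x)) * cnj (v x)) * (of_real (sin (k * s)) * v s))"
    by (rule integral_mult_right_zero)
  also have "\<dots> = 2 * \<i> / of_real k * ((LINT x|lborel. of_real (sin (k * x)) * cnj (v x)) * S)"
    unfolding S_def by (subst integral_pair_times[OF iS' iS]) (rule refl)
  also have "(LINT x|lborel. of_real (sin (k * x)) * cnj (v x)) = cnj S"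
    unfolding S_def integral_cnj_eq[symmetric] cS ..
  finally have "Q (of_real k) - cnj (Q (of_real k)) = 2 * \<i> / of_real k * (cnj S * S)" by (simp only: Q_minus)
  also have "cnj S * S = of_real ((cmod S)\<^sup>2)" by (subst complex_norm_square) (rule mult.commute)
  finally have "2 * \<i> * of_real (Im (Q (of_real k))) = 2 * \<i> / of_real k * of_real ((cmod S)\<^sup>2)"
    by (simp only: complex_diff_cnj) (simp add: mult_ac)
  then have "Im (Q (of_real k)) = (cmod S)\<^sup>2 / k" by (simp add: complex_eq_iff)
  then show ?thesis using assms by (simp add: W norm_mult power_mult_distrib)
qed

lemma B_eq: "B_plus \<alpha> v k = 1 + of_real \<alpha> * Q (of_real k)" "B_minus \<alpha> v k = 1 + of_real \<alpha> * Q (of_real (- k))"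
proof -
  have lim: "((\<lambda>\<epsilon>. 1 + of_real \<alpha> * Q (of_real k + \<i> * of_real \<epsilon>)) \<longlongrightarrow> 1 + of_real \<alpha> * Q (of_real k)) (at_right 0)" for k
  proof (intro tendsto_intros)
    have "(Q \<longlongrightarrow> Q (of_real k)) (at (of_real k) within {l. 0 \<le> Im l})" using Q_continuous by (simp add: continuous_on_def)
    then show "((\<lambda>\<epsilon>. Q (of_real k + \<i> * of_real \<epsilon>)) \<longlongrightarrow> Q (of_real k)) (at_right 0)"
      by (rule filterlim_compose)
         (auto simp: filterlim_at eventually_at_filter intro!: tendsto_eq_intros always_eventually)
  qed
  have "((\<lambda>\<epsilon>. b1 \<alpha> v ((of_real k + \<i> * of_real \<epsilon>)\<^sup>2)) \<longlongrightarrow> 1 + of_real \<alpha> * Q (of_real k)) (at_right 0)"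
    by (rule Lim_transform_eventually[OF lim])
       (use eventually_at_right_less[of 0] in \<open>eventually_elim, simp add: b1_eq\<close>)
  then show "B_plus \<alpha> v k = 1 + of_real \<alpha> * Q (of_real k)" unfolding B_plus_def by (intro tendsto_Lim) auto
  \<comment> \<open>Since \<open>b1\<close> is evaluated at a square, approaching \<open>k\<close>
    from below amounts to approaching \<open>- k\<close> from above.\<close>
  have sq: "(of_real k - \<i> * of_real \<epsilon>)\<^sup>2 = (of_real (- k) + \<i> * of_real \<epsilon>)\<^sup>2" for \<epsilon> by (simp add: power2_eq_square algebra_simps)
  have "((\<lambda>\<epsilon>. b1 \<alpha> v ((of_real k - \<i> * of_real \<epsilon>)\<^sup>2)) \<longlongrightarrow> 1 + of_real \<alpha> * Q (of_real (- k))) (at_right 0)"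
    unfolding sq by (rule Lim_transform_eventually[OF lim])
       (use eventually_at_right_less[of 0] in \<open>eventually_elim, subst b1_eq, simp_all\<close>)
  then show "B_minus \<alpha> v k = 1 + of_real \<alpha> * Q (of_real (- k))" unfolding B_minus_def by (intro tendsto_Lim) auto
qed

end

section \<open>The scattering formula\<close>

text \<open>Zeros are excluded by three different reasons: the sign of \<alpha> in the open half
  plane, the assumption on \<open>r_fun\<close> on the real axis off \<open>0\<close>, and
  \<open>Re_Q_0\<close> at \<open>0\<close>.\<close>

lemma (in form_factor) B_plus_logarithm:
  assumes \<alpha>: "0 < \<alpha>" and r: "\<And>k. k \<noteq> 0 \<Longrightarrow> r_fun \<alpha> v k \<noteq> 0"
  obtains L D R where "continuous_on {z. 0 \<le> Im z} L" "L holomorphic_on {z. 0 < Im z}"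
    "\<And>k. B_plus \<alpha> v k = exp (L (of_real k))" "0 < R"
    "\<And>z. 0 \<le> Im z \<Longrightarrow> R \<le> norm z \<Longrightarrow> norm (L z) \<le> D / norm z"
proof -
  define F where "F = (\<lambda>z. 1 + of_real \<alpha> * Q z)"
  have c: "continuous_on {z. 0 \<le> Im z} F" unfolding F_def by (intro continuous_intros Q_continuous)
  have h: "F holomorphic_on {z. 0 < Im z}" unfolding F_def by (intro holomorphic_intros Q_holomorphic)
  have nz: "F z \<noteq> 0" if "0 \<le> Im z" for z
  proof (cases "0 < Im z")
    case True
    then show ?thesis unfolding F_def using Q_nonresonant \<alpha> by blast
  next
    case False
    then have z: "z = of_real (Re z)" using that by (simp add: complex_eq_iff)
    show ?thesis
    proof (cases "Re z = 0")
      case True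
      have "0 < 1 + \<alpha> * Re (Q 0)" using \<alpha> Re_Q_0 by (simp add: add_pos_nonneg)
      then have "Re (F 0) \<noteq> 0" by (simp add: F_def)
      then show ?thesis using z True by auto
    next
      case False
      then show ?thesis using r[OF False] r_fun_eq[of \<alpha> "Re z"] \<alpha> z by (auto simp: F_def)
    qed
  qed
  define M where "M = \<alpha> * (LINT (x, s)|(lborel \<Otimes>\<^sub>M lborel). norm (v s * cnj (v x)))"
  have d: "norm (F z - 1) \<le> M / norm z" if "0 \<le> Im z" "z \<noteq> 0" for z
    using mult_left_mono[OF norm_Q_le[OF that], of \<alpha>] \<alpha> by (simp add: F_def M_def norm_mult)
  from half_plane_logarithm[OF c h nz d] obtain L D R where
    "continuous_on {z. 0 \<le> Im z} L" "L holomorphic_on {z. 0 < Im z}" "\<And>z. 0 \<le> Im z \<Longrightarrow> exp (L z) = F z" "0 < R"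
    "\<And>z. 0 \<le> Im z \<Longrightarrow> R \<le> norm z \<Longrightarrow> norm (L z) \<le> D / norm z"
    by metis
  then show ?thesis using that[of L R D] by (simp add: B_eq F_def)
qed

text \<open>Two branches differ by a continuous function with values in the multiples of
  \<open>2 * pi\<close>, hence by a constant, and the limit at infinity makes it \<open>0\<close>.
  This justifies the definite description in \<open>zeta\<close>.\<close>

lemma arg_branch_unique:
  assumes "arg_branch F \<zeta>" "arg_branch F \<xi>" and nz: "\<And>k. F k \<noteq> 0"
  shows "\<zeta> = \<xi>"
proof -
  have c: "continuous_on UNIV \<zeta>" "continuous_on UNIV \<xi>"
    and F: "F k = of_real (cmod (F k)) * cis (\<zeta> k)" "F k = of_real (cmod (F k)) * cis (\<xi> k)"
    and lim: "(\<zeta> \<longlongrightarrow> 0) at_infinity" "(\<xi> \<longlongrightarrow> 0) at_infinity" for k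
    using assms(1,2) unfolding arg_branch_def by blast+
  have "(\<lambda>k. \<i> * of_real (\<zeta> k - \<xi> k)) constant_on UNIV"
  proof (rule exp_eq_one_constant)
    show "continuous_on UNIV (\<lambda>k. \<i> * complex_of_real (\<zeta> k - \<xi> k))" by (intro continuous_intros c)
    fix k
    have "of_real (cmod (F k)) * cis (\<zeta> k) = of_real (cmod (F k)) * cis (\<xi> k)" using F by metis
    then have "cis (\<zeta> k) = cis (\<xi> k)" using nz[of k] by simp
    then have "cis (\<zeta> k - \<xi> k) = 1" by (simp flip: cis_divide)
    then show "exp (\<i> * of_real (\<zeta> k - \<xi> k)) = 1" by (simp add: cis_conv_exp)
  qed simp
  then obtain d where "\<And>k. \<i> * complex_of_real (\<zeta> k - \<xi> k) = d" unfolding constant_on_def by auto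
  then have d: "\<zeta> k - \<xi> k = Im d" for k by (metis Im_i_times Re_complex_of_real)
  have "((\<lambda>k. \<zeta> k - \<xi> k) \<longlongrightarrow> 0 - 0) at_infinity" by (intro tendsto_diff lim)
  then have "Im d = 0" unfolding d diff_self by (rule tendsto_unique[OF trivial_limit_at_infinity tendsto_const])
  then show ?thesis using d by (simp add: fun_eq_iff)
qed

theorem (in form_factor) scattering_formula:
  assumes \<alpha>: "0 < \<alpha>" and r: "\<And>k. k \<noteq> 0 \<Longrightarrow> r_fun \<alpha> v k \<noteq> 0"
  shows "(\<forall>k. k \<noteq> 0 \<longrightarrow>
            S1 \<alpha> v k = B_minus \<alpha> v k / B_plus \<alpha> v k \<and>
            S1 \<alpha> v k = exp (- 2 * \<i> * of_real (zeta \<alpha> v k))) \<and>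
         (\<forall>k. \<exists>I. has_pv_integral (\<lambda>t. zeta \<alpha> v t / (t - k)) k I \<and>
            (cmod (W1 v k))\<^sup>2 = 4 * k / \<alpha> * sin (zeta \<alpha> v k) * exp (1 / pi * I))"
proof -
  obtain L D R where L: "continuous_on {z. 0 \<le> Im z} L" "L holomorphic_on {z. 0 < Im z}"
    "\<And>k. B_plus \<alpha> v k = exp (L (of_real k))" "0 < R"
    "\<And>z. 0 \<le> Im z \<Longrightarrow> R \<le> norm z \<Longrightarrow> norm (L z) \<le> D / norm z"
    using B_plus_logarithm[OF assms] by metis
  define \<zeta> where "\<zeta> = (\<lambda>k::real. Im (L (of_real k)))"
  have branch: "arg_branch (B_plus \<alpha> v) \<zeta>" unfolding arg_branch_def
  proof (intro conjI allI)
    show "continuous_on UNIV \<zeta>" unfolding \<zeta>_def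
      by (intro continuous_intros continuous_on_compose2[OF L(1)]) auto
    show "B_plus \<alpha> v k = of_real (cmod (B_plus \<alpha> v k)) * cis (\<zeta> k)" for k
      by (simp add: L(3) \<zeta>_def exp_eq_polar norm_mult)
    show "(\<zeta> \<longlongrightarrow> 0) at_infinity"
    proof (rule Lim_null_comparison)
      show "\<forall>\<^sub>F k in at_infinity. norm (\<zeta> k) \<le> D * norm (inverse k)"
        unfolding eventually_at_infinity
      proof (intro exI allI impI)
        fix k :: real assume "R \<le> norm k"
        then have "norm (L (of_real k)) \<le> D / norm k" using L(5)[of "of_real k"] by simp
        then show "norm (\<zeta> k) \<le> D * norm (inverse k)"
          using abs_Im_le_cmod[of "L (of_real k)"] by (simp add: \<zeta>_def divide_inverse)
      qed
      show "((\<lambda>k. D * norm (inverse k :: real)) \<longlongrightarrow> 0) at_infinity"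
        by (intro tendsto_mult_right_zero tendsto_norm_zero tendsto_inverse_0)
    qed
  qed
  have zeta: "zeta \<alpha> v = \<zeta>" unfolding zeta_def
    using branch arg_branch_unique by (intro the_equality) (auto simp: L(3))
  have Bm: "B_minus \<alpha> v k = cnj (B_plus \<alpha> v k)" for k by (simp only: B_eq Q_minus) simp
  have "S1 \<alpha> v k = B_minus \<alpha> v k / B_plus \<alpha> v k \<and> S1 \<alpha> v k = exp (- 2 * \<i> * of_real (zeta \<alpha> v k))" if "k \<noteq> 0" for k
  proof
    have r': "r_fun \<alpha> v k = - 2 * \<i> * of_real k / of_real \<alpha> * B_plus \<alpha> v k"
      "r_fun \<alpha> v (- k) = 2 * \<i> * of_real k / of_real \<alpha> * B_minus \<alpha> v k"
      using r_fun_eq[of \<alpha> k] r_fun_eq[of \<alpha> "- k"] \<alpha> that by (simp_all add: B_eq)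
    show S: "S1 \<alpha> v k = B_minus \<alpha> v k / B_plus \<alpha> v k"
      unfolding S1_def r' using \<alpha> that L(3)[of k] by simp
    have "B_minus \<alpha> v k / B_plus \<alpha> v k = exp (cnj (L (of_real k)) - L (of_real k))"
      by (simp add: Bm L(3) exp_cnj exp_diff)
    also have "cnj (L (of_real k)) - L (of_real k) = - 2 * \<i> * of_real (zeta \<alpha> v k)"
      by (simp add: zeta \<zeta>_def complex_eq_iff)
    finally show "S1 \<alpha> v k = exp (- 2 * \<i> * of_real (zeta \<alpha> v k))" using S by simp
  qed
  moreover have "\<exists>I. has_pv_integral (\<lambda>t. zeta \<alpha> v t / (t - k)) k I \<and>
            (cmod (W1 v k))\<^sup>2 = 4 * k / \<alpha> * sin (zeta \<alpha> v k) * exp (1 / pi * I)" for k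
  proof (intro exI conjI)
    show "has_pv_integral (\<lambda>t. zeta \<alpha> v t / (t - k)) k (pi * Re (L (of_real k)))"
      unfolding zeta \<zeta>_def by (rule pv_integral_half_plane[OF L(1,2,4,5)])
    show "(cmod (W1 v k))\<^sup>2 = 4 * k / \<alpha> * sin (zeta \<alpha> v k) * exp (1 / pi * (pi * Re (L (of_real k))))"
    \<comment> \<open>\<open>norm_W1\<close> requires \<open>k \<noteq> 0\<close>; at
      \<open>k = 0\<close> both sides are \<open>0\<close>.\<close>
    proof (cases "k = 0")
      case False
      have "\<alpha> * Im (Q (of_real k)) = Im (B_plus \<alpha> v k)" by (simp add: B_eq)
      also have "\<dots> = exp (Re (L (of_real k))) * sin (zeta \<alpha> v k)" by (simp add: L(3) zeta \<zeta>_def Im_exp)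
      finally show ?thesis using norm_W1[OF False] \<alpha> by (simp add: field_simps)
    qed (simp add: W1_def)
  qed
  ultimately show ?thesis by blast
qed

section \<open>Passage from Lebesgue measurable to Borel form factors\<close>

lemma lebesgue_measurable_cong_AE:
  fixes f g :: "real \<Rightarrow> complex"
  assumes "f \<in> borel_measurable lebesgue" "AE x in lebesgue. f x = g x"
  shows "g \<in> borel_measurable lebesgue"
proof (rule measurableI)
  fix A :: "complex set" assume "A \<in> sets borel"
  then have A: "f -` A \<inter> space lebesgue \<in> sets lebesgue" using assms(1) by (rule measurable_sets[rotated])
  have "AE x in lebesgue. x \<in> f -` A \<inter> space lebesgue \<longleftrightarrow> x \<in> g -` A \<inter> space lebesgue"
    using assms(2) by eventually_elim simp
  then show "g -` A \<inter> space lebesgue \<in> sets lebesgue"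
    by (rule completion.in_sets_AE[OF _ A]) (rule Int_lower2)
qed simp

text \<open>No measurability is assumed, so that integrands built from choice operators are covered:
  by completeness either both integrands are measurable, or neither is and both integrals take the
  default value \<open>0\<close>.\<close>

lemma lebesgue_integral_cong_AE:
  fixes f g :: "real \<Rightarrow> complex"
  assumes ae: "AE x in lebesgue. 0 < x \<longrightarrow> f x = g x"
  shows "(LINT x:{0<..}|lebesgue. f x) = (LINT x:{0<..}|lebesgue. g x)"
proof -
  let ?f = "\<lambda>x. indicator {0<..} x *\<^sub>R f x" and ?g = "\<lambda>x. indicator {0<..} x *\<^sub>R g x"
  have fg: "AE x in lebesgue. ?f x = ?g x" using ae by eventually_elim (auto simp: indicator_def)
  have gf: "AE x in lebesgue. ?g x = ?f x" using fg by (rule AE_symmetric)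
  show ?thesis unfolding set_lebesgue_integral_def
  proof (cases "?f \<in> borel_measurable lebesgue")
    case True
    then show "integral\<^sup>L lebesgue ?f = integral\<^sup>L lebesgue ?g"
      using lebesgue_measurable_cong_AE[OF True fg] fg by (rule integral_cong_AE)
  next
    case False
    then have "?g \<notin> borel_measurable lebesgue" using lebesgue_measurable_cong_AE[OF _ gf] by auto
    then have n: "\<not> integrable lebesgue ?f" "\<not> integrable lebesgue ?g"
      using False borel_measurable_integrable[of lebesgue ?f] borel_measurable_integrable[of lebesgue ?g] by auto
    show "integral\<^sup>L lebesgue ?f = integral\<^sup>L lebesgue ?g"
      unfolding not_integrable_integral_eq[OF n(1)] not_integrable_integral_eq[OF n(2)] ..
  qed
qed

text \<open>\<open>R0\<close> sees \<open>v\<close> only through an almost everywhere equation, so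
  the predicate under \<open>SOME\<close> is the same for both and the chosen functions are equal
  outright. For \<open>g11\<close> the exceptional set is also translated, and stays
  negligible.\<close>

lemma form_factor_cong_AE:
  assumes ae: "AE x in lebesgue. 0 < x \<longrightarrow> v x = w x"
  shows "b1 \<alpha> v = b1 \<alpha> w" "v_tilde v = v_tilde w" "Phi11 v = Phi11 w"
proof -
  have "R0 z v = R0 z w" for z
  proof -
    have "(AE x in lebesgue. 0 < x \<longrightarrow> L0 y x - z * y x = v x) \<longleftrightarrow> (AE x in lebesgue. 0 < x \<longrightarrow> L0 y x - z * y x = w x)" for y
    proof
      show "AE x in lebesgue. 0 < x \<longrightarrow> L0 y x - z * y x = w x" if "AE x in lebesgue. 0 < x \<longrightarrow> L0 y x - z * y x = v x"
        using that ae by eventually_elim auto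
      show "AE x in lebesgue. 0 < x \<longrightarrow> L0 y x - z * y x = v x" if "AE x in lebesgue. 0 < x \<longrightarrow> L0 y x - z * y x = w x"
        using that ae by eventually_elim auto
    qed
    then show ?thesis unfolding R0_def by simp
  qed
  then show "b1 \<alpha> v = b1 \<alpha> w"
    unfolding b1_def inner_half_def fun_eq_iff
    by (auto intro!: lebesgue_integral_cong_AE eventually_mono[OF ae])
  show "v_tilde v = v_tilde w"
    unfolding v_tilde_def fun_eq_iff by (auto intro!: lebesgue_integral_cong_AE eventually_mono[OF ae])
  have "g11 v y = g11 w y" if "0 < y" for y
    unfolding g11_def
  proof (rule lebesgue_integral_cong_AE)
    obtain N where N: "negligible N" "{x. \<not> (0 < x \<longrightarrow> v x = w x)} \<subseteq> N"
      using ae unfolding eventually_ae_filter_negligible by blast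
    have "AE x in lebesgue. 0 < x \<longrightarrow> v (x + y) = w (x + y)"
      unfolding eventually_ae_filter_negligible
    proof (intro exI conjI)
      show "negligible ((+) (- y) ` N)" by (rule negligible_translation[OF N(1)])
      show "{x. \<not> (0 < x \<longrightarrow> v (x + y) = w (x + y))} \<subseteq> (+) (- y) ` N"
      proof
        fix x assume "x \<in> {x. \<not> (0 < x \<longrightarrow> v (x + y) = w (x + y))}"
        then have "x + y \<in> N" using N(2) that by auto
        then show "x \<in> (+) (- y) ` N" by (rule rev_image_eqI) simp
      qed
    qed
    with ae show "AE x in lebesgue. 0 < x \<longrightarrow> cnj (v (x + y)) * v x = cnj (w (x + y)) * w x"
      by eventually_elim auto
  qed
  then show "Phi11 v = Phi11 w"
    unfolding Phi11_def fun_eq_iff by (auto intro!: lebesgue_integral_cong_AE)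
qed

lemma ex_form_factor_AE_eq:
  assumes v_meas: "set_borel_measurable lebesgue {0<..} v"
    and v_int: "set_integrable lebesgue {0<..} (\<lambda>x. (1 + x\<^sup>2) * (cmod (v x))\<^sup>2)"
  obtains w where "form_factor w" "AE x in lebesgue. 0 < x \<longrightarrow> v x = w x"
proof -
  let ?g = "\<lambda>x. indicator {0<..} x *\<^sub>R v x"
  obtain g' where g': "g' \<in> borel_measurable lborel" "AE x in lborel. ?g x = g' x"
    using completion_ex_borel_measurable_complex[of ?g lborel] v_meas unfolding set_borel_measurable_def by blast
  define w where "w = (\<lambda>x. indicator {0<..} x *\<^sub>R g' x)"
  have [measurable]: "g' \<in> borel_measurable borel" using g'(1) by simp
  have wm[measurable]: "w \<in> borel_measurable borel" unfolding w_def by measurable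
  have ae: "AE x in lebesgue. 0 < x \<longrightarrow> v x = w x"
    using AE_completion[OF g'(2)] by eventually_elim (auto simp: w_def)
  have m: "(\<lambda>x. (1 + x\<^sup>2) * (cmod (w x))\<^sup>2) \<in> borel_measurable lborel" by measurable
  have "integrable lebesgue (\<lambda>x. (1 + x\<^sup>2) * (cmod (w x))\<^sup>2)"
  proof (rule integrable_cong_AE_imp)
    show "integrable lebesgue (\<lambda>x. indicator {0<..} x *\<^sub>R ((1 + x\<^sup>2) * (cmod (v x))\<^sup>2))"
      using v_int by (simp add: set_integrable_def)
    show "AE x in lebesgue. indicator {0<..} x *\<^sub>R ((1 + x\<^sup>2) * (cmod (v x))\<^sup>2) = (1 + x\<^sup>2) * (cmod (w x))\<^sup>2"
      using ae by eventually_elim (auto simp: w_def indicator_def)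
  qed (rule measurable_completion[OF m])
  then have "integrable lborel (\<lambda>x. (1 + x\<^sup>2) * (cmod (w x))\<^sup>2)" using m by (simp add: integrable_completion)
  then have "form_factor w" using wm by unfold_locales (auto simp: w_def)
  then show ?thesis using ae by (rule that)
qed

theorem theorem4p1:
  fixes \<alpha> :: real and v :: "real \<Rightarrow> complex"
  assumes v_meas: "set_borel_measurable lebesgue {0<..} v"
    and v_int: "set_integrable lebesgue {0<..} (\<lambda>x. (1 + x\<^sup>2) * (cmod (v x))\<^sup>2)"
    and v_nonzero: "\<not> (AE x in lebesgue. 0 < x \<longrightarrow> v x = 0)"
    and alpha_pos: "\<alpha> > 0"
    and r_nonzero: "\<And>k. k \<noteq> 0 \<Longrightarrow> r_fun \<alpha> v k \<noteq> 0"
  shows "(\<forall>k. k \<noteq> 0 \<longrightarrow>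
            S1 \<alpha> v k = B_minus \<alpha> v k / B_plus \<alpha> v k \<and>
            S1 \<alpha> v k = exp (- 2 * \<i> * of_real (zeta \<alpha> v k))) \<and>
         (\<forall>k. \<exists>I. has_pv_integral (\<lambda>t. zeta \<alpha> v t / (t - k)) k I \<and>
            (cmod (W1 v k))\<^sup>2 = 4 * k / \<alpha> * sin (zeta \<alpha> v k) * exp (1 / pi * I))"
proof -
  \<comment> \<open>Every quantity in the claim depends only on the almost everywhere class of
    \<open>v\<close> on the half-line, so the Borel representative may replace it.\<close>
  obtain w where w: "form_factor w" "AE x in lebesgue. 0 < x \<longrightarrow> v x = w x"
    using ex_form_factor_AE_eq[OF v_meas v_int] .
  note e = form_factor_cong_AE[OF w(2)]
  have r: "r_fun \<alpha> v = r_fun \<alpha> w" by (simp add: fun_eq_iff r_fun_def e)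
  have B: "B_plus \<alpha> v = B_plus \<alpha> w" "B_minus \<alpha> v = B_minus \<alpha> w"
    by (simp_all add: fun_eq_iff B_plus_def B_minus_def e)
  have S: "S1 \<alpha> v = S1 \<alpha> w" "zeta \<alpha> v = zeta \<alpha> w" "W1 v = W1 w"
    by (simp_all add: fun_eq_iff S1_def zeta_def W1_def r B e)
  show ?thesis unfolding S B
    by (rule form_factor.scattering_formula[OF w(1) alpha_pos]) (use r_nonzero r in simp)
qed

end
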